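(* Fix an integer $d\ge 1$. There exist $k_d$ and $\beta_d>0$ such that for every constant integer $k\ge k_d$, \[\lim_{n\to\infty}\mathbb{P}\big(\mathfrak{h}(K_{n,d,k})\ge \beta_d\big)=1,\] where $K_{n,d,k}=\bigcup_{i=1}^k T^i_{n,d}$ is the union of $k$ independent $d$-dimensional determinantal hypertrees on the vertex set $[n]$.
   Context: A $d$-dimensional simplicial complex $T$ on vertex set $[n]=\{1,\dots,n\}$ is a hypertree if it has complete $(d-1)$-skeleton, has exactly $\binom{n-1}{d}$ faces of dimension $d$, and its integral homology group $H_{d-1}(T)$ is finite. By Kalai's formula $\sum_T |H_{d-1}(T)|^2=n^{\binom{n-2}{d}}$ (sum over all hypertrees on $[n]$). The determinantal hypertree $T_{n,d}$ is the random hypertree with $\mathbb{P}(T_{n,d}=T)=|H_{d-1}(T)|^2/n^{\binom{n-2}{d}}$. $T^1_{n,d},\dots,T^k_{n,d}$ are i.i.d. copies of $T_{n,d}$, and $K_{n,d,k}$ is the complex with complete $(d-1)$-skeleton on $[n]$ whose $d$-faces are the union of the $d$-faces of the $T^i_{n,d}$. Coboundary expansion: for a $d$-dimensional complex $K$ and $0\le i\le d$, let $K(i)$ be its set of $i$-faces, $C^i(K,\mathbb{F}_2)$ the $\mathbb{F}_2$-valued functions on $K(i)$, $\delta_i:C^i(K,\mathbb{F}_2)\to C^{i+1}(K,\mathbb{F}_2)$ the usual coboundary map, and $B^i(K,\mathbb{F}_2)=\operatorname{Im}\delta_{i-1}$. The weight of an $i$-face $\sigma$ is $w(\sigma)=\frac{|\{\tau\in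 K(d):\sigma\subset\tau\}|}{\binom{d+1}{i+1}|K(d)|}$; for $f\in C^i(K,\mathbb{F}_2)$, $\|f\|=\sum_{\sigma\in\operatorname{supp} f}w(\sigma)$, and $\|f+B^i\|=\min_{g\in f+B^i(K,\mathbb{F}_2)}\|g\|$. For $0\le i\le d-1$, $\mathfrak{h}_i(K)=\min_{f\in C^i(K,\mathbb{F}_2)\setminus B^i(K,\mathbb{F}_2)}\frac{\|\delta_i f\|}{\|f+B^i(K,\mathbb{F}_2)\|}$, and $\mathfrak{h}(K)=\min_{0\le i\le d-1}\mathfrak{h}_i(K)$. *)

theory Defs
  imports
    "HOL-Probability.Probability"
    "HOL-Algebra.Free_Abelian_Groups"
    "HOL-Library.Z2"
begin

text \<open>
  A complex is its set of faces, the empty face included.  Dimensions are integers and start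
  at -1 (the empty face), so homology and cohomology are reduced: this is what makes
  \<open>H\<^sub>0\<close> of a tree finite and makes \<open>B\<^sup>0\<close> the space of constant functions.
\<close>

definition simplicial_complex :: "'a set \<Rightarrow> 'a set set \<Rightarrow> bool" where
  "simplicial_complex V K \<longleftrightarrow>
     {} \<in> K \<and> (\<forall>\<sigma>\<in>K. finite \<sigma> \<and> \<sigma> \<subseteq> V \<and> Pow \<sigma> \<subseteq> K)"

definition faces :: "'a set set \<Rightarrow> int \<Rightarrow> 'a set set" where
  "faces K i = {\<sigma> \<in> K. finite \<sigma> \<and> int (card \<sigma>) = i + 1}"

definition has_dimension :: "'a set set \<Rightarrow> nat \<Rightarrow> bool" where
  "has_dimension K d \<longleftrightarrow> faces K (int d) \<noteq> {} \<and> (\<forall>i > int d. faces K i = {})"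

definition complete_skeleton :: "'a set \<Rightarrow> int \<Rightarrow> 'a set set" where
  "complete_skeleton V i = {\<sigma>. finite \<sigma> \<and> \<sigma> \<subseteq> V \<and> int (card \<sigma>) \<le> i + 1}"

subsection \<open>Reduced integral homology\<close>

definition simplicial_boundary :: "('a::linorder set \<Rightarrow>\<^sub>0 int) \<Rightarrow> ('a set \<Rightarrow>\<^sub>0 int)" where
  "simplicial_boundary =
     frag_extend (\<lambda>\<sigma>. \<Sum>j<card \<sigma>.
       frag_cmul ((-1) ^ j) (frag_of (\<sigma> - {sorted_list_of_set \<sigma> ! j})))"

definition simplicial_chain_group :: "'a set set \<Rightarrow> int \<Rightarrow> ('a set \<Rightarrow>\<^sub>0 int) monoid" where
  "simplicial_chain_group K i = free_Abelian_group (faces K i)"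

definition simplicial_cycles :: "'a::linorder set set \<Rightarrow> int \<Rightarrow> ('a set \<Rightarrow>\<^sub>0 int) set" where
  "simplicial_cycles K i = {c \<in> carrier (simplicial_chain_group K i). simplicial_boundary c = 0}"

definition simplicial_boundaries :: "'a::linorder set set \<Rightarrow> int \<Rightarrow> ('a set \<Rightarrow>\<^sub>0 int) set" where
  "simplicial_boundaries K i = simplicial_boundary ` carrier (simplicial_chain_group K (i + 1))"

definition simplicial_homology_group ::
    "int \<Rightarrow> 'a::linorder set set \<Rightarrow> ('a set \<Rightarrow>\<^sub>0 int) set monoid" where
  "simplicial_homology_group i K =
     subgroup_generated (simplicial_chain_group K i) (simplicial_cycles K i)
       Mod simplicial_boundaries K i"

subsection \<open>Determinantal hypertrees\<close>

definition hypertree :: "nat \<Rightarrow> nat \<Rightarrow> nat set set \<Rightarrow> bool" where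
  "hypertree n d T \<longleftrightarrow>
     simplicial_complex {1..n} T \<and>
     has_dimension T d \<and>
     complete_skeleton {1..n} (int d - 1) \<subseteq> T \<and>
     card (faces T (int d)) = (n - 1) choose d \<and>
     finite (carrier (simplicial_homology_group (int d - 1) T))"

text \<open>
  The total mass is 1 for large \<open>n\<close> by Kalai's formula.
\<close>

definition determinantal_hypertree :: "nat \<Rightarrow> nat \<Rightarrow> nat set set measure" where
  "determinantal_hypertree n d =
     point_measure {T. hypertree n d T}
       (\<lambda>T. ennreal (real (order (simplicial_homology_group (int d - 1) T)) ^ 2
                      / real n ^ ((n - 2) choose d)))"

definition iid_determinantal_hypertrees ::
    "nat \<Rightarrow> nat \<Rightarrow> nat \<Rightarrow> (nat \<Rightarrow> nat set set) measure" where
  "iid_determinantal_hypertrees n d k = (\<Pi>\<^sub>M j\<in>{1..k}. determinantal_hypertree n d)"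

definition hypertree_union :: "nat \<Rightarrow> nat \<Rightarrow> nat \<Rightarrow> (nat \<Rightarrow> nat set set) \<Rightarrow> nat set set" where
  "hypertree_union n d k T =
     complete_skeleton {1..n} (int d - 1) \<union> (\<Union>j\<in>{1..k}. faces (T j) (int d))"

lemma hypertree_union_eq_UN:
  assumes "k \<ge> 1" and "\<And>j. j \<in> {1..k} \<Longrightarrow> hypertree n d (T j)"
  shows "hypertree_union n d k T = (\<Union>j\<in>{1..k}. T j)"
proof -
  have *: "T j = complete_skeleton {1..n} (int d - 1) \<union> faces (T j) (int d)"
    if "j \<in> {1..k}" for j
  proof -
    have h: "simplicial_complex {1..n} (T j)" "has_dimension (T j) d"
      "complete_skeleton {1..n} (int d - 1) \<subseteq> T j"
      using assms(2)[OF that] by (auto simp: hypertree_def)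
    have "\<sigma> \<in> complete_skeleton {1..n} (int d - 1) \<union> faces (T j) (int d)"
      if s: "\<sigma> \<in> T j" for \<sigma>
    proof -
      have f: "finite \<sigma>" "\<sigma> \<subseteq> {1..n}" using h(1) s by (auto simp: simplicial_complex_def)
      have "\<sigma> \<in> faces (T j) (int (card \<sigma>) - 1)" using s f by (simp add: faces_def)
      then have "int (card \<sigma>) - 1 \<le> int d"
        using h(2) by (force simp: has_dimension_def)
      then show ?thesis using s f by (auto simp: faces_def complete_skeleton_def)
    qed
    then show ?thesis using h(3) by (auto simp: faces_def)
  qed
  have "(\<Union>j\<in>{1..k}. T j) =
      (\<Union>j\<in>{1..k}. complete_skeleton {1..n} (int d - 1) \<union> faces (T j) (int d))"
    using * by (intro SUP_cong) auto
  also have "\<dots> = hypertree_union n d k T"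
    using assms(1) by (auto simp: hypertree_union_def)
  finally show ?thesis by simp
qed

subsection \<open>Coboundary expansion over the field with two elements\<close>

text \<open>
  Functions on \<open>faces K i\<close> are represented by their extension by zero.
\<close>

definition cochains :: "'a set set \<Rightarrow> int \<Rightarrow> ('a set \<Rightarrow> bit) set" where
  "cochains K i = {f. \<forall>\<sigma>. \<sigma> \<notin> faces K i \<longrightarrow> f \<sigma> = 0}"

definition coboundary :: "'a set set \<Rightarrow> int \<Rightarrow> ('a set \<Rightarrow> bit) \<Rightarrow> ('a set \<Rightarrow> bit)" where
  "coboundary K i f =
     (\<lambda>\<tau>. if \<tau> \<in> faces K (i + 1) then \<Sum>\<sigma> | \<sigma> \<in> faces K i \<and> \<sigma> \<subseteq> \<tau>. f \<sigma> else 0)"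

definition coboundaries :: "'a set set \<Rightarrow> int \<Rightarrow> ('a set \<Rightarrow> bit) set" where
  "coboundaries K i = coboundary K (i - 1) ` cochains K (i - 1)"

definition face_weight :: "nat \<Rightarrow> 'a set set \<Rightarrow> int \<Rightarrow> 'a set \<Rightarrow> real" where
  "face_weight d K i \<sigma> =
     real (card {\<tau> \<in> faces K (int d). \<sigma> \<subseteq> \<tau>})
       / (real ((d + 1) choose nat (i + 1)) * real (card (faces K (int d))))"

definition cochain_norm :: "nat \<Rightarrow> 'a set set \<Rightarrow> int \<Rightarrow> ('a set \<Rightarrow> bit) \<Rightarrow> real" where
  "cochain_norm d K i f = (\<Sum>\<sigma> | \<sigma> \<in> faces K i \<and> f \<sigma> \<noteq> 0. face_weight d K i \<sigma>)"

definition coset_norm :: "nat \<Rightarrow> 'a set set \<Rightarrow> int \<Rightarrow> ('a set \<Rightarrow> bit) \<Rightarrow> real" where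
  "coset_norm d K i f = Min {cochain_norm d K i (\<lambda>\<sigma>. f \<sigma> + b \<sigma>) | b. b \<in> coboundaries K i}"

definition coboundary_expansion_at :: "nat \<Rightarrow> 'a set set \<Rightarrow> int \<Rightarrow> real" where
  "coboundary_expansion_at d K i =
     Min {cochain_norm d K (i + 1) (coboundary K i f) / coset_norm d K i f | f.
            f \<in> cochains K i - coboundaries K i}"

definition coboundary_expansion :: "nat \<Rightarrow> 'a set set \<Rightarrow> real" where
  "coboundary_expansion d K = Min (coboundary_expansion_at d K ` {0..int d - 1})"

end

theory Submission
  imports Defs "Jordan_Normal_Form.Determinant"
begin

text \<open>
  Let \<open>x\<^sub>\<tau>\<close> be the boundary of the face \<open>\<tau>\<close>, restricted to the ridges avoiding a fixed vertex. The
  order of \<open>H\<^sub>d\<^sub>-\<^sub>1(T)\<close> is the absolute value of the minor of the matrix of all \<open>x\<^sub>\<tau>\<close> at the faces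
  of \<open>T\<close>, so by Cauchy-Binet the generating function of the determinantal hypertree in weights \<open>w\<close>
  is \<open>det (\<Sum> w\<^sub>\<tau> x\<^sub>\<tau> x\<^sub>\<tau>\<^sup>T)\<close> up to normalisation. At \<open>w = 1\<close> this Gram matrix is \<open>1 + L\<close> with \<open>L\<close>
  an up-Laplacian; its inverse is explicit, and concavity of \<open>log det\<close> gives \<open>E z ^ card (T \<inter> S) \<le>
  exp ((z - 1) (d + 1) card S / n)\<close> for every set \<open>S\<close> of \<open>d\<close>-faces and every \<open>z > 0\<close>. All
  probabilistic input is this bound together with union bounds.

  For a \<open>(d-1)\<close>-cochain whose support \<open>A\<close> is smallest in its class modulo coboundaries, call the
  faces of \<open>A\<close> fat, and call a smaller face fat if a fixed proportion of its one-vertex extensions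
  is fat. With high probability few \<open>d\<close>-faces contain two fat faces of equal size that meet in a
  codimension-one face that is not fat. In every other \<open>d\<close>-face the coboundary of \<open>A\<close> agrees with
  the coboundary of the part of \<open>A\<close> lying above a minimal fat face \<open>\<rho>\<close>. That part is dense in the
  link of \<open>\<rho>\<close> and still minimal, so its coboundary in the complete complex is large, and there are
  few enough such cochains for a union bound to show that a proportion of this coboundary survives
  in the random complex.
\<close>

section \<open>Determinants\<close>

text \<open>A union bound over all minimal cochains fails in top dimension. A small size |A| admits
  about n^(d |A|) cochains, while only about k |A| random faces are expected in the coboundary of A;
  for bounded k a failure probability exp(-c k |A|) misses by a logarithm in the exponent. Above a
  fixed face with d - r vertices there are at most 2^(n^r) cochains, and a coboundary of order
  n^(r+1) meets about k n^r random faces, so there a constant k suffices. This forces the cut of A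
  into pieces dense in links. The bad faces produced by the cut are few only if small vertex sets
  span few faces, and what counts as small has to be fixed level by level, before k is chosen. Faces
  are counted with multiplicity over the k trees, because this count has a product moment; the
  multiplicities are at most d + 2 with high probability. The minimum degree of a ridge is not
  probabilistic: every hypertree covers every ridge. Cochains below dimension d - 1 have their
  coboundary inside the complete skeleton, so degree bounds settle them.\<close>

lemma det_one_plus_mult_commute:
  fixes A B :: "'a::idom mat"
  assumes A: "A \<in> carrier_mat n m" and B: "B \<in> carrier_mat m n"
  shows "det (1\<^sub>m n + A * B) = det (1\<^sub>m m + B * A)"
proof -
  have AB: "A * B \<in> carrier_mat n n" and BA: "B * A \<in> carrier_mat m m" using A B by auto
  \<comment> \<open>Sylvester's identity by block factorisation: \<open>?X * ?Y\<close> and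
    \<open>?Z * ?X\<close> are the same matrix, \<open>?X\<close> is unipotent, and the block
    triangular \<open>?Y\<close> and \<open>?Z\<close> have determinants det (1 + BA) and det (1 +
    AB).\<close>
  let ?X = "four_block_mat (1\<^sub>m n) (0\<^sub>m n m) B (1\<^sub>m m)"
  let ?Y = "four_block_mat (1\<^sub>m n) (- A) (0\<^sub>m m n) (1\<^sub>m m + B * A)"
  let ?Z = "four_block_mat (1\<^sub>m n + A * B) (- A) (0\<^sub>m m n) (1\<^sub>m m)"
  have mA: "- A \<in> carrier_mat n m" using A by auto
  have c: "1\<^sub>m n \<in> carrier_mat n n" "1\<^sub>m m \<in> carrier_mat m m" "0\<^sub>m n m \<in> carrier_mat n m"
    "0\<^sub>m m n \<in> carrier_mat m n" "1\<^sub>m m + B * A \<in> carrier_mat m m" "1\<^sub>m n + A * B \<in> carrier_mat n n"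
    using AB BA by auto
  have canc1: "- X + (1\<^sub>m k + X) = 1\<^sub>m k" and canc2: "1\<^sub>m k + X + - X = 1\<^sub>m k"
    if "X \<in> carrier_mat k k" for X :: "'a mat" and k
    using that by (auto intro!: eq_matI)
  have "?X * ?Y = four_block_mat (1\<^sub>m n) (- A) B (1\<^sub>m m)"
    unfolding mult_four_block_mat[OF c(1) c(3) B c(2) c(1) mA c(4) c(5)]
  proof (rule cong_four_block_mat)
    show "1\<^sub>m n * 1\<^sub>m n + 0\<^sub>m n m * 0\<^sub>m m n = (1\<^sub>m n :: 'a mat)" by simp
    show "1\<^sub>m n * - A + 0\<^sub>m n m * (1\<^sub>m m + B * A) = - A"
      unfolding left_mult_zero_mat[OF c(5)] using mA by simp
    show "B * 1\<^sub>m n + 1\<^sub>m m * 0\<^sub>m m n = B" using B by simp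
    have "B * - A = - (B * A)" using A B by simp
    then show "B * - A + 1\<^sub>m m * (1\<^sub>m m + B * A) = 1\<^sub>m m"
      unfolding left_mult_one_mat[OF c(5)] by (simp add: canc1[OF BA])
  qed
  moreover have "?Z * ?X = four_block_mat (1\<^sub>m n) (- A) B (1\<^sub>m m)"
    unfolding mult_four_block_mat[OF c(6) mA c(4) c(2) c(1) c(3) B c(2)]
  proof (rule cong_four_block_mat)
    have "- A * B = - (A * B)" using A B by simp
    then show "(1\<^sub>m n + A * B) * 1\<^sub>m n + - A * B = 1\<^sub>m n"
      unfolding right_mult_one_mat[OF c(6)] by (simp add: canc2[OF AB])
    show "(1\<^sub>m n + A * B) * 0\<^sub>m n m + - A * 1\<^sub>m m = - A"
      unfolding right_mult_zero_mat[OF c(6)] using mA by simp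
    show "0\<^sub>m m n * 1\<^sub>m n + 1\<^sub>m m * B = B" using B by simp
    show "0\<^sub>m m n * 0\<^sub>m n m + 1\<^sub>m m * 1\<^sub>m m = (1\<^sub>m m :: 'a mat)" by simp
  qed
  ultimately have e: "?X * ?Y = ?Z * ?X" by simp
  have X: "?X \<in> carrier_mat (n + m) (n + m)" and Y: "?Y \<in> carrier_mat (n + m) (n + m)"
    and Z: "?Z \<in> carrier_mat (n + m) (n + m)"
    using c by (auto intro!: four_block_carrier_mat)
  have dX: "det ?X = 1"
    using det_four_block_mat_upper_right_zero[OF c(1) refl B c(2)] by simp
  have "det ?X * det ?Y = det ?Z * det ?X"
    unfolding det_mult[OF X Y, symmetric] det_mult[OF Z X, symmetric] e ..
  then show ?thesis
    using dX det_four_block_mat_lower_left_zero[OF c(1) mA refl c(5)]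
      det_four_block_mat_lower_left_zero[OF c(6) mA refl c(2)] by simp
qed

text \<open>Multilinear expansion of the rows gives a sum over all functions from row indices to
  \<open>E\<close>. Those that are not injective contribute zero, and the others are grouped by
  their image \<open>T\<close>. The enumeration \<open>t T\<close> may be arbitrary, since it
  affects the minor only by a sign, which the square removes.\<close>

lemma cauchy_binet_diagonal:
  fixes x :: "nat \<Rightarrow> 'e \<Rightarrow> 'a::idom" and w :: "'e \<Rightarrow> 'a"
  assumes E: "finite E" and t: "\<And>T. T \<subseteq> E \<Longrightarrow> card T = n \<Longrightarrow> bij_betw (t T) {0..<n} T"
  shows "det (mat n n (\<lambda>(i,j). \<Sum>e\<in>E. w e * x i e * x j e)) =
    (\<Sum>T | T \<subseteq> E \<and> card T = n. (det (mat n n (\<lambda>(i,j). x i (t T j))))\<^sup>2 * (\<Prod>e\<in>T. w e))"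
proof -
  let ?I = "{0..<n}" and ?P = "{p. p permutes {0..<n}}"
  let ?F = "?I \<rightarrow>\<^sub>E E"
  \<comment> \<open>The selected minor is taken in transposed form, so that a repeated value of
    \<open>f\<close> becomes a repeated row.\<close>
  define D where "D f = det (mat n n (\<lambda>(i,j). x j (f i)))" for f
  have Dd: "D f = (\<Sum>p\<in>?P. of_int (sign p) * (\<Prod>i\<in>?I. x (p i) (f i)))" for f
    unfolding D_def by (subst det_def'[of _ n]) (auto intro!: sum.cong prod.cong simp:
        permutes_in_image[where S="?I", simplified])
  have "det (mat n n (\<lambda>(i,j). \<Sum>e\<in>E. w e * x i e * x j e)) =
     (\<Sum>p\<in>?P. of_int (sign p) * (\<Prod>i\<in>?I. \<Sum>e\<in>E. w e * x i e * x (p i) e))"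
    by (subst det_def'[of _ n]) (auto intro!: sum.cong prod.cong simp: permutes_in_image[where
        S="?I", simplified])
  also have "\<dots> = (\<Sum>p\<in>?P. of_int (sign p) * (\<Sum>f\<in>?F. \<Prod>i\<in>?I. w (f i) * x i (f i) * x (p i) (f i)))"
    using E by (subst prod_sum_PiE) auto
  also have "\<dots> = (\<Sum>f\<in>?F. \<Sum>p\<in>?P. (\<Prod>i\<in>?I. w (f i) * x i (f i)) * (of_int (sign p) *
      (\<Prod>i\<in>?I. x (p i) (f i))))"
    unfolding sum_distrib_left by (subst sum.swap) (auto intro!: sum.cong simp: prod.distrib
        algebra_simps)
  also have "\<dots> = (\<Sum>f\<in>?F. (\<Prod>i\<in>?I. w (f i) * x i (f i)) * D f)"
    unfolding Dd sum_distrib_left ..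
  also have "\<dots> = (\<Sum>f\<in>{f\<in>?F. inj_on f ?I}. (\<Prod>i\<in>?I. w (f i) * x i (f i)) * D f)"
  proof (rule sum.mono_neutral_right)
    show "finite ?F" using E by (intro finite_PiE) auto
    show "\<forall>f\<in>?F - {f\<in>?F. inj_on f ?I}. (\<Prod>i\<in>?I. w (f i) * x i (f i)) * D f = 0"
    proof
      fix f assume "f \<in> ?F - {f\<in>?F. inj_on f ?I}"
      then obtain i j where ij: "i < n" "j < n" "i \<noteq> j" "f i = f j" by (auto simp: inj_on_def)
      have "D f = 0" unfolding D_def
        by (rule det_identical_rows[of _ n i j]) (use ij in \<open>auto intro!: eq_vecI\<close>)
      then show "(\<Prod>i\<in>?I. w (f i) * x i (f i)) * D f = 0" by simp
    qed
  qed auto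
  also have "\<dots> = (\<Sum>T | T \<subseteq> E \<and> card T = n. \<Sum>f | f \<in> {f\<in>?F. inj_on f ?I} \<and> f ` ?I =
      T. (\<Prod>i\<in>?I. w (f i) * x i (f i)) * D f)"
  proof (rule sum.group[symmetric])
    show "finite {f\<in>?F. inj_on f ?I}" using E
        by (intro finite_subset[OF _ finite_PiE[of ?I "\<lambda>_. E"]]) auto
    show "finite {T. T \<subseteq> E \<and> card T = n}" using E by auto
    show "(\<lambda>f. f ` ?I) ` {f\<in>?F. inj_on f ?I} \<subseteq> {T. T \<subseteq> E \<and> card T = n}" by (auto simp: card_image)
  qed
  also have "\<dots> = (\<Sum>T | T \<subseteq> E \<and> card T = n. (det (mat n n (\<lambda>(i,j). x i (t T j))))\<^sup>2 * (\<Prod>e\<in>T. w e))"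
  proof (rule sum.cong[OF refl])
    fix T assume "T \<in> {T. T \<subseteq> E \<and> card T = n}"
    then have T: "T \<subseteq> E" "card T = n" by auto
    note b = t[OF T]
    have binj: "inj_on (t T) ?I" and bim: "t T ` ?I = T" using b by (auto simp: bij_betw_def)
    let ?X = "mat n n (\<lambda>(i,j). x i (t T j))"
    have DT: "D (t T) = det ?X"
    proof -
      have "mat n n (\<lambda>(i,j). x j (t T i)) = transpose_mat ?X" by (intro eq_matI) auto
      then show ?thesis unfolding D_def by (simp add: det_transpose[of _ n])
    qed
    have Dq: "D (\<lambda>i. t T (q i)) = of_int (sign q) * det ?X" if q: "q permutes ?I" for q
    proof -
      have "D (\<lambda>i. t T (q i)) = det (mat n n (\<lambda>(i,j). mat n n (\<lambda>(i,j). x j (t T i)) $$ (q i, j)))"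
        unfolding D_def by (rule arg_cong[where f="det"], rule eq_matI)
          (use permutes_in_image[OF q] in auto)
      also have "\<dots> = of_int (sign q) * D (t T)" unfolding D_def
          by (rule det_permute_rows) (use q in auto)
      finally show ?thesis using DT by simp
    qed
    \<comment> \<open>Injective functions with image \<open>T\<close> are the compositions of
      \<open>t T\<close> with permutations \<open>q\<close>. The minor contributes the sign of
      \<open>q\<close>, and the remaining signed sum over \<open>q\<close> is the Leibniz expansion
      of a second copy of the same minor.\<close>
    have "(\<Sum>f | f \<in> {f\<in>?F. inj_on f ?I} \<and> f ` ?I = T. (\<Prod>i\<in>?I. w (f i) * x i (f i)) * D f) =
       (\<Sum>q\<in>?P. (\<Prod>i\<in>?I. w (t T (q i)) * x i (t T (q i))) * D (\<lambda>i. t T (q i)))"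
    proof (rule sum.reindex_bij_witness[where j="\<lambda>f i.
        if i < n then inv_into ?I (t T) (f i) else i" and i="\<lambda>q. restrict (\<lambda>i. t T (q i)) ?I"])
      fix f assume f: "f \<in> {f. f \<in> {f\<in>?F. inj_on f ?I} \<and> f ` ?I = T}"
      let ?q = "\<lambda>i. if i < n then inv_into ?I (t T) (f i) else i"
      have fi: "t T (?q i) = f i" if "i < n" for i
        using f that bim by (auto intro!: f_inv_into_f)
      show fe: "restrict (\<lambda>i. t T (?q i)) ?I = f"
        using f fi by (auto simp: fun_eq_iff PiE_def extensional_def restrict_def)
      show "?q \<in> ?P"
      proof -
        have "inj_on ?q ?I"
        proof (rule inj_onI)
          fix a b assume ab: "a \<in> ?I" "b \<in> ?I" and e: "?q a = ?q b"
          have "f a = t T (?q a)" using fi[of a] ab by simp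
          also have "\<dots> = t T (?q b)" unfolding e ..
          also have "\<dots> = f b" using fi[of b] ab by simp
          finally show "a = b" using f ab by (auto dest: inj_onD)
        qed
        moreover have "?q ` ?I \<subseteq> ?I" using f bim
            by (auto intro!: inv_into_into[where A="?I", simplified])
        ultimately have "bij_betw ?q ?I ?I" 
          using endo_inj_surj[of ?I ?q] unfolding bij_betw_def by blast
        then show ?thesis by (auto intro!: bij_imp_permutes)
      qed
      have "D (\<lambda>i. t T (?q i)) = D f" unfolding D_def
        by (rule arg_cong[where f="det"], rule eq_matI) (use fi in auto)
      then show "(\<Prod>i\<in>?I. w (t T (?q i)) * x i (t T (?q i))) * D (\<lambda>i. t T (?q i)) =
          (\<Prod>i\<in>?I. w (f i) * x i (f i)) * D f"
        using fi by (auto intro!: prod.cong)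
    next
      fix q assume "q \<in> ?P"
      then have q: "q permutes ?I" by simp
      have qi: "i < n \<Longrightarrow> q i < n" for i using permutes_in_image[OF q] by auto
      have qb: "bij_betw q ?I ?I" using q by (rule permutes_imp_bij)
      show "(\<lambda>i. if i < n then inv_into ?I (t T) (restrict (\<lambda>i. t T (q i)) ?I i) else i) = q"
        using qi binj q by (auto simp: fun_eq_iff permutes_def)
      have "bij_betw (\<lambda>i. t T (q i)) ?I T" using bij_betw_trans[OF qb b] by (simp add: o_def)
      then show "restrict (\<lambda>i. t T (q i)) ?I \<in> {f. f \<in> {f\<in>?F. inj_on f ?I} \<and> f ` ?I = T}"
        using T by (auto simp: bij_betw_def)
    qed
    also have "\<dots> = (\<Sum>q\<in>?P. (\<Prod>e\<in>T. w e) * (of_int (sign q) * (\<Prod>i\<in>?I. x i (t T (q i)))) * det ?X)"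
    proof (rule sum.cong[OF refl])
      fix q assume "q \<in> ?P"
      then have q: "q permutes ?I" by simp
      have qb: "bij_betw q ?I ?I" using q by (rule permutes_imp_bij)
      have "bij_betw (\<lambda>i. t T (q i)) ?I T" using bij_betw_trans[OF qb b] by (simp add: o_def)
      then have "(\<Prod>i\<in>?I. w (t T (q i))) = (\<Prod>e\<in>T. w e)"
        by (rule prod.reindex_bij_betw)
      then show "(\<Prod>i\<in>?I. w (t T (q i)) * x i (t T (q i))) * D (\<lambda>i. t T (q i)) =
        (\<Prod>e\<in>T. w e) * (of_int (sign q) * (\<Prod>i\<in>?I. x i (t T (q i)))) * det ?X"
        by (simp add: Dq[OF q] prod.distrib algebra_simps)
    qed
    also have "\<dots> = (\<Prod>e\<in>T. w e) * (\<Sum>q\<in>?P. of_int (sign q) * (\<Prod>i\<in>?I. x i (t T (q i)))) * det ?X"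
      by (simp add: sum_distrib_left sum_distrib_right)
    also have "(\<Sum>q\<in>?P. of_int (sign q) * (\<Prod>i\<in>?I. x i (t T (q i)))) = det ?X"
      by (subst det_def'[of _ n]) (auto intro!: sum.cong prod.cong simp: permutes_in_image[where
          S="?I", simplified])
    finally show "(\<Sum>f | f \<in> {f\<in>?F. inj_on f ?I} \<and> f ` ?I = T. (\<Prod>i\<in>?I. w (f i) * x i (f i)) * D f) =
       (det ?X)\<^sup>2 * (\<Prod>e\<in>T. w e)" by (simp add: power2_eq_square algebra_simps)
  qed
  finally show ?thesis .
qed

section \<open>The index of an integer lattice as a determinant\<close>

lemma exists_unimodular_first_row:
  fixes A :: "int mat"
  assumes "A \<in> carrier_mat n n" "0 < n"
  shows "\<exists>U\<in>carrier_mat n n. \<bar>det U\<bar> = 1 \<and> (\<forall>j. 0 < j \<longrightarrow> j < n \<longrightarrow> (A * U) $$ (0,j) = 0)"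
  using assms(1)
\<comment> \<open>The Euclidean algorithm on the first row by unimodular column operations; the sum
  of the absolute values of its entries decreases until at most one entry is nonzero, and a column
  swap then moves it to the front.\<close>
proof (induction "\<Sum>j<n. nat \<bar>A $$ (0,j)\<bar>" arbitrary: A rule: less_induct)
  case less
  note A = less.prems
  have step: ?case if U1: "U1 \<in> carrier_mat n n" "\<bar>det U1\<bar> = 1"
     and U: "U \<in> carrier_mat n n" "\<bar>det U\<bar> = 1" "\<forall>j. 0 < j \<longrightarrow> j < n \<longrightarrow> (A * U1 * U) $$ (0,j) =
         0" for U1 U
  proof (intro bexI[of _ "U1 * U"] conjI)
    show "\<bar>det (U1 * U)\<bar> = 1" using U1 U by (simp add: det_mult[of _ n] abs_mult)
    show "\<forall>j. 0 < j \<longrightarrow> j < n \<longrightarrow> (A * (U1 * U)) $$ (0,j) = 0"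
      using U(3) assoc_mult_mat[OF A U1(1) U(1)] by simp
  qed (use U1 U in auto)
  show ?case
  proof (cases "\<exists>i j. i < n \<and> j < n \<and> i \<noteq> j \<and> A $$ (0,i) \<noteq> 0 \<and> A $$ (0,j) \<noteq> 0 \<and> \<bar>A $$ (0,j)\<bar> \<le>
      \<bar>A $$ (0,i)\<bar>")
    case True
    then obtain i j where ij: "i < n" "j < n" "i \<noteq> j" "A $$ (0,i) \<noteq> 0" "A $$ (0,j) \<noteq> 0" "\<bar>A $$
        (0,j)\<bar> \<le> \<bar>A $$ (0,i)\<bar>" by auto
    \<comment> \<open>\<open>s\<close> is 1 or -1, with the sign that turns the larger entry into
      one of absolute value |A(0,i)| - |A(0,j)|: the subtractive form of Euclid's algorithm, which
      needs no division.\<close>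
    define s where "s = - sgn (A $$ (0,i)) * sgn (A $$ (0,j))"
    let ?U1 = "addrow_mat n s j i"
    have eq: "addcol s i j A = A * ?U1" using A ij by (intro addcol_mat[of _ n]) auto
    have d: "\<bar>det ?U1\<bar> = 1" using ij by (simp add: det_addrow_mat)
    have lt: "nat \<bar>(A * ?U1) $$ (0,i)\<bar> < nat \<bar>A $$ (0,i)\<bar>"
    proof -
      have "(A * ?U1) $$ (0,i) = s * A $$ (0,j) + A $$ (0,i)"
        unfolding eq[symmetric] using A ij assms(2) by simp
      moreover have "\<bar>s * A $$ (0,j) + A $$ (0,i)\<bar> < \<bar>A $$ (0,i)\<bar>"
        using ij(4-6) unfolding s_def by (auto simp: sgn_if abs_if split: if_splits)
      ultimately show ?thesis by simp
    qed
    have "(\<Sum>j<n. nat \<bar>(A * ?U1) $$ (0,j)\<bar>) < (\<Sum>j<n. nat \<bar>A $$ (0,j)\<bar>)"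
    proof (rule sum_strict_mono_ex1)
      show "\<forall>l\<in>{..<n}. nat \<bar>(A * ?U1) $$ (0,l)\<bar> \<le> nat \<bar>A $$ (0,l)\<bar>"
      proof
        fix l assume "l \<in> {..<n}"
        then show "nat \<bar>(A * ?U1) $$ (0,l)\<bar> \<le> nat \<bar>A $$ (0,l)\<bar>"
          using lt A assms(2) unfolding eq[symmetric] by (cases "l = i") auto
      qed
      show "\<exists>l\<in>{..<n}. nat \<bar>(A * ?U1) $$ (0,l)\<bar> < nat \<bar>A $$ (0,l)\<bar>" using lt ij by auto
    qed auto
    from less.hyps[OF this] A obtain U where "U \<in> carrier_mat n n" "\<bar>det U\<bar> =
        1" "\<forall>j. 0 < j \<longrightarrow> j < n \<longrightarrow> (A * ?U1 * U) $$ (0,j) = 0"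
      by auto
    then show ?thesis using step[of ?U1 U] d by auto
  next
    case False
    show ?thesis
    proof (cases "\<exists>i. 0 < i \<and> i < n \<and> A $$ (0,i) \<noteq> 0")
      case True
      then obtain i where i: "0 < i" "i < n" "A $$ (0,i) \<noteq> 0" by auto
      have z: "A $$ (0,l) = 0" if "l < n" "l \<noteq> i" for l
        using False i that linear[of "\<bar>A $$ (0,i)\<bar>" "\<bar>A $$ (0,l)\<bar>"] by blast
      let ?U1 = "swaprows_mat n 0 i :: int mat"
      have eq: "swapcols 0 i A = A * ?U1" using A i by (intro swapcols_mat[of _ n]) auto
      have d: "\<bar>det ?U1\<bar> = 1" using i by (simp add: det_swaprows_mat)
      have "(A * ?U1) $$ (0,j) = 0" if "0 < j" "j < n" for j
        using that z[of 0] z[of j] i A unfolding eq[symmetric] by (auto simp: mat_swapcols_def)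
      then show ?thesis using d by (intro bexI[of _ ?U1]) auto
    next
      case False
      then show ?thesis using A by (intro bexI[of _ "1\<^sub>m n"]) auto
    qed
  qed
qed

lemma mult_mat_lattice_subset:
  fixes A U :: "int mat"
  assumes "A \<in> carrier_mat n n" "U \<in> carrier_mat n n"
    and "\<forall>i<n. v i = (\<Sum>j<n. (A * U) $$ (i,j) * c j)"
  shows "\<exists>c. \<forall>i<n. v i = (\<Sum>j<n. A $$ (i,j) * c j)"
proof (intro exI allI impI)
  fix i assume i: "i < n"
  have "v i = (\<Sum>j<n. (\<Sum>k<n. A $$ (i,k) * U $$ (k,j)) * c j)"
    using assms i by (auto simp: scalar_prod_def atLeast0LessThan intro!: sum.cong)
  also have "\<dots> = (\<Sum>k<n. A $$ (i,k) * (\<Sum>j<n. U $$ (k,j) * c j))"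
    unfolding sum_distrib_left sum_distrib_right
        by (subst sum.swap) (auto intro!: sum.cong simp: algebra_simps)
  finally show "v i = (\<Sum>k<n. A $$ (i,k) * (\<Sum>j<n. U $$ (k,j) * c j))" .
qed

text \<open>The column lattice has index |det A|. Once the first row is cleared, the coset of
  \<open>v\<close> is determined by \<open>v 0\<close> modulo the corner entry \<open>g\<close> and
  by a coset of the lattice of the complementary block, so the index multiplies as the determinant
  does. Vectors are total functions of which only the first \<open>n\<close> values matter;
  uniqueness is meant inside the fixed set \<open>P\<close> only.\<close>

lemma lattice_transversal_mat:
  fixes A :: "int mat"
  assumes "A \<in> carrier_mat n n" "det A \<noteq> 0"
  shows "\<exists>P. finite P \<and> card P = nat \<bar>det A\<bar> \<and>
    (\<forall>v::nat\<Rightarrow>int. \<exists>!p. p \<in> P \<and> (\<exists>c. \<forall>i<n. v i - p i = (\<Sum>j<n. A $$ (i,j) * c j)))"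
  using assms
proof (induction n arbitrary: A)
  case 0
  \<comment> \<open>In rank zero all functions are congruent, and one representative matches the
    empty determinant 1.\<close>
  then show ?case by (intro exI[of _ "{\<lambda>_. 0}"]) auto
next
  case (Suc m)
  let ?n = "Suc m"
  obtain U where U: "U \<in> carrier_mat ?n ?n" "\<bar>det U\<bar> = 1" "\<And>j. 0 < j \<Longrightarrow> j < ?n
      \<Longrightarrow> (A * U) $$ (0,j) = 0"
    using exists_unimodular_first_row[OF Suc.prems(1)] by auto
  define B where "B = A * U"
  define g where "g = B $$ (0,0)"
  define B' where "B' = mat_delete B 0 0"
  have B: "B \<in> carrier_mat ?n ?n" using U Suc.prems unfolding B_def by auto
  have B'c: "B' \<in> carrier_mat m m" using B unfolding B'_def by (auto simp: mat_delete_def)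
  have B'i: "B' $$ (i,j) = B $$ (Suc i, Suc j)" if "i < m" "j < m" for i j
    unfolding B'_def using that B mat_delete_index[OF B, of 0 0 i j] by (simp add: insert_index_def)
  have "det B = (\<Sum>j<?n. B $$ (0,j) * cofactor B 0 j)" using laplace_expansion_row[OF B, of 0]
      by simp
  also have "\<dots> = g * cofactor B 0 0" unfolding sum.lessThan_Suc_shift g_def using U(3)
      by (simp add: B_def)
  also have "cofactor B 0 0 = det B'" by (simp add: cofactor_def B'_def)
  finally have dB: "det B = g * det B'" .
  have dBA: "\<bar>det B\<bar> = \<bar>det A\<bar>"
    unfolding B_def using U Suc.prems by (simp add: det_mult[of _ ?n] abs_mult)
  then have g0: "g \<noteq> 0" and d': "det B' \<noteq> 0" using dB Suc.prems by auto
  have lat: "(\<exists>c. \<forall>i<?n. v i = (\<Sum>j<?n. B $$ (i,j) * c j))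
      \<longleftrightarrow> (\<exists>c. \<forall>i<?n. v i = (\<Sum>j<?n. A $$ (i,j) * c j))" for v
  proof
    assume "\<exists>c. \<forall>i<?n. v i = (\<Sum>j<?n. B $$ (i,j) * c j)"
    then show "\<exists>c. \<forall>i<?n. v i = (\<Sum>j<?n. A $$ (i,j) * c j)"
      unfolding B_def using mult_mat_lattice_subset[OF Suc.prems(1) U(1)] by blast
  next
    assume l: "\<exists>c. \<forall>i<?n. v i = (\<Sum>j<?n. A $$ (i,j) * c j)"
    \<comment> \<open>The inverse of \<open>U\<close>: since det U is 1 or -1, multiplying the
      adjugate by it replaces the division. Hence the column operations leave the lattice
      unchanged.\<close>
    let ?W = "det U \<cdot>\<^sub>m adj_mat U"
    have W: "?W \<in> carrier_mat ?n ?n" using adj_mat(1)[OF U(1)] by auto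
    have "U * ?W = det U \<cdot>\<^sub>m (U * adj_mat U)" using U adj_mat(1)[OF U(1)] by auto
    also have "\<dots> = 1\<^sub>m ?n" unfolding adj_mat(2)[OF U(1)] using U(2)
      by (intro eq_matI) (auto simp: abs_if split: if_splits)
    finally have "B * ?W = A" unfolding B_def using assoc_mult_mat[OF Suc.prems(1) U(1) W] Suc.prems
        by simp
    then have "\<exists>c. \<forall>i<?n. v i = (\<Sum>j<?n. (B * ?W) $$ (i,j) * c j)" using l by simp
    then show "\<exists>c. \<forall>i<?n. v i = (\<Sum>j<?n. B $$ (i,j) * c j)"
      using mult_mat_lattice_subset[OF B W] by blast
  qed
  obtain P' where P': "finite P'" "card P' = nat \<bar>det B'\<bar>"
    "\<And>v::nat\<Rightarrow>int. \<exists>!p. p \<in> P' \<and> (\<exists>c. \<forall>i<m. v i - p i = (\<Sum>j<m. B' $$ (i,j) * c j))"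
    using Suc.IH[OF B'c d'] by blast
  \<comment> \<open>A residue modulo |g| in coordinate 0, followed by a representative for the
    smaller block.\<close>
  define P where "P = (\<lambda>(a,p). case_nat a p) ` ({0..<\<bar>g\<bar>} \<times> P')"
  have inj: "inj_on (\<lambda>(a,p). case_nat a p) ({0..<\<bar>g\<bar>} \<times> P')"
  proof (rule inj_onI, clarsimp)
    fix a b :: int and p q :: "nat \<Rightarrow> int" assume e: "case_nat a p = case_nat b q"
    show "a = b \<and> p = q" using fun_cong[OF e, of 0] fun_cong[OF e, of "Suc _"]
        by (auto simp: fun_eq_iff)
  qed
  \<comment> \<open>The coefficient \<open>s\<close> of the first column is forced by coordinate 0,
    where all other columns vanish. After subtracting \<open>s\<close> times that column, membership
    is a question about the block \<open>B'\<close>.\<close>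
  have mem: "(\<exists>c. \<forall>i<?n. v i = (\<Sum>j<?n. B $$ (i,j) * c j)) \<longleftrightarrow>
      (\<exists>s. v 0 = g * s \<and> (\<exists>c. \<forall>i<m. v (Suc i) - B $$ (Suc i,0) * s =
          (\<Sum>j<m. B' $$ (i,j) * c j)))" for v
  proof
    assume "\<exists>c. \<forall>i<?n. v i = (\<Sum>j<?n. B $$ (i,j) * c j)"
    then obtain c where c: "\<And>i. i<?n \<Longrightarrow> v i = (\<Sum>j<?n. B $$ (i,j) * c j)" by blast
    have "v 0 = g * c 0" using c[of 0] U(3) unfolding sum.lessThan_Suc_shift g_def
        by (simp add: B_def)
    moreover have "v (Suc i) - B $$ (Suc i,0) * c 0 = (\<Sum>j<m. B' $$ (i,j) * c (Suc j))"
        if "i < m" for i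
      using c[of "Suc i"] that B'i unfolding sum.lessThan_Suc_shift by simp
    ultimately show "\<exists>s. v 0 = g * s \<and> (\<exists>c. \<forall>i<m. v (Suc i) - B $$ (Suc i,0) * s =
        (\<Sum>j<m. B' $$ (i,j) * c j))"
      by (intro exI[of _ "c 0"]) (auto intro!: exI[of _ "\<lambda>j. c (Suc j)"])
  next
    assume "\<exists>s. v 0 = g * s \<and> (\<exists>c. \<forall>i<m. v (Suc i) - B $$ (Suc i,0) * s =
        (\<Sum>j<m. B' $$ (i,j) * c j))"
    then obtain s c where sc: "v 0 = g * s" "\<And>i. i<m
        \<Longrightarrow> v (Suc i) - B $$ (Suc i,0) * s = (\<Sum>j<m. B' $$ (i,j) * c j)" by blast
    have "v i = (\<Sum>j<?n. B $$ (i,j) * case_nat s c j)" if i: "i < ?n" for i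
    proof (cases i)
      case 0
      then show ?thesis using sc(1) U(3) unfolding sum.lessThan_Suc_shift by (simp add: B_def g_def)
    next
      case (Suc l)
      then show ?thesis using sc(2)[of l] i B'i unfolding sum.lessThan_Suc_shift
          by (simp add: algebra_simps)
    qed
    then show "\<exists>c. \<forall>i<?n. v i = (\<Sum>j<?n. B $$ (i,j) * c j)" by blast
  qed
  show ?case
  proof (intro exI[of _ P] conjI allI)
    show "finite P" unfolding P_def using P'(1) by auto
    have "card P = nat \<bar>g\<bar> * nat \<bar>det B'\<bar>"
      unfolding P_def card_image[OF inj] using P' by (simp add: card_cartesian_product)
    then show "card P = nat \<bar>det A\<bar>"
      unfolding dBA[symmetric] dB by (simp add: abs_mult nat_mult_distrib)
    fix v :: "nat \<Rightarrow> int"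
    define r where "r = v 0 mod \<bar>g\<bar>"
    define s where "s = (v 0 - r) div g"
    have r: "0 \<le> r" "r < \<bar>g\<bar>" using g0 by (auto simp: r_def)
    have "\<bar>g\<bar> dvd v 0 - r" unfolding r_def by (simp add: minus_mod_eq_mult_div)
    then have gs: "v 0 - r = g * s" unfolding s_def by simp
    obtain p where p: "p \<in> P'" "\<exists>c. \<forall>i<m. (v (Suc i) - B $$ (Suc i,0) * s) - p i =
        (\<Sum>j<m. B' $$ (i,j) * c j)"
      "\<And>p'. p' \<in> P' \<and> (\<exists>c. \<forall>i<m. (v (Suc i) - B $$ (Suc i,0) * s) - p' i =
          (\<Sum>j<m. B' $$ (i,j) * c j)) \<Longrightarrow> p' = p"
      using P'(3)[of "\<lambda>i. v (Suc i) - B $$ (Suc i,0) * s"] by (elim ex1E) blast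
    show "\<exists>!p. p \<in> P \<and> (\<exists>c. \<forall>i<?n. v i - p i = (\<Sum>j<?n. A $$ (i,j) * c j))"
      unfolding lat[of "\<lambda>i. v i - _ i", symmetric] mem[of "\<lambda>i. v i - _ i"]
    proof (rule ex1I[of _ "case_nat r p"], intro conjI)
      show "case_nat r p \<in> P" unfolding P_def using r p(1) by force
      show "\<exists>s. v 0 - case_nat r p 0 = g * s \<and> (\<exists>c. \<forall>i<m. v (Suc i) - case_nat r p (Suc i) - B $$
          (Suc i,0) * s = (\<Sum>j<m. B' $$ (i,j) * c j))"
        using p(2) gs by (intro exI[of _ s]) (auto simp: algebra_simps)
    next
      fix q assume q: "q \<in> P \<and> (\<exists>s. v 0 - q 0 =
          g * s \<and> (\<exists>c. \<forall>i<m. v (Suc i) - q (Suc i) - B $$ (Suc i,0) * s =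
          (\<Sum>j<m. B' $$ (i,j) * c j)))"
      then obtain a p' where ap: "q = case_nat a p'" "0 \<le> a" "a < \<bar>g\<bar>" "p' \<in> P'" unfolding P_def
          by auto
      obtain s' where s': "v 0 - a = g * s'" "\<exists>c. \<forall>i<m. v (Suc i) - p' i - B $$ (Suc i,0) * s' =
          (\<Sum>j<m. B' $$ (i,j) * c j)"
        using q ap by auto
      have "\<bar>g\<bar> dvd v 0 - a" using s'(1) by simp
      then have "a = r" unfolding r_def using ap by (metis mod_eq_dvd_iff mod_pos_pos_trivial)
      then have "s' = s" using s'(1) gs g0 by simp
      then have "p' = p" using s'(2) ap(4) by (intro p(3)) (auto simp: algebra_simps)
      then show "q = case_nat r p" using ap \<open>a = r\<close> by simp
    qed
  qed
qed


section \<open>Determinants of matrices indexed by finite sets\<close>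

definition enum_set :: "'a set \<Rightarrow> nat \<Rightarrow> 'a" where
  "enum_set R = (SOME h. bij_betw h {0..<card R} R)"

text \<open>The two enumerations are unrelated, so for \<open>R\<close> different from
  \<open>T\<close> the value is meaningful only up to sign. Minors of the boundary matrix therefore
  enter the argument through squares, absolute values and vanishing.\<close>

definition set_det :: "'r set \<Rightarrow> 't set \<Rightarrow> ('r \<Rightarrow> 't \<Rightarrow> 'a::comm_ring_1) \<Rightarrow> 'a" where
  "set_det R T f = det (mat (card R) (card R) (\<lambda>(i,j). f (enum_set R i) (enum_set T j)))"

lemma bij_betw_enum_set: "finite R \<Longrightarrow> bij_betw (enum_set R) {0..<card R} R"
  unfolding enum_set_def by (rule someI_ex[OF ex_bij_betw_nat_finite])

lemma enum_set_mem: "finite R \<Longrightarrow> i < card R \<Longrightarrow> enum_set R i \<in> R"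
  using bij_betw_enum_set[of R] by (auto simp: bij_betw_def)

lemma enum_set_eq_iff: "finite R \<Longrightarrow> i < card R \<Longrightarrow> j < card R \<Longrightarrow> enum_set R i = enum_set R j \<longleftrightarrow> i = j"
  using bij_betw_enum_set[of R] by (auto simp: bij_betw_def inj_on_def)

lemma sum_enum_set: "finite R \<Longrightarrow> (\<Sum>i\<in>{0..<card R}. f (enum_set R i)) = (\<Sum>r\<in>R. f r)"
  using bij_betw_enum_set[of R] by (rule sum.reindex_bij_betw)

lemma enum_set_surj: assumes "finite R" "r \<in> R" obtains i where "i < card R" "enum_set R i = r"
proof -
  have "r \<in> enum_set R ` {0..<card R}" using bij_betw_enum_set[OF assms(1)] assms(2)
      by (simp add: bij_betw_def)
  then show ?thesis using that by auto
qed

lemma set_det_cong: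
  assumes "finite R" "finite T" "card R = card T" "\<And>r t. r \<in> R \<Longrightarrow> t \<in> T \<Longrightarrow> f r t = g r t"
  shows "set_det R T f = set_det R T g"
  unfolding set_det_def
  by (rule arg_cong[where f="det"], rule eq_matI) (use assms in \<open>auto simp: enum_set_mem\<close>)

lemma set_det_one:
  assumes R: "finite R"
  shows "set_det R R (\<lambda>i j. if i = j then 1 else 0) = (1 :: 'a::comm_ring_1)"
proof -
  have "mat (card R) (card R) (\<lambda>(i,j). if enum_set R i = enum_set R j then 1 else 0) =
      (1\<^sub>m (card R) :: 'a mat)"
    by (rule eq_matI) (auto simp: enum_set_eq_iff R)
  then show ?thesis unfolding set_det_def by (simp only: det_one)
qed

lemma set_det_smult: "set_det R T (\<lambda>i j. c * f i j) = c ^ card R * set_det R T f"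
proof -
  have "mat (card R) (card R) (\<lambda>(i,j). c * f (enum_set R i) (enum_set T j)) =
     c \<cdot>\<^sub>m mat (card R) (card R) (\<lambda>(i,j). f (enum_set R i) (enum_set T j))"
    by (rule eq_matI) auto
  then show ?thesis unfolding set_det_def by simp
qed

lemma set_det_mult:
  assumes R: "finite R"
  shows "set_det R R (\<lambda>i j. \<Sum>k\<in>R. f i k * g k j) = set_det R R f * set_det R R g"
proof -
  let ?M = "\<lambda>f. mat (card R) (card R) (\<lambda>(i,j). f (enum_set R i) (enum_set R j))"
  have "?M (\<lambda>i j. \<Sum>k\<in>R. f i k * g k j) = ?M f * ?M g"
    by (rule eq_matI) (auto simp: scalar_prod_def sum_enum_set[OF R, symmetric])
  then show ?thesis unfolding set_det_def using det_mult[of "?M f" "card R" "?M g"] by simp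
qed

lemma set_det_one_plus_mult_commute:
  fixes f :: "'r \<Rightarrow> 'k \<Rightarrow> 'a::idom"
  assumes R: "finite R" and K: "finite K"
  shows "set_det R R (\<lambda>i j. (if i = j then 1 else 0) + (\<Sum>k\<in>K. f i k * g k j)) =
     set_det K K (\<lambda>k l. (if k = l then 1 else 0) + (\<Sum>i\<in>R. g k i * f i l))"
proof -
  let ?A = "mat (card R) (card K) (\<lambda>(i,j). f (enum_set R i) (enum_set K j))"
  let ?B = "mat (card K) (card R) (\<lambda>(i,j). g (enum_set K i) (enum_set R j))"
  have "1\<^sub>m (card R) + ?A * ?B = mat (card R) (card R) (\<lambda>(i,j). (if enum_set R i =
      enum_set R j then 1 else 0) +
      (\<Sum>k\<in>K. f (enum_set R i) k * g k (enum_set R j)))"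
    by (rule eq_matI) (auto simp: scalar_prod_def sum_enum_set[OF K, symmetric] enum_set_eq_iff R)
  moreover have "1\<^sub>m (card K) + ?B * ?A = mat (card K) (card K) (\<lambda>(i,j). (if enum_set K i =
      enum_set K j then 1 else 0) +
      (\<Sum>k\<in>R. g (enum_set K i) k * f k (enum_set K j)))"
    by (rule eq_matI) (auto simp: scalar_prod_def sum_enum_set[OF R, symmetric] enum_set_eq_iff K)
  ultimately show ?thesis unfolding set_det_def
    using det_one_plus_mult_commute[of ?A "card R" "card K" ?B] by simp
qed

lemma set_det_cauchy_binet:
  fixes x :: "'r \<Rightarrow> 'e \<Rightarrow> 'a::idom"
  assumes E: "finite E"
  shows "set_det R R (\<lambda>i j. \<Sum>e\<in>E. w e * x i e * x j e) =
    (\<Sum>T | T \<subseteq> E \<and> card T = card R. (set_det R T x)\<^sup>2 * (\<Prod>e\<in>T. w e))"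
proof -
  have "bij_betw (enum_set T) {0..<card R} T" if "T \<subseteq> E" "card T = card R" for T
    using bij_betw_enum_set[OF finite_subset[OF that(1) E]] that(2) by simp
  then show ?thesis unfolding set_det_def by (rule cauchy_binet_diagonal[OF E])
qed

lemma set_det_of_int: "set_det R T (\<lambda>i j. of_int (f i j)) =
    (of_int (set_det R T f) :: 'a::comm_ring_1)"
proof -
  interpret of_int_hom: comm_ring_hom "of_int :: int \<Rightarrow> 'a" by unfold_locales auto
  let ?M = "mat (card R) (card R) (\<lambda>(i,j). f (enum_set R i) (enum_set T j))"
  have "mat (card R) (card R) (\<lambda>(i,j). of_int (f (enum_set R i) (enum_set T j))) =
      map_mat (of_int :: int \<Rightarrow> 'a) ?M"
    by (rule eq_matI) auto
  then show ?thesis unfolding set_det_def by (simp add: of_int_hom.hom_det)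
qed

lemma set_det_solve:
  fixes f :: "'r \<Rightarrow> 'r \<Rightarrow> 'a::field"
  assumes R: "finite R" and d: "set_det R R f \<noteq> 0"
  shows "\<exists>y. \<forall>i\<in>R. (\<Sum>j\<in>R. f i j * y j) = b i"
proof -
  let ?n = "card R"
  let ?M = "mat ?n ?n (\<lambda>(i,j). f (enum_set R i) (enum_set R j))"
  have M: "?M \<in> carrier_mat ?n ?n" by simp
  define c where "c j = (\<Sum>k\<in>{0..<?n}. adj_mat ?M $$ (j,k) * b (enum_set R k)) / det ?M" for j
  define y where "y r = c (inv_into {0..<?n} (enum_set R) r)" for r
  have yc: "y (enum_set R j) = c j" if "j < ?n" for j
    unfolding y_def using that bij_betw_enum_set[OF R] by (auto simp: bij_betw_def)
  have dn: "det ?M \<noteq> 0" using d by (simp add: set_det_def)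
  have adj: "(\<Sum>j\<in>{0..<?n}. ?M $$ (i,j) * adj_mat ?M $$ (j,k)) = (if i = k then det ?M else 0)"
    if "i < ?n" "k < ?n" for i k
  proof -
    have "(?M * adj_mat ?M) $$ (i,k) = (\<Sum>j\<in>{0..<?n}. ?M $$ (i,j) * adj_mat ?M $$ (j,k))"
      using that adj_mat(1)[OF M] by (simp add: scalar_prod_def)
    then show ?thesis unfolding adj_mat(2)[OF M] using that by (auto split: if_splits)
  qed
  have "(\<Sum>j\<in>R. f (enum_set R i) j * y j) = b (enum_set R i)" if i: "i < ?n" for i
  proof -
    have "(\<Sum>j\<in>R. f (enum_set R i) j * y j) = (\<Sum>j\<in>{0..<?n}. ?M $$ (i,j) * c j)"
      unfolding sum_enum_set[OF R, symmetric] using i yc by (intro sum.cong) auto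
    also have "\<dots> = (\<Sum>k\<in>{0..<?n}. \<Sum>j\<in>{0..<?n}. ?M $$ (i,j) * adj_mat ?M $$ (j,k) *
        b (enum_set R k)) / det ?M"
      unfolding c_def by (subst sum.swap) (simp add: sum_distrib_left sum_divide_distrib
          algebra_simps)
    also have "\<dots> = (\<Sum>k\<in>{0..<?n}. (if i = k then det ?M else 0) * b (enum_set R k)) / det ?M"
      unfolding sum_distrib_right[symmetric] using adj i
          by (intro arg_cong2[where f="(/)"] sum.cong) auto
    also have "\<dots> = b (enum_set R i)" using i dn
        by (simp add: if_distrib[where f="\<lambda>x. x * _"] cong: if_cong)
    finally show ?thesis .
  qed
  then show ?thesis by (intro exI[of _ y] ballI) (auto elim!: enum_set_surj[OF R])
qed

lemma set_det_zero_left_kernel: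
  fixes f :: "'r \<Rightarrow> 't \<Rightarrow> 'a::idom"
  assumes R: "finite R" and T: "finite T" and c: "card T = card R"
  shows "set_det R T f = 0 \<longleftrightarrow> (\<exists>y. (\<exists>r\<in>R. y r \<noteq> 0) \<and> (\<forall>t\<in>T. (\<Sum>r\<in>R. y r * f r t) = 0))"
proof -
  let ?n = "card R"
  let ?M = "mat ?n ?n (\<lambda>(i,j). f (enum_set R i) (enum_set T j))"
  have M: "transpose_mat ?M \<in> carrier_mat ?n ?n" by simp
  have dt: "set_det R T f = det (transpose_mat ?M)" unfolding set_det_def
      by (simp add: det_transpose[of _ ?n])
  have key: "(\<Sum>r\<in>R. y r * f r (enum_set T j)) =
      vec_index (transpose_mat ?M *\<^sub>v vec ?n (\<lambda>i. y (enum_set R i))) j" if "j < ?n" for y j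
    using that unfolding sum_enum_set[OF R, symmetric]
        by (auto simp: scalar_prod_def intro!: sum.cong)
  show ?thesis unfolding dt det_0_iff_vec_prod_zero[OF M]
  proof safe
    fix v assume v: "v \<in> carrier_vec ?n" "v \<noteq> 0\<^sub>v ?n" "transpose_mat ?M *\<^sub>v v = 0\<^sub>v ?n"
    define y where "y r = vec_index v (inv_into {0..<?n} (enum_set R) r)" for r
    have yc: "y (enum_set R j) = vec_index v j" if "j < ?n" for j
      unfolding y_def using that bij_betw_enum_set[OF R] by (auto simp: bij_betw_def)
    have ve: "vec ?n (\<lambda>i. y (enum_set R i)) = v" using v yc by (intro eq_vecI) auto
    obtain j where j: "j < ?n" "vec_index v j \<noteq> 0" using v(1,2) eq_vecI[of v "0\<^sub>v ?n"] by auto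
    have "\<forall>t\<in>T. (\<Sum>r\<in>R. y r * f r t) = 0"
    proof
      fix t assume "t \<in> T"
      then obtain i where "i < ?n" "enum_set T i = t" using c by (auto elim!: enum_set_surj[OF T])
      then show "(\<Sum>r\<in>R. y r * f r t) = 0" using key[of i y] v(3) unfolding ve by auto
    qed
    then show "\<exists>y. (\<exists>r\<in>R. y r \<noteq> 0) \<and> (\<forall>t\<in>T. (\<Sum>r\<in>R. y r * f r t) = 0)"
      using j yc enum_set_mem[OF R j(1)] by (intro exI[of _ y]) (auto intro!: bexI[of _ "enum_set R
          j"])
  next
    fix y r assume y: "r \<in> R" "y r \<noteq> 0" "\<forall>t\<in>T. (\<Sum>r\<in>R. y r * f r t) = 0"
    let ?v = "vec ?n (\<lambda>i. y (enum_set R i))"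
    obtain i where i: "i < ?n" "enum_set R i = r" using enum_set_surj[OF R y(1)] .
    have "vec_index ?v i \<noteq> vec_index (0\<^sub>v ?n) i" using i y(2) by simp
    then have "?v \<noteq> 0\<^sub>v ?n" by metis
    moreover have "transpose_mat ?M *\<^sub>v ?v = 0\<^sub>v ?n"
    proof (rule eq_vecI)
      fix j assume "j < dim_vec (0\<^sub>v ?n :: 'a vec)"
      then have j: "j < ?n" by simp
      then show "vec_index (transpose_mat ?M *\<^sub>v ?v) j = vec_index (0\<^sub>v ?n) j"
        using key[OF j, of y] y(3) enum_set_mem[OF T, of j] c by simp
    qed simp
    ultimately show "\<exists>v. v \<in> carrier_vec ?n \<and> v \<noteq> 0\<^sub>v ?n \<and> transpose_mat ?M *\<^sub>v v = 0\<^sub>v ?n"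
      by (intro exI[of _ ?v] conjI) (assumption | simp)+
  qed
qed

lemma set_det_lattice_transversal:
  fixes f :: "'r \<Rightarrow> 't \<Rightarrow> int"
  assumes R: "finite R" and T: "finite T" and c: "card T = card R" and d: "set_det R T f \<noteq> 0"
  shows "\<exists>P. finite P \<and> card P = nat \<bar>set_det R T f\<bar> \<and>
    (\<forall>v. \<exists>!p. p \<in> P \<and> (\<exists>c. \<forall>r\<in>R. v r - p r = (\<Sum>t\<in>T. f r t * c t)))"
proof -
  let ?n = "card R"
  let ?M = "mat ?n ?n (\<lambda>(i,j). f (enum_set R i) (enum_set T j))"
  let ?h = "\<lambda>r. inv_into {0..<?n} (enum_set R) r" and ?g = "\<lambda>r. inv_into {0..<?n} (enum_set T) r"
  have "\<exists>P. finite P \<and> card P = nat \<bar>det ?M\<bar> \<and>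
    (\<forall>v::nat\<Rightarrow>int. \<exists>!p. p \<in> P \<and> (\<exists>c. \<forall>i<?n. v i - p i = (\<Sum>j<?n. ?M $$ (i,j) * c j)))"
    by (rule lattice_transversal_mat) (use d in \<open>auto simp: set_det_def\<close>)
  then obtain P where P0: "finite P \<and> card P = nat \<bar>det ?M\<bar> \<and>
    (\<forall>v::nat\<Rightarrow>int. \<exists>!p. p \<in> P \<and> (\<exists>c. \<forall>i<?n. v i - p i = (\<Sum>j<?n. ?M $$ (i,j) * c j)))" ..
  define L where "L v p \<longleftrightarrow> (\<exists>c. \<forall>i<?n. v i - p i =
      (\<Sum>j<?n. ?M $$ (i,j) * c j))" for v p :: "nat \<Rightarrow> int"
  have P: "finite P" "card P = nat \<bar>det ?M\<bar>" "\<And>v. \<exists>!p. p \<in> P \<and> L v p"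
    using P0 unfolding L_def by (simp_all only:)
  have h: "?h (enum_set R i) = i" if "i < ?n" for i using that bij_betw_enum_set[OF R]
      by (auto simp: bij_betw_def)
  have hR: "enum_set R (?h r) = r" "?h r < ?n" if "r \<in> R" for r
    using that bij_betw_enum_set[OF R] inv_into_into[of r "enum_set R" "{0..<?n}"]
        by (auto simp: bij_betw_def f_inv_into_f)
  have g: "?g (enum_set T i) = i" if "i < ?n" for i using that bij_betw_enum_set[OF T] c
      by (auto simp: bij_betw_def)
  have S: "(\<Sum>t\<in>T. F t) = (\<Sum>j<?n. F (enum_set T j))" for F :: "'t \<Rightarrow> int"
    using sum_enum_set[OF T, of F] c by (simp add: atLeast0LessThan)
  have eq: "(\<exists>c. \<forall>r\<in>R. v r - p (?h r) = (\<Sum>t\<in>T. f r t * c t)) \<longleftrightarrow>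
     L (\<lambda>i. v (enum_set R i)) p" for v p
    unfolding L_def
  proof
    assume "\<exists>c. \<forall>r\<in>R. v r - p (?h r) = (\<Sum>t\<in>T. f r t * c t)"
    then obtain c where c: "\<forall>r\<in>R. v r - p (?h r) = (\<Sum>t\<in>T. f r t * c t)" ..
    have "v (enum_set R i) - p i = (\<Sum>j<?n. ?M $$ (i,j) * c (enum_set T j))" if "i < ?n" for i
      using c[rule_format, OF enum_set_mem[OF R that]] h[OF that] that unfolding S by simp
    then show "\<exists>c. \<forall>i<?n. v (enum_set R i) - p i = (\<Sum>j<?n. ?M $$ (i,j) * c j)"
      by (intro exI[of _ "\<lambda>j. c (enum_set T j)"]) simp
  next
    assume "\<exists>c. \<forall>i<?n. v (enum_set R i) - p i = (\<Sum>j<?n. ?M $$ (i,j) * c j)"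
    then obtain c where c: "\<forall>i<?n. v (enum_set R i) - p i = (\<Sum>j<?n. ?M $$ (i,j) * c j)" ..
    have "v r - p (?h r) = (\<Sum>t\<in>T. f r t * c (?g t))" if r: "r \<in> R" for r
      using c[rule_format, OF hR(2)[OF r]] hR[OF r] g unfolding S by simp
    then show "\<exists>c. \<forall>r\<in>R. v r - p (?h r) = (\<Sum>t\<in>T. f r t * c t)"
      by (intro exI[of _ "\<lambda>t. c (?g t)"]) simp
  qed
  have inj: "inj_on (\<lambda>p. p \<circ> ?h) P"
  proof (rule inj_onI)
    fix p q assume pq: "p \<in> P" "q \<in> P" "p \<circ> ?h = q \<circ> ?h"
    have "p i = q i" if "i < ?n" for i using fun_cong[OF pq(3), of "enum_set R i"] h[OF that]
        by simp
    then have "L p q" unfolding L_def by (intro exI[of _ "\<lambda>_. 0"]) auto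
    moreover have "L p p" unfolding L_def by (intro exI[of _ "\<lambda>_. 0"]) auto
    ultimately show "p = q" using P(3)[of p] pq by blast
  qed
  show ?thesis
  proof (intro exI[of _ "(\<lambda>p. p \<circ> ?h) ` P"] conjI allI)
    show "card ((\<lambda>p. p \<circ> ?h) ` P) = nat \<bar>set_det R T f\<bar>"
        unfolding card_image[OF inj] P(2) set_det_def ..
    fix v
    obtain p where p: "p \<in> P" "L (\<lambda>i. v (enum_set R i)) p"
      "\<And>q. q \<in> P \<Longrightarrow> L (\<lambda>i. v (enum_set R i)) q \<Longrightarrow> q = p"
      using P(3)[of "\<lambda>i. v (enum_set R i)"] by (elim ex1E) blast
    show "\<exists>!p. p \<in> (\<lambda>p. p \<circ> ?h) ` P \<and> (\<exists>c. \<forall>r\<in>R. v r - p r = (\<Sum>t\<in>T. f r t * c t))"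
    proof (rule ex1I[of _ "p \<circ> ?h"])
      show "p \<circ> ?h \<in> (\<lambda>p. p \<circ> ?h) ` P \<and> (\<exists>c. \<forall>r\<in>R. v r - (p \<circ> ?h) r = (\<Sum>t\<in>T. f r t * c t))"
        unfolding o_apply eq using p by blast
      fix q assume q: "q \<in> (\<lambda>p. p \<circ> ?h) ` P \<and> (\<exists>c. \<forall>r\<in>R. v r - q r = (\<Sum>t\<in>T. f r t * c t))"
      then obtain q' where q': "q' \<in> P" "q = q' \<circ> ?h" by blast
      have "L (\<lambda>i. v (enum_set R i)) q'" using q[THEN conjunct2] unfolding q'(2) o_apply eq .
      then show "q = p \<circ> ?h" using p(3) q' by blast
    qed
  qed (use P in auto)
qed

text \<open>The matrix determinant lemma. A vector \<open>y\<close> with f y = b stands in for the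
  inverse of \<open>f\<close> applied to \<open>b\<close>: then f + s b a^T = f (1 + s y a^T), and
  Sylvester's identity reduces the second factor to a 1 by 1 determinant.\<close>

lemma set_det_rank_one_update:
  fixes f :: "'r \<Rightarrow> 'r \<Rightarrow> 'a::idom"
  assumes R: "finite R" and y: "\<And>i. i \<in> R \<Longrightarrow> (\<Sum>j\<in>R. f i j * y j) = b i"
  shows "set_det R R (\<lambda>i j. f i j + s * b i * a j) = set_det R R f * (1 + s * (\<Sum>j\<in>R. a j * y j))"
proof -
  have "set_det R R (\<lambda>i j. f i j + s * b i * a j) = set_det R R (\<lambda>i j. \<Sum>k\<in>R. f i k * ((if k =
      j then 1 else 0) + (\<Sum>u\<in>{()}. s * y k * a j)))"
  proof (rule set_det_cong[OF R R refl])
    fix i j assume ij: "i \<in> R" "j \<in> R"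
    have "(\<Sum>k\<in>R. f i k * ((if k = j then 1 else 0) + (\<Sum>u\<in>{()}. s * y k * a j))) =
       (\<Sum>k\<in>R. f i k * (if k = j then 1 else 0)) + s * (\<Sum>k\<in>R. f i k * y k) * a j"
      by (simp add: algebra_simps sum.distrib sum_distrib_left)
    also have "(\<Sum>k\<in>R. f i k * (if k = j then 1 else 0)) = f i j"
      using ij R by (simp add: if_distrib[where f="\<lambda>x. _ * x"] cong: if_cong)
    finally show "f i j + s * b i * a j = (\<Sum>k\<in>R. f i k * ((if k =
        j then 1 else 0) + (\<Sum>u\<in>{()}. s * y k * a j)))"
      using y[OF ij(1)] by simp
  qed
  also have "\<dots> = set_det R R f * set_det R R (\<lambda>k j. (if k =
      j then 1 else 0) + (\<Sum>u\<in>{()}. s * y k * a j))"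
    by (rule set_det_mult[OF R])
  also have "set_det R R (\<lambda>k j. (if k = j then 1 else 0) + (\<Sum>u\<in>{()}. s * y k * a j)) =
     set_det {()} {()} (\<lambda>k l. (if k = l then 1 else 0) + (\<Sum>i\<in>R. a i * (s * y i)))"
    by (rule set_det_one_plus_mult_commute) (use R in auto)
  also have "\<dots> = 1 + s * (\<Sum>j\<in>R. a j * y j)"
    unfolding set_det_def by (subst det_single) (auto simp: sum_distrib_left algebra_simps)
  finally show ?thesis .
qed

text \<open>The tangent inequality of the concave function \<open>log det\<close>.\<close>

lemma set_det_gram_reweight_le:
  fixes x :: "'r \<Rightarrow> 'e \<Rightarrow> real"
  assumes R: "finite R" and E: "finite E" and z: "z > 0" and S: "S \<subseteq> E"
    and pd: "\<And>v. (\<And>e. e \<in> E \<Longrightarrow> (\<Sum>i\<in>R. x i e * v i) = 0) \<Longrightarrow> \<forall>i\<in>R. v i = 0"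
    and y: "\<And>e i. e \<in> S \<Longrightarrow> i \<in> R \<Longrightarrow> (\<Sum>j\<in>R. (\<Sum>g\<in>E. x i g * x j g) * y e j) = x i e"
    and q: "\<And>e. e \<in> S \<Longrightarrow> (\<Sum>j\<in>R. x j e * y e j) = q"
  shows "set_det R R (\<lambda>i j. \<Sum>e\<in>E. (if e \<in> S then z else 1) * x i e * x j e) \<le>
    set_det R R (\<lambda>i j. \<Sum>e\<in>E. x i e * x j e) * exp ((z - 1) * q * real (card S))"
proof -
  define dot where "dot e v = (\<Sum>i\<in>R. x i e * v i)" for e and v :: "'r \<Rightarrow> real"
  define w where "w S e = (if e \<in> S then z else 1)" for S :: "'e set" and e
  define G where "G S i j = (\<Sum>e\<in>E. w S e * x i e * x j e)" for S i j
  define Q where "Q S v = (\<Sum>e\<in>E. w S e * (dot e v)\<^sup>2)" for S v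
  have wpos: "w S e > 0" for S e using z by (simp add: w_def)
  have GQ: "(\<Sum>i\<in>R. (\<Sum>j\<in>R. G S i j * v j) * u i) = (\<Sum>e\<in>E. w S e * dot e v * dot e u)" for S v u
  proof -
    have "(\<Sum>i\<in>R. (\<Sum>j\<in>R. G S i j * v j) * u i) =
        (\<Sum>i\<in>R. \<Sum>j\<in>R. \<Sum>e\<in>E. w S e * (x j e * v j) * (x i e * u i))"
      unfolding G_def by (simp add: sum_distrib_left sum_distrib_right algebra_simps)
    also have "\<dots> = (\<Sum>i\<in>R. \<Sum>e\<in>E. \<Sum>j\<in>R. w S e * (x j e * v j) * (x i e * u i))"
      by (intro sum.cong[OF refl] sum.swap)
    also have "\<dots> = (\<Sum>e\<in>E. \<Sum>i\<in>R. \<Sum>j\<in>R. w S e * (x j e * v j) * (x i e * u i))"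
      by (rule sum.swap)
    also have "\<dots> = (\<Sum>e\<in>E. w S e * dot e v * dot e u)"
      unfolding dot_def
      by (rule sum.cong[OF refl], subst sum.swap) (simp add: sum_distrib_left sum_distrib_right
          algebra_simps)
    finally show ?thesis .
  qed
  have GQ': "(\<Sum>i\<in>R. (\<Sum>j\<in>R. G S i j * v j) * v i) = Q S v" for S v
    unfolding GQ Q_def by (simp add: power2_eq_square mult.assoc)
  have Gsym: "(\<Sum>i\<in>R. (\<Sum>j\<in>R. G S i j * v j) * u i) = (\<Sum>i\<in>R. (\<Sum>j\<in>R. G S i j * u j) * v i)" for S v u
    unfolding GQ by (simp add: mult.assoc mult.left_commute mult.commute)
  have Qnn: "Q S v \<ge> 0" for S v unfolding Q_def using wpos
      by (intro sum_nonneg mult_nonneg_nonneg) (auto simp: less_imp_le)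
  have dnz: "set_det R R (G S) \<noteq> 0" for S
  proof
    assume "set_det R R (G S) = 0"
    then obtain v where v: "\<exists>r\<in>R. v r \<noteq> 0" "\<forall>t\<in>R. (\<Sum>r\<in>R. v r * G S r t) = 0"
      unfolding set_det_zero_left_kernel[OF R R refl] by blast
    have "(\<Sum>j\<in>R. G S i j * v j) = 0" if "i \<in> R" for i
      using v(2)[rule_format, OF that] unfolding G_def by (simp add: algebra_simps)
    then have "Q S v = 0" unfolding GQ'[symmetric] by simp
    then have "\<forall>e\<in>E. w S e * (dot e v)\<^sup>2 = 0"
      unfolding Q_def using wpos by (subst (asm) sum_nonneg_eq_0_iff) (auto simp: E less_imp_le)
    then have "\<And>e. e \<in> E \<Longrightarrow> dot e v = 0" using wpos[of S] by (auto simp: less_le)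
    then show False using pd[of v] v(1) unfolding dot_def by blast
  qed
  have dnn: "set_det R R (G S) \<ge> 0" for S
    unfolding G_def set_det_cauchy_binet[OF E] using wpos
    by (intro sum_nonneg mult_nonneg_nonneg prod_nonneg) (auto simp: less_imp_le)
  \<comment> \<open>The faces of \<open>S'\<close> are reweighted one at a time. Each change is a
    rank-one update, whose factor involves the quantity x_e^T G^(-1) x_e for the current Gram
    matrix; it has to be compared with its value \<open>q\<close> for the original one.\<close>
  have main: "set_det R R (G S') \<le> set_det R R (G {}) * exp ((z - 1) * q * real (card S'))"
      if "S' \<subseteq> S" for S'
    using finite_subset[OF that finite_subset[OF S E]] that
  proof (induction S' rule: finite_induct)
    case empty
    then show ?case by simp
  next
    case (insert e S')
    have eS: "e \<in> S" "e \<in> E" using insert.prems S by auto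
    obtain u where u: "\<And>i. i \<in> R \<Longrightarrow> (\<Sum>j\<in>R. G S' i j * u j) = x i e"
      using set_det_solve[OF R dnz[of S'], of "\<lambda>i. x i e"] by blast
    have ye: "(\<Sum>j\<in>R. G {} i j * y e j) = x i e" if "i \<in> R" for i
      using y[OF eS(1) that] unfolding G_def w_def by simp
    have "set_det R R (G (insert e S')) = set_det R R (\<lambda>i j. G S' i j + (z - 1) * x i e * x j e)"
    proof (rule set_det_cong[OF R R refl])
      fix i j
      have "G (insert e S') i j = (\<Sum>g\<in>E. w S' g * x i g * x j g + (if g =
          e then (z - 1) * x i e * x j e else 0))"
        unfolding G_def using insert.hyps(2) by (intro sum.cong) (auto simp: w_def algebra_simps)
      also have "\<dots> = G S' i j + (z - 1) * x i e * x j e"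
        unfolding sum.distrib G_def using E eS by simp
      finally show "G (insert e S') i j = G S' i j + (z - 1) * x i e * x j e" .
    qed
    also have "\<dots> = set_det R R (G S') * (1 + (z - 1) * (\<Sum>j\<in>R. x j e * u j))"
      by (rule set_det_rank_one_update[OF R u])
    finally have step: "set_det R R (G (insert e S')) =
        set_det R R (G S') * (1 + (z - 1) * dot e u)"
      unfolding dot_def .
    have uu: "Q S' u = dot e u"
      unfolding GQ'[symmetric] dot_def using u by (intro sum.cong) auto
    have yy: "Q {} (y e) = q"
      unfolding GQ'[symmetric] q[OF eS(1), symmetric] using ye by (intro sum.cong) auto
    \<comment> \<open>Monotonicity of x^T G^(-1) x in \<open>G\<close> without inverse matrices:
      both quadratic forms are evaluated at the difference of the solutions \<open>u\<close> and
      \<open>y e\<close> of the two systems, where they are nonnegative.\<close>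
    have quad: "Q T (\<lambda>i. v i - v' i) = Q T v - 2 * (\<Sum>i\<in>R. (\<Sum>j\<in>R. G T i j * v j) * v' i) +
        Q T v'" for T v v'
    proof -
      have "dot g (\<lambda>i. v i - v' i) = dot g v - dot g v'" for g
        unfolding dot_def by (simp add: algebra_simps sum_subtractf)
      then have "Q T (\<lambda>i. v i - v' i) = (\<Sum>e\<in>E. w T e * (dot e v - dot e v')\<^sup>2)" unfolding Q_def
          by (simp only:)
      then show ?thesis unfolding GQ unfolding Q_def
        by (simp add: power2_diff algebra_simps sum.distrib sum_subtractf sum_distrib_left)
    qed
    have c1: "0 \<le> q - 2 * dot e u + Q {} u"
      using Qnn[of "{}" "\<lambda>i. y e i - u i"] ye unfolding quad yy dot_def by simp
    have c2: "0 \<le> dot e u - 2 * q + Q S' (y e)"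
      using Qnn[of S' "\<lambda>i. u i - y e i"] u unfolding quad uu q[OF eS(1), symmetric] by simp
    \<comment> \<open>For z at least 1 the Gram matrix has grown and the quantity has dropped; for z
      < 1 it has risen, but z - 1 is negative. Both cases give the same inequality, so one bound
      yields upper and lower tails.\<close>
    have "(z - 1) * dot e u \<le> (z - 1) * q"
    proof (cases "z \<ge> 1")
      case True
      have "Q {} u \<le> Q S' u" unfolding Q_def using True
          by (intro sum_mono mult_right_mono) (auto simp: w_def)
      then have "dot e u \<le> q" using c1 uu by simp
      then show ?thesis using True by (intro mult_left_mono) auto
    next
      case False
      have "Q S' (y e) \<le> Q {} (y e)" unfolding Q_def using False
          by (intro sum_mono mult_right_mono) (auto simp: w_def)
      then have "q \<le> dot e u" using c2 yy by simp
      then show ?thesis using False by (intro mult_left_mono_neg) auto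
    qed
    then have "1 + (z - 1) * dot e u \<le> exp ((z - 1) * q)"
      using exp_ge_add_one_self[of "(z - 1) * q"] by linarith
    then have "set_det R R (G (insert e S')) \<le> set_det R R (G S') * exp ((z - 1) * q)"
      unfolding step using dnn by (intro mult_left_mono) auto
    also have "\<dots> \<le> set_det R R (G {}) * exp ((z - 1) * q * real (card S')) * exp ((z - 1) * q)"
      using insert by (intro mult_right_mono) auto
    also have "\<dots> = set_det R R (G {}) * exp ((z - 1) * q * real (card (insert e S')))"
      using insert.hyps by (simp add: exp_add[symmetric] algebra_simps)
    finally show ?case .
  qed
  show ?thesis using main[OF subset_refl] unfolding G_def w_def by simp
qed


section \<open>Incidence numbers and Laplacians\<close>

text \<open>Faces are indexed by cardinality, one more than the dimension: ridges are
  \<open>ksets V d\<close> and top faces \<open>ksets V (Suc d)\<close>.\<close>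

definition ksets :: "'a set \<Rightarrow> nat \<Rightarrow> 'a set set" where
  "ksets V q = {\<sigma>. \<sigma> \<subseteq> V \<and> card \<sigma> = q}"

definition below_sign :: "'a::linorder \<Rightarrow> 'a set \<Rightarrow> int" where
  "below_sign x \<sigma> = (-1) ^ card {u\<in>\<sigma>. u < x}"

text \<open>An entry of the boundary matrix. At most one summand is nonzero; writing it as a sum
  makes the function total and spares choosing the removed vertex.\<close>

definition incidence :: "'a::linorder set \<Rightarrow> 'a set \<Rightarrow> int" where
  "incidence \<rho> \<sigma> = (\<Sum>x\<in>\<sigma>. if \<sigma> - {x} = \<rho> then below_sign x \<sigma> else 0)"

lemma finite_ksets [simp, intro]: "finite V \<Longrightarrow> finite (ksets V q)"
  unfolding ksets_def by simp

lemma card_ksets: "finite V \<Longrightarrow> card (ksets V q) = card V choose q"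
  unfolding ksets_def by (rule n_subsets)

lemma ksets_finite: "finite V \<Longrightarrow> \<sigma> \<in> ksets V q \<Longrightarrow> finite \<sigma>"
  unfolding ksets_def using finite_subset by auto

lemma insert_ksets: "finite V \<Longrightarrow> \<sigma> \<in> ksets V q \<Longrightarrow> x \<in> V - \<sigma> \<Longrightarrow> insert x \<sigma> \<in> ksets V (Suc q)"
  using ksets_finite[of V \<sigma> q] by (auto simp: ksets_def)

lemma remove_ksets: "finite V \<Longrightarrow> \<sigma> \<in> ksets V q \<Longrightarrow> x \<in> \<sigma> \<Longrightarrow> \<sigma> - {x} \<in> ksets V (q - 1)"
  using ksets_finite[of V \<sigma> q] by (auto simp: ksets_def)

lemma below_sign_sq [simp]: "below_sign x \<sigma> * below_sign x \<sigma> = 1"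
  unfolding below_sign_def by (simp add: power_add[symmetric] flip: mult_2)

lemma below_sign_nonzero [simp]: "below_sign x \<sigma> \<noteq> 0" unfolding below_sign_def by simp

lemma below_sign_insert:
  assumes "finite \<rho>" "x \<notin> \<rho>"
  shows "below_sign y (insert x \<rho>) = (if x < y then - below_sign y \<rho> else below_sign y \<rho>)"
proof -
  have "{u \<in> insert x \<rho>. u < y} = (if x < y then insert x {u\<in>\<rho>. u < y} else {u\<in>\<rho>. u < y})" by auto
  then show ?thesis unfolding below_sign_def using assms by simp
qed

lemma incidence_remove: "finite \<sigma> \<Longrightarrow> x \<in> \<sigma> \<Longrightarrow> incidence (\<sigma> - {x}) \<sigma> = below_sign x \<sigma>"
proof -
  assume a: "finite \<sigma>" "x \<in> \<sigma>"
  have "(\<sigma> - {y} = \<sigma> - {x}) = (y = x)" if "y \<in> \<sigma>" for y using that a by auto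
  then have "incidence (\<sigma> - {x}) \<sigma> = (\<Sum>y\<in>\<sigma>. if y = x then below_sign y \<sigma> else 0)"
    unfolding incidence_def by (intro sum.cong) auto
  then show ?thesis using a by simp
qed

lemma incidence_insert: "finite \<rho> \<Longrightarrow> x \<notin> \<rho> \<Longrightarrow> incidence \<rho> (insert x \<rho>) = below_sign x \<rho>"
  using incidence_remove[of "insert x \<rho>" x] below_sign_insert[of \<rho> x x] by simp

lemma incidence_nonzeroD: "incidence \<rho> \<sigma> \<noteq> 0 \<Longrightarrow> \<exists>x\<in>\<sigma>. \<rho> = \<sigma> - {x}"
  unfolding incidence_def by (rule ccontr) (auto intro!: sum.neutral)

lemma sum_incidence_up:
  assumes V: "finite V" and s: "\<sigma> \<in> ksets V q"
  shows "(\<Sum>\<tau>\<in>ksets V (Suc q). incidence \<sigma> \<tau> * g \<tau>) = (\<Sum>x\<in>V - \<sigma>. below_sign x \<sigma> * g (insert x \<sigma>))"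
proof -
  have fs: "finite \<sigma>" using ksets_finite[OF V s] .
  have inj: "inj_on (\<lambda>x. insert x \<sigma>) (V - \<sigma>)" by (auto simp: inj_on_def)
  have "(\<Sum>\<tau>\<in>ksets V (Suc q). incidence \<sigma> \<tau> * g \<tau>) =
      (\<Sum>\<tau>\<in>(\<lambda>x. insert x \<sigma>) ` (V - \<sigma>). incidence \<sigma> \<tau> * g \<tau>)"
  proof (rule sum.mono_neutral_right)
    show "(\<lambda>x. insert x \<sigma>) ` (V - \<sigma>) \<subseteq> ksets V (Suc q)" using insert_ksets[OF V s] by auto
    show "\<forall>\<tau>\<in>ksets V (Suc q) - (\<lambda>x. insert x \<sigma>) ` (V - \<sigma>). incidence \<sigma> \<tau> * g \<tau> = 0"
    proof (rule ballI, rule ccontr)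
      fix \<tau> assume t: "\<tau> \<in> ksets V (Suc q) - (\<lambda>x. insert x \<sigma>) ` (V - \<sigma>)" "incidence \<sigma> \<tau> * g \<tau> \<noteq> 0"
      then obtain x where "x \<in> \<tau>" "\<sigma> = \<tau> - {x}" using incidence_nonzeroD[of \<sigma> \<tau>] by auto
      then have "\<tau> = insert x \<sigma>" "x \<in> V - \<sigma>" using t by (auto simp: ksets_def)
      then show False using t by auto
    qed
  qed (use V in auto)
  also have "\<dots> = (\<Sum>x\<in>V - \<sigma>. below_sign x \<sigma> * g (insert x \<sigma>))"
    unfolding sum.reindex[OF inj] o_def using fs by (intro sum.cong) (auto simp: incidence_insert)
  finally show ?thesis .
qed

lemma sum_incidence_down:
  assumes V: "finite V" and s: "\<sigma> \<in> ksets V (Suc q)"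
  shows "(\<Sum>\<rho>\<in>ksets V q. incidence \<rho> \<sigma> * g \<rho>) = (\<Sum>x\<in>\<sigma>. below_sign x \<sigma> * g (\<sigma> - {x}))"
proof -
  have fs: "finite \<sigma>" using ksets_finite[OF V s] .
  have inj: "inj_on (\<lambda>x. \<sigma> - {x}) \<sigma>" by (auto simp: inj_on_def)
  have "(\<Sum>\<rho>\<in>ksets V q. incidence \<rho> \<sigma> * g \<rho>) = (\<Sum>\<rho>\<in>(\<lambda>x. \<sigma> - {x}) ` \<sigma>. incidence \<rho> \<sigma> * g \<rho>)"
  proof (rule sum.mono_neutral_right)
    show "(\<lambda>x. \<sigma> - {x}) ` \<sigma> \<subseteq> ksets V q" using remove_ksets[OF V s] by auto
    show "\<forall>\<rho>\<in>ksets V q - (\<lambda>x. \<sigma> - {x}) ` \<sigma>. incidence \<rho> \<sigma> * g \<rho> = 0"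
      using incidence_nonzeroD[of _ \<sigma>] by auto
  qed (use V in auto)
  also have "\<dots> = (\<Sum>x\<in>\<sigma>. below_sign x \<sigma> * g (\<sigma> - {x}))"
    unfolding sum.reindex[OF inj] o_def using fs by (intro sum.cong) (auto simp: incidence_remove)
  finally show ?thesis .
qed

text \<open>Of two vertices removed from a face, the larger one changes its position when the
  smaller one goes first, the smaller one does not. This single sign change makes the boundary map
  square to zero.\<close>

lemma below_sign_swap:
  assumes "finite \<tau>" "x \<in> \<tau>" "y \<in> \<tau>" "x \<noteq> y"
  shows "below_sign x \<tau> * below_sign y (\<tau> - {x}) = - (below_sign y \<tau> * below_sign x (\<tau> - {y}))"
proof -
  have 1: "below_sign y \<tau> = (if x < y then - below_sign y (\<tau> - {x}) else below_sign y (\<tau> - {x}))"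
    using below_sign_insert[of "\<tau> - {x}" x y] assms by (simp add: insert_absorb)
  have 2: "below_sign x \<tau> = (if y < x then - below_sign x (\<tau> - {y}) else below_sign x (\<tau> - {y}))"
    using below_sign_insert[of "\<tau> - {y}" y x] assms by (simp add: insert_absorb)
  show ?thesis
  proof (cases x y rule: linorder_cases)
    case less
    then have "below_sign y \<tau> = - below_sign y (\<tau> - {x})" "below_sign x \<tau> = below_sign x (\<tau> - {y})"
      unfolding 1 2 by (simp_all only: if_True not_less_iff_gr_or_eq simp_thms if_False less_not_sym
          if_P)
    then show ?thesis by simp
  next
    case greater
    then have "below_sign y \<tau> = below_sign y (\<tau> - {x})" "below_sign x \<tau> = - below_sign x (\<tau> - {y})"
      unfolding 1 2 by (simp_all only: if_True not_less_iff_gr_or_eq simp_thms if_False less_not_sym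
          if_P)
    then show ?thesis by simp
  qed (use assms in auto)
qed

lemma incidence_incidence:
  assumes V: "finite V" and t: "\<tau> \<in> ksets V (Suc (Suc q))"
  shows "(\<Sum>\<sigma>\<in>ksets V (Suc q). incidence \<sigma> \<tau> * incidence \<rho> \<sigma>) = 0"
proof -
  have ft: "finite \<tau>" using ksets_finite[OF V t] .
  define h where "h x y = (if x \<noteq> y \<and> \<tau> - {x} - {y} =
      \<rho> then below_sign x \<tau> * below_sign y (\<tau> - {x}) else 0)" for x y
  have "(\<Sum>\<sigma>\<in>ksets V (Suc q). incidence \<sigma> \<tau> * incidence \<rho> \<sigma>) =
      (\<Sum>x\<in>\<tau>. below_sign x \<tau> * incidence \<rho> (\<tau> - {x}))"
    by (rule sum_incidence_down[OF V t])
  also have "\<dots> = (\<Sum>x\<in>\<tau>. \<Sum>y\<in>\<tau>. h x y)"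
  proof (rule sum.cong[OF refl])
    fix x assume x: "x \<in> \<tau>"
    have "below_sign x \<tau> * incidence \<rho> (\<tau> - {x}) = (\<Sum>y\<in>\<tau> - {x}. h x y)"
      unfolding incidence_def sum_distrib_left by (intro sum.cong) (auto simp: h_def)
    also have "\<dots> = (\<Sum>y\<in>\<tau>. h x y)" using ft x by (intro sum.mono_neutral_left) (auto simp: h_def)
    finally show "below_sign x \<tau> * incidence \<rho> (\<tau> - {x}) = (\<Sum>y\<in>\<tau>. h x y)" .
  qed
  finally have S: "(\<Sum>\<sigma>\<in>ksets V (Suc q). incidence \<sigma> \<tau> * incidence \<rho> \<sigma>) = (\<Sum>x\<in>\<tau>. \<Sum>y\<in>\<tau>. h x y)" .
  have "(\<Sum>x\<in>\<tau>. \<Sum>y\<in>\<tau>. h x y) = (\<Sum>x\<in>\<tau>. \<Sum>y\<in>\<tau>. - h y x)"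
  proof (intro sum.cong refl)
    fix x y assume xy: "x \<in> \<tau>" "y \<in> \<tau>"
    have e: "\<tau> - {x} - {y} = \<tau> - {y} - {x}" by auto
    show "h x y = - h y x" using below_sign_swap[OF ft xy] unfolding h_def e by auto
  qed
  also have "\<dots> = - (\<Sum>x\<in>\<tau>. \<Sum>y\<in>\<tau>. h x y)" by (subst sum.swap) (simp add: sum_negf)
  finally show ?thesis using S by simp
qed

definition up_laplacian :: "'a::linorder set \<Rightarrow> nat \<Rightarrow> 'a set \<Rightarrow> 'a set \<Rightarrow> int" where
  "up_laplacian V q \<sigma> \<sigma>' = (\<Sum>\<tau>\<in>ksets V (Suc q). incidence \<sigma> \<tau> * incidence \<sigma>' \<tau>)"

text \<open>For \<open>q = 0\<close> truncated subtraction returns to size 0, where every incidence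
  number with the empty face as second argument is zero. So the operator vanishes on the empty face,
  as it should with nothing below it.\<close>

definition down_laplacian :: "'a::linorder set \<Rightarrow> nat \<Rightarrow> 'a set \<Rightarrow> 'a set \<Rightarrow> int" where
  "down_laplacian V q \<sigma> \<sigma>' = (\<Sum>\<rho>\<in>ksets V (q - 1). incidence \<rho> \<sigma> * incidence \<rho> \<sigma>')"

text \<open>On the diagonal, the vertices of the face and those outside it together number
  \<open>card V\<close>. Off the diagonal only faces that differ by exchanging one vertex matter:
  they have one common coface and one common facet, whose two contributions have opposite
  signs.\<close>

lemma laplacian_sum:
  assumes V: "finite V" and s: "\<sigma> \<in> ksets V q" and s': "\<sigma>' \<in> ksets V q"
  shows "up_laplacian V q \<sigma> \<sigma>' + down_laplacian V q \<sigma> \<sigma>' = (if \<sigma> = \<sigma>' then int (card V) else 0)"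
proof -
  have fs: "finite \<sigma>" "finite \<sigma>'" using ksets_finite[OF V] s s' by auto
  have c: "card \<sigma> = q" "card \<sigma>' = q" "\<sigma> \<subseteq> V" "\<sigma>' \<subseteq> V" using s s' by (auto simp: ksets_def)
  have U: "up_laplacian V q \<sigma> \<sigma>' = (\<Sum>x\<in>V - \<sigma>. below_sign x \<sigma> * incidence \<sigma>' (insert x \<sigma>))"
    unfolding up_laplacian_def by (rule sum_incidence_up[OF V s])
  have D: "down_laplacian V q \<sigma> \<sigma>' = (\<Sum>x\<in>\<sigma>. below_sign x \<sigma> * incidence (\<sigma> - {x}) \<sigma>')"
  proof (cases q)
    case 0
    then have "\<sigma> = {}" using c fs by auto
    then show ?thesis unfolding down_laplacian_def by (simp add: incidence_def)
  next
    case (Suc p)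
    then show ?thesis unfolding down_laplacian_def
        using sum_incidence_down[OF V, of \<sigma> p "\<lambda>\<rho>. incidence \<rho> \<sigma>'"] s by simp
  qed
  show ?thesis
  proof (cases "\<sigma> = \<sigma>'")
    case True
    have "up_laplacian V q \<sigma> \<sigma>' = (\<Sum>x\<in>V - \<sigma>. 1)"
      unfolding U using fs True by (intro sum.cong) (auto simp: incidence_insert)
    moreover have "down_laplacian V q \<sigma> \<sigma>' = (\<Sum>x\<in>\<sigma>. 1)"
      unfolding D using fs True by (intro sum.cong) (auto simp: incidence_remove)
    moreover have "card (V - \<sigma>) + card \<sigma> = card V"
      using c V fs card_mono[OF V c(3)] by (simp add: card_Diff_subset)
    ultimately show ?thesis using True by simp
  next
    case False
    show ?thesis
    proof (cases "\<exists>\<omega> x y. x \<noteq> y \<and> x \<notin> \<omega> \<and> y \<notin> \<omega> \<and> \<sigma> = insert y \<omega> \<and> \<sigma>' = insert x \<omega>")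
      case True
      then obtain \<omega> x y where w: "x \<noteq> y" "x \<notin> \<omega>" "y \<notin> \<omega>" "\<sigma> = insert y \<omega>" "\<sigma>' = insert x \<omega>" by blast
      have fw: "finite \<omega>" using w fs by simp
      have "up_laplacian V q \<sigma> \<sigma>' = (\<Sum>z\<in>V - \<sigma>.
          if z = x then below_sign x \<sigma> * below_sign y \<sigma>' else 0)"
        unfolding U
      proof (intro sum.cong refl)
        fix z assume z: "z \<in> V - \<sigma>"
        show "below_sign z \<sigma> * incidence \<sigma>' (insert z \<sigma>) = (if z =
            x then below_sign x \<sigma> * below_sign y \<sigma>' else 0)"
        proof (cases "z = x")
          case True
          have "insert x \<sigma> = insert y \<sigma>'" using w by auto
          then show ?thesis using True incidence_insert[of \<sigma>' y] fs w by auto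
        next
          case False
          have "x \<in> \<sigma>'" "x \<notin> insert z \<sigma>" using False w by auto
          then have "incidence \<sigma>' (insert z \<sigma>) = 0" using incidence_nonzeroD[of \<sigma>' "insert z \<sigma>"]
              by auto
          then show ?thesis using False by simp
        qed
      qed
      moreover have "x \<in> V - \<sigma>" using w c by auto
      ultimately have u: "up_laplacian V q \<sigma> \<sigma>' = below_sign x \<sigma> * below_sign y \<sigma>'" using V by simp
      have "down_laplacian V q \<sigma> \<sigma>' = (\<Sum>z\<in>\<sigma>. if z = y then below_sign y \<sigma> * below_sign x \<sigma>' else 0)"
        unfolding D
      proof (intro sum.cong refl)
        fix z assume z: "z \<in> \<sigma>"
        show "below_sign z \<sigma> * incidence (\<sigma> - {z}) \<sigma>' = (if z =
            y then below_sign y \<sigma> * below_sign x \<sigma>' else 0)"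
        proof (cases "z = y")
          case True
          have "\<sigma> - {y} = \<sigma>' - {x}" using w by auto
          then show ?thesis using True incidence_remove[of \<sigma>' x] fs w by auto
        next
          case False
          have "y \<in> \<sigma> - {z}" "y \<notin> \<sigma>'" using False w by auto
          then have "incidence (\<sigma> - {z}) \<sigma>' = 0" using incidence_nonzeroD[of "\<sigma> - {z}" \<sigma>'] by blast
          then show ?thesis using False by simp
        qed
      qed
      moreover have "y \<in> \<sigma>" using w by auto
      ultimately have d: "down_laplacian V q \<sigma> \<sigma>' = below_sign y \<sigma> * below_sign x \<sigma>'" using fs
          by simp
      have "below_sign x \<sigma> * below_sign y \<sigma>' + below_sign y \<sigma> * below_sign x \<sigma>' = 0"
      proof -
        have e: "below_sign x \<sigma> = (if y < x then - below_sign x \<omega> else below_sign x \<omega>)"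
          "below_sign y \<sigma>' = (if x < y then - below_sign y \<omega> else below_sign y \<omega>)"
          "below_sign y \<sigma> = below_sign y \<omega>" "below_sign x \<sigma>' = below_sign x \<omega>"
          unfolding w(4,5) below_sign_insert[OF fw w(3)] below_sign_insert[OF fw w(2)] by simp_all
        show ?thesis unfolding e using w(1) by (cases x y rule: linorder_cases) simp_all
      qed
      then show ?thesis using u d False by simp
    next
      case nadj: False
      have "up_laplacian V q \<sigma> \<sigma>' = 0" unfolding U
      proof (rule sum.neutral, rule ballI, rule ccontr)
        fix z assume z: "z \<in> V - \<sigma>" "below_sign z \<sigma> * incidence \<sigma>' (insert z \<sigma>) \<noteq> 0"
        then obtain y where y: "y \<in> insert z \<sigma>" "\<sigma>' = insert z \<sigma> - {y}"
            using incidence_nonzeroD[of \<sigma>' "insert z \<sigma>"] by auto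
        then have "y \<noteq> z" using False z by auto
        then have "z \<noteq> y \<and> z \<notin> \<sigma> - {y} \<and> y \<notin> \<sigma> - {y} \<and> \<sigma> = insert y (\<sigma> - {y}) \<and> \<sigma>' =
            insert z (\<sigma> - {y})"
          using y z by auto
        then show False using nadj by blast
      qed
      moreover have "down_laplacian V q \<sigma> \<sigma>' = 0" unfolding D
      proof (rule sum.neutral, rule ballI, rule ccontr)
        fix z assume z: "z \<in> \<sigma>" "below_sign z \<sigma> * incidence (\<sigma> - {z}) \<sigma>' \<noteq> 0"
        then obtain x where x: "x \<in> \<sigma>'" "\<sigma> - {z} = \<sigma>' - {x}"
            using incidence_nonzeroD[of "\<sigma> - {z}" \<sigma>'] by auto
        have "x \<noteq> z" using False z x by auto
        moreover have "z \<notin> \<sigma>' - {x}" using x by auto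
        ultimately have "x \<noteq> z \<and> x \<notin> \<sigma> - {z} \<and> z \<notin> \<sigma> - {z} \<and> \<sigma> = insert z (\<sigma> - {z}) \<and> \<sigma>' =
            insert x (\<sigma> - {z})"
          using z x by auto
        then show False using nadj by blast
      qed
      ultimately show ?thesis using False by simp
    qed
  qed
qed

lemma down_up_laplacian:
  assumes V: "finite V"
  shows "(\<Sum>\<kappa>\<in>ksets V q. down_laplacian V q \<sigma> \<kappa> * up_laplacian V q \<kappa> \<sigma>') = 0"
proof (cases q)
  case 0
  have "down_laplacian V q \<sigma> \<kappa> = 0" if "\<kappa> \<in> ksets V q" for \<kappa>
  proof -
    have "\<kappa> = {}" using that 0 ksets_finite[OF V that] by (auto simp: ksets_def)
    then show ?thesis unfolding down_laplacian_def incidence_def by simp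
  qed
  then show ?thesis by simp
next
  case (Suc p)
  have "(\<Sum>\<kappa>\<in>ksets V q. down_laplacian V q \<sigma> \<kappa> * up_laplacian V q \<kappa> \<sigma>') =
     (\<Sum>\<kappa>\<in>ksets V q. \<Sum>\<rho>\<in>ksets V p. \<Sum>\<tau>\<in>ksets V (Suc q). incidence \<rho> \<sigma> * incidence \<sigma>' \<tau> *
         (incidence \<kappa> \<tau> * incidence \<rho> \<kappa>))"
    unfolding down_laplacian_def up_laplacian_def Suc sum_product by (simp add: algebra_simps)
  also have "\<dots> = (\<Sum>\<rho>\<in>ksets V p. \<Sum>\<kappa>\<in>ksets V q. \<Sum>\<tau>\<in>ksets V (Suc q). incidence \<rho> \<sigma> * incidence \<sigma>' \<tau> *
      (incidence \<kappa> \<tau> * incidence \<rho> \<kappa>))"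
    by (rule sum.swap)
  also have "\<dots> = (\<Sum>\<rho>\<in>ksets V p. \<Sum>\<tau>\<in>ksets V (Suc q). \<Sum>\<kappa>\<in>ksets V q. incidence \<rho> \<sigma> * incidence \<sigma>' \<tau> *
      (incidence \<kappa> \<tau> * incidence \<rho> \<kappa>))"
    by (intro sum.cong refl sum.swap)
  also have "\<dots> = 0"
    unfolding sum_distrib_left[symmetric] Suc using incidence_incidence[OF V]
        by (intro sum.neutral ballI) auto
  finally show ?thesis .
qed

lemma up_laplacian_sym: "up_laplacian V q \<sigma> \<sigma>' = up_laplacian V q \<sigma>' \<sigma>"
  unfolding up_laplacian_def by (simp add: mult.commute)

lemma down_laplacian_sym: "down_laplacian V q \<sigma> \<sigma>' = down_laplacian V q \<sigma>' \<sigma>"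
  unfolding down_laplacian_def by (simp add: mult.commute)

text \<open>The product of the down- and the up-Laplacian vanishes because the boundary squares to
  zero, so (1 + Ldown)(1 + Lup) = 1 + Ldown + Lup, a multiple of the identity. This is the explicit
  inverse of the Gram matrix.\<close>

lemma one_plus_laplacian_mult:
  assumes V: "finite V" and s: "\<sigma> \<in> ksets V q" and s': "\<sigma>' \<in> ksets V q"
  shows "(\<Sum>\<kappa>\<in>ksets V q. ((if \<sigma> = \<kappa> then 1 else 0) + down_laplacian V q \<sigma> \<kappa>) * ((if \<kappa> =
      \<sigma>' then 1 else 0) + up_laplacian V q \<kappa> \<sigma>')) =
    (1 + int (card V)) * (if \<sigma> = \<sigma>' then 1 else 0)"
proof -
  have "(\<Sum>\<kappa>\<in>ksets V q. ((if \<sigma> = \<kappa> then 1 else 0) + down_laplacian V q \<sigma> \<kappa>) * ((if \<kappa> =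
      \<sigma>' then 1 else 0) + up_laplacian V q \<kappa> \<sigma>')) =
    (\<Sum>\<kappa>\<in>ksets V q. (if \<kappa> = \<sigma> then (if \<sigma> = \<sigma>' then 1 else 0) + up_laplacian V q \<sigma> \<sigma>' else 0) +
        (if \<kappa> = \<sigma>' then down_laplacian V q \<sigma> \<sigma>' else 0) +
            down_laplacian V q \<sigma> \<kappa> * up_laplacian V q \<kappa> \<sigma>')"
    by (intro sum.cong) (auto simp: algebra_simps)
  also have "\<dots> = (if \<sigma> = \<sigma>' then 1 else 0) + up_laplacian V q \<sigma> \<sigma>' + down_laplacian V q \<sigma> \<sigma>'"
    unfolding sum.distrib down_up_laplacian[OF V] using V s s' by simp
  finally show ?thesis using laplacian_sum[OF assms] by auto
qed

text \<open>Sylvester's identity equates the up-determinant at size \<open>q\<close> with the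
  down-determinant at size \<open>Suc q\<close>. The latter times the up-determinant at
  \<open>Suc q\<close> is the determinant of a scalar matrix, and Pascal's rule divides the
  exponents.\<close>

lemma det_one_plus_up_laplacian:
  assumes V: "finite V" and m: "card V \<ge> 1"
  shows "set_det (ksets V q) (ksets V q) (\<lambda>\<sigma> \<sigma>'. (if \<sigma> =
      \<sigma>' then 1 else 0) + up_laplacian V q \<sigma> \<sigma>') =
    (1 + int (card V)) ^ ((card V - 1) choose q)"
proof (induction q)
  case 0
  have k0: "ksets V 0 = {{}}" using V by (auto simp: ksets_def dest: finite_subset)
  have "up_laplacian V 0 {} {} = int (card V)"
    using laplacian_sum[OF V, of "{}" 0 "{}"] by (simp add: k0 down_laplacian_def incidence_def)
  moreover have "enum_set {{} :: 'a set} 0 = {}" using enum_set_mem[of "{{} :: 'a set}" 0] by simp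
  ultimately show ?case unfolding k0 set_det_def by (subst det_single) auto
next
  case (Suc q)
  let ?D = "\<lambda>q. set_det (ksets V q) (ksets V q) (\<lambda>\<sigma> \<sigma>'. (if \<sigma> =
      \<sigma>' then 1 else 0) + up_laplacian V q \<sigma> \<sigma>')"
  let ?E = "set_det (ksets V (Suc q)) (ksets V (Suc q)) (\<lambda>\<sigma> \<sigma>'. (if \<sigma> =
      \<sigma>' then 1 else 0) + down_laplacian V (Suc q) \<sigma> \<sigma>')"
  have "?D q = ?E"
    unfolding up_laplacian_def down_laplacian_def diff_Suc_1
    by (rule set_det_one_plus_mult_commute[where f=incidence and g="\<lambda>\<tau> \<sigma>. incidence \<sigma> \<tau>"]) (use V in
        auto)
  moreover have "?E * ?D (Suc q) = (1 + int (card V)) ^ (card V choose Suc q)"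
  proof -
    have "?E * ?D (Suc q) = set_det (ksets V (Suc q)) (ksets V (Suc q)) (\<lambda>\<sigma> \<sigma>'. (1 +
        int (card V)) * (if \<sigma> = \<sigma>' then 1 else 0))"
      unfolding set_det_mult[OF finite_ksets[OF V], symmetric]
      by (rule set_det_cong) (use V one_plus_laplacian_mult[OF V] in auto)
    then show ?thesis using set_det_one[OF finite_ksets[OF V], where 'a=int]
        by (simp only: set_det_smult card_ksets[OF V])
  qed
  moreover have "card V choose Suc q = (card V - 1 choose q) + (card V - 1 choose Suc q)"
    using m by (cases "card V") auto
  ultimately have "(1 + int (card V)) ^ (card V - 1 choose q) * ?D (Suc q) =
      (1 + int (card V)) ^ (card V - 1 choose q) * (1 + int (card V)) ^ (card V - 1 choose Suc q)"
    using Suc.IH by (simp only: power_add)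
  moreover have "(1 + int (card V)) ^ (card V - 1 choose q) \<noteq> 0" by simp
  ultimately show ?case using mult_left_cancel by blast
qed

text \<open>Of the cofaces of a ridge avoiding \<open>v\<close>, exactly one contains
  \<open>v\<close>, and no other ridge avoiding \<open>v\<close> lies in it. Those cofaces
  contribute the identity; all others are cofaces inside \<open>V - {v}\<close>.\<close>

lemma gram_incidence:
  assumes V: "finite V" and v: "v \<in> V" and s: "\<sigma> \<in> ksets (V - {v}) d" and s': "\<sigma>' \<in> ksets (V - {v})
      d"
  shows "(\<Sum>\<tau>\<in>ksets V (Suc d). incidence \<sigma> \<tau> * incidence \<sigma>' \<tau>) =
    (if \<sigma> = \<sigma>' then 1 else 0) + up_laplacian (V - {v}) d \<sigma> \<sigma>'"
proof -
  have sV: "\<sigma> \<in> ksets V d" and vs: "v \<notin> \<sigma>" "v \<notin> \<sigma>'" using s s' by (auto simp: ksets_def)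
  have fs: "finite \<sigma>" using ksets_finite[OF V sV] .
  have "(\<Sum>\<tau>\<in>ksets V (Suc d). incidence \<sigma> \<tau> * incidence \<sigma>' \<tau>) =
      (\<Sum>x\<in>V - \<sigma>. below_sign x \<sigma> * incidence \<sigma>' (insert x \<sigma>))"
    by (rule sum_incidence_up[OF V sV])
  also have "V - \<sigma> = insert v (V - {v} - \<sigma>)" using v vs by auto
  also have "(\<Sum>x\<in>insert v (V - {v} - \<sigma>). below_sign x \<sigma> * incidence \<sigma>' (insert x \<sigma>)) =
     below_sign v \<sigma> * incidence \<sigma>' (insert v \<sigma>) +
         (\<Sum>x\<in>V - {v} - \<sigma>. below_sign x \<sigma> * incidence \<sigma>' (insert x \<sigma>))"
    using V by (subst sum.insert) auto
  also have "(\<Sum>x\<in>V - {v} - \<sigma>. below_sign x \<sigma> * incidence \<sigma>' (insert x \<sigma>)) =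
      up_laplacian (V - {v}) d \<sigma> \<sigma>'"
    unfolding up_laplacian_def by (rule sum_incidence_up[symmetric]) (use V s in auto)
  also have "below_sign v \<sigma> * incidence \<sigma>' (insert v \<sigma>) = (if \<sigma> = \<sigma>' then 1 else 0)"
  proof (cases "\<sigma> = \<sigma>'")
    case True
    then show ?thesis using fs vs by (auto simp: incidence_insert)
  next
    case False
    have "incidence \<sigma>' (insert v \<sigma>) = 0"
      using incidence_nonzeroD[of \<sigma>' "insert v \<sigma>"] False vs by auto
    then show ?thesis using False by simp
  qed
  finally show ?thesis .
qed

text \<open>This evaluates x^T (1 + Ldown) x for the reduced boundary x of a face. If the face
  avoids \<open>v\<close>, x has d + 1 unit entries and the boundary of x is zero; otherwise x is
  one signed ridge, whose boundary has d unit entries. The value is d + 1 in both cases.\<close>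

lemma reduced_face_energy:
  assumes V: "finite V" and v: "v \<in> V" and d: "d \<ge> 1" and t: "\<tau> \<in> ksets V (Suc d)"
  shows "(\<Sum>\<sigma>\<in>ksets (V - {v}) d. incidence \<sigma> \<tau> * incidence \<sigma> \<tau>) +
     (\<Sum>\<rho>\<in>ksets (V - {v}) (d - 1). (\<Sum>\<sigma>\<in>ksets (V - {v}) d. incidence \<rho> \<sigma> * incidence \<sigma> \<tau>)\<^sup>2) =
         int d + 1"
proof -
  let ?V = "V - {v}"
  have V': "finite ?V" using V by simp
  have ft: "finite \<tau>" using ksets_finite[OF V t] .
  have ct: "card \<tau> = Suc d" using t by (auto simp: ksets_def)
  obtain p where p: "d = Suc p" using d by (cases d) auto
  show ?thesis
  proof (cases "v \<in> \<tau>")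
    case False
    then have t': "\<tau> \<in> ksets ?V (Suc d)" using t by (auto simp: ksets_def)
    have "(\<Sum>\<sigma>\<in>ksets ?V d. incidence \<sigma> \<tau> * incidence \<sigma> \<tau>) = (\<Sum>x\<in>\<tau>. 1)"
      unfolding sum_incidence_down[OF V' t'] using ft
          by (intro sum.cong) (auto simp: incidence_remove)
    moreover have "(\<Sum>\<sigma>\<in>ksets ?V d. incidence \<rho> \<sigma> * incidence \<sigma> \<tau>) = 0" for \<rho>
      using incidence_incidence[OF V', of \<tau> p \<rho>] t' p by (simp add: mult.commute)
    ultimately show ?thesis using ct by simp
  next
    case True
    let ?s = "\<tau> - {v}"
    have s: "?s \<in> ksets ?V d" using t True ft by (auto simp: ksets_def)
    have i: "incidence \<sigma> \<tau> = (if \<sigma> = ?s then below_sign v \<tau> else 0)" if "\<sigma> \<in> ksets ?V d" for \<sigma>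
    proof (cases "\<sigma> = ?s")
      case False
      have "v \<notin> \<sigma>" using that by (auto simp: ksets_def)
      then show ?thesis using incidence_nonzeroD[of \<sigma> \<tau>] False True by auto
    qed (use ft True in \<open>simp add: incidence_remove\<close>)
    have "(\<Sum>\<sigma>\<in>ksets ?V d. incidence \<sigma> \<tau> * incidence \<sigma> \<tau>) = (\<Sum>\<sigma>\<in>ksets ?V d. if \<sigma> = ?s then 1 else 0)"
      using i by (intro sum.cong) auto
    then have 1: "(\<Sum>\<sigma>\<in>ksets ?V d. incidence \<sigma> \<tau> * incidence \<sigma> \<tau>) = 1" using s V' by simp
    have "(\<Sum>\<sigma>\<in>ksets ?V d. incidence \<rho> \<sigma> * incidence \<sigma> \<tau>) = (\<Sum>\<sigma>\<in>ksets ?V d.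
        if \<sigma> = ?s then incidence \<rho> ?s * below_sign v \<tau> else 0)" for \<rho>
      using i by (intro sum.cong) auto
    then have "(\<Sum>\<sigma>\<in>ksets ?V d. incidence \<rho> \<sigma> * incidence \<sigma> \<tau>) =
        incidence \<rho> ?s * below_sign v \<tau>" for \<rho>
      using s V' by simp
    note inner = this
    have "(\<Sum>\<rho>\<in>ksets ?V (d - 1). (\<Sum>\<sigma>\<in>ksets ?V d. incidence \<rho> \<sigma> * incidence \<sigma> \<tau>)\<^sup>2) =
       (\<Sum>\<rho>\<in>ksets ?V p. incidence \<rho> ?s * incidence \<rho> ?s)"
    proof -
      have "(a * below_sign v \<tau>)\<^sup>2 = (a * a) * (below_sign v \<tau> * below_sign v \<tau>)" for a :: int
        unfolding power2_eq_square by (simp only: mult_ac)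
      then show ?thesis using p by (simp add: inner[unfolded p])
    qed
    also have "\<dots> = (\<Sum>x\<in>?s. 1)"
      unfolding sum_incidence_down[OF V' s[unfolded p]] using ft
          by (intro sum.cong) (auto simp: incidence_remove)
    finally show ?thesis using 1 ct ft True by simp
  qed
qed


text \<open>\<open>Y\<close> is (1 + Ldown) applied to the reduced boundary, that is,
  \<open>card V\<close> times the solution of the Gram system; it is kept integral and divided by
  \<open>card V\<close> only later.\<close>

lemma reduced_gram_solution:
  assumes V: "finite V" and v: "v \<in> V" and d: "d \<ge> 1" and t: "\<tau> \<in> ksets V (Suc d)"
  defines "R \<equiv> ksets (V - {v}) d"
  defines "Y \<equiv> \<lambda>j. \<Sum>\<kappa>\<in>R. ((if j = \<kappa> then 1 else 0) +
      down_laplacian (V - {v}) d j \<kappa>) * incidence \<kappa> \<tau>"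
  shows "\<sigma> \<in> R \<Longrightarrow> (\<Sum>j\<in>R. (\<Sum>g\<in>ksets V (Suc d). incidence \<sigma> g * incidence j g) * Y j) =
      int (card V) * incidence \<sigma> \<tau>"
    and "(\<Sum>j\<in>R. incidence j \<tau> * Y j) = int d + 1"
proof -
  let ?V = "V - {v}"
  have V': "finite ?V" using V by simp
  have R: "finite R" unfolding R_def using V' by simp
  have cV: "int (card V) = 1 + int (card ?V)" using card.remove[OF V v] by simp
  let ?up = "\<lambda>i j. (if i = j then 1 else 0) + up_laplacian ?V d i j"
  let ?dn = "\<lambda>i j. (if i = j then 1 else 0) + down_laplacian ?V d i j"
  {
    assume s: "\<sigma> \<in> R"
    have prod: "(\<Sum>j\<in>R. ?up \<sigma> j * ?dn j \<kappa>) = int (card V) * (if \<kappa> = \<sigma> then 1 else 0)"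
        if k: "\<kappa> \<in> R" for \<kappa>
    proof -
      have "(\<Sum>j\<in>R. ?up \<sigma> j * ?dn j \<kappa>) = (\<Sum>j\<in>R. ?dn \<kappa> j * ?up j \<sigma>)"
      proof (rule sum.cong[OF refl])
        fix j
        have "?up \<sigma> j = ?up j \<sigma>" using up_laplacian_sym[of ?V d \<sigma> j] by auto
        moreover have "?dn j \<kappa> = ?dn \<kappa> j" using down_laplacian_sym[of ?V d \<kappa> j] by auto
        ultimately show "?up \<sigma> j * ?dn j \<kappa> = ?dn \<kappa> j * ?up j \<sigma>" by (simp only: mult.commute)
      qed
      also have "\<dots> = int (card V) * (if \<kappa> = \<sigma> then 1 else 0)"
        unfolding R_def cV by (rule one_plus_laplacian_mult[OF V']) (use k s in \<open>auto simp: R_def\<close>)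
      finally show ?thesis .
    qed
    have "(\<Sum>j\<in>R. (\<Sum>g\<in>ksets V (Suc d). incidence \<sigma> g * incidence j g) * Y j) = (\<Sum>j\<in>R. ?up \<sigma> j * Y j)"
      using gram_incidence[OF V v] s unfolding R_def by (intro sum.cong) auto
    also have "\<dots> = (\<Sum>j\<in>R. \<Sum>\<kappa>\<in>R. ?up \<sigma> j * ?dn j \<kappa> * incidence \<kappa> \<tau>)"
      unfolding Y_def by (simp only: sum_distrib_left mult.assoc)
    also have "\<dots> = (\<Sum>\<kappa>\<in>R. (\<Sum>j\<in>R. ?up \<sigma> j * ?dn j \<kappa>) * incidence \<kappa> \<tau>)"
      unfolding sum_distrib_right by (rule sum.swap)
    also have "\<dots> = (\<Sum>\<kappa>\<in>R. if \<kappa> = \<sigma> then int (card V) * incidence \<sigma> \<tau> else 0)"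
      using prod by (intro sum.cong) auto
    also have "\<dots> = int (card V) * incidence \<sigma> \<tau>" using s R by simp
    finally show "(\<Sum>j\<in>R. (\<Sum>g\<in>ksets V (Suc d). incidence \<sigma> g * incidence j g) * Y j) =
        int (card V) * incidence \<sigma> \<tau>" .
  }
  have "(\<Sum>j\<in>R. incidence j \<tau> * Y j) = (\<Sum>j\<in>R. incidence j \<tau> * incidence j \<tau>) +
     (\<Sum>j\<in>R. \<Sum>\<kappa>\<in>R. incidence j \<tau> * down_laplacian ?V d j \<kappa> * incidence \<kappa> \<tau>)"
  proof -
    have "Y j = incidence j \<tau> + (\<Sum>\<kappa>\<in>R. down_laplacian ?V d j \<kappa> * incidence \<kappa> \<tau>)" if "j \<in> R" for j
    proof -
      have "Y j = (\<Sum>\<kappa>\<in>R. (if \<kappa> = j then incidence j \<tau> else 0) +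
          down_laplacian ?V d j \<kappa> * incidence \<kappa> \<tau>)"
        unfolding Y_def by (intro sum.cong) (auto simp: algebra_simps)
      then show ?thesis using that R by (simp add: sum.distrib)
    qed
    then have "(\<Sum>j\<in>R. incidence j \<tau> * Y j) = (\<Sum>j\<in>R. incidence j \<tau> * incidence j \<tau> +
        (\<Sum>\<kappa>\<in>R. incidence j \<tau> * down_laplacian ?V d j \<kappa> * incidence \<kappa> \<tau>))"
      by (intro sum.cong) (auto simp: algebra_simps sum_distrib_left)
    then show ?thesis by (simp add: sum.distrib)
  qed
  also have "(\<Sum>j\<in>R. \<Sum>\<kappa>\<in>R. incidence j \<tau> * down_laplacian ?V d j \<kappa> * incidence \<kappa> \<tau>) =
     (\<Sum>\<rho>\<in>ksets ?V (d - 1). (\<Sum>\<sigma>\<in>R. incidence \<rho> \<sigma> * incidence \<sigma> \<tau>)\<^sup>2)"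
  proof -
    have "(\<Sum>j\<in>R. \<Sum>\<kappa>\<in>R. incidence j \<tau> * down_laplacian ?V d j \<kappa> * incidence \<kappa> \<tau>) =
       (\<Sum>j\<in>R. \<Sum>\<kappa>\<in>R. \<Sum>\<rho>\<in>ksets ?V (d - 1). (incidence \<rho> j * incidence j \<tau>) * (incidence \<rho> \<kappa> *
           incidence \<kappa> \<tau>))"
      unfolding down_laplacian_def by (simp add: sum_distrib_left sum_distrib_right mult_ac)
    also have "\<dots> = (\<Sum>j\<in>R. \<Sum>\<rho>\<in>ksets ?V (d - 1). \<Sum>\<kappa>\<in>R. (incidence \<rho> j * incidence j \<tau>) *
        (incidence \<rho> \<kappa> * incidence \<kappa> \<tau>))"
      by (intro sum.cong refl sum.swap)
    also have "\<dots> = (\<Sum>\<rho>\<in>ksets ?V (d - 1). \<Sum>j\<in>R. \<Sum>\<kappa>\<in>R. (incidence \<rho> j * incidence j \<tau>) *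
        (incidence \<rho> \<kappa> * incidence \<kappa> \<tau>))"
      by (rule sum.swap)
    finally show ?thesis unfolding power2_eq_square sum_product .
  qed
  finally show "(\<Sum>j\<in>R. incidence j \<tau> * Y j) = int d + 1"
    using reduced_face_energy[OF V v d t] unfolding R_def by simp
qed

text \<open>Kalai's formula, before minors are identified with orders of homology groups.\<close>

lemma sum_squared_minors:
  fixes V :: "'a::linorder set" and d :: nat
  assumes V: "finite V" and v: "v \<in> V" and c: "card V \<ge> 2"
  defines "R \<equiv> ksets (V - {v}) d"
  shows "(\<Sum>D | D \<subseteq> ksets V (Suc d) \<and> card D = card R. (set_det R D incidence)\<^sup>2) =
      int (card V) ^ ((card V - 2) choose d)"
proof -
  have V': "finite (V - {v})" using V by simp
  have c': "card (V - {v}) = card V - 1" using V v by simp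
  have cV: "1 + int (card (V - {v})) = int (card V)" using c c' by simp
  have "(\<Sum>D | D \<subseteq> ksets V (Suc d) \<and> card D = card R. (set_det R D incidence)\<^sup>2) =
     set_det R R (\<lambda>i j. \<Sum>e\<in>ksets V (Suc d). 1 * incidence i e * incidence j e)"
    using set_det_cauchy_binet[of "ksets V (Suc d)" R "\<lambda>_. 1" incidence] V by simp
  also have "\<dots> = set_det R R (\<lambda>i j. (if i = j then 1 else 0) + up_laplacian (V - {v}) d i j)"
    by (rule set_det_cong) (use V' gram_incidence[OF V v] in \<open>auto simp: R_def\<close>)
  also have "\<dots> = (1 + int (card (V - {v}))) ^ ((card (V - {v}) - 1) choose d)"
    unfolding R_def by (rule det_one_plus_up_laplacian) (use V' c c' in auto)
  finally show ?thesis unfolding cV using c' by (simp add: numeral_2_eq_2)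
qed

text \<open>The derivative of log det in the weight of a face is the same number
  \<open>(d + 1) / card V\<close> for every face, so the tangent bound depends on \<open>S\<close>
  through its cardinality alone.\<close>

lemma sum_squared_minors_reweight:
  assumes V: "finite V" and v: "v \<in> V" and c: "card V \<ge> 2" and d: "d \<ge> 1" and z: "z > 0" and S: "S \<subseteq>
      ksets V (Suc d)"
  defines "R \<equiv> ksets (V - {v}) d"
  shows "(\<Sum>D | D \<subseteq> ksets V (Suc d) \<and> card D = card R. (real_of_int (set_det R D incidence))\<^sup>2 *
      z ^ card (D \<inter> S))
     \<le> real (card V) ^ ((card V - 2) choose d) * exp ((z - 1) * (real d +
         1) / real (card V) * real (card S))"
proof -
  let ?E = "ksets V (Suc d)" and ?n = "real (card V)"
  let ?x = "\<lambda>i e. real_of_int (incidence i e)"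
  have V': "finite (V - {v})" using V by simp
  have R: "finite R" unfolding R_def using V' by simp
  have E: "finite ?E" using V by simp
  define Y where "Y \<tau> j = (\<Sum>\<kappa>\<in>R. ((if j = \<kappa> then 1 else 0) +
      down_laplacian (V - {v}) d j \<kappa>) * incidence \<kappa> \<tau>)" for \<tau> j
  have "(\<Sum>D | D \<subseteq> ?E \<and> card D = card R. (real_of_int (set_det R D incidence))\<^sup>2 *
      z ^ card (D \<inter> S)) =
    (\<Sum>D | D \<subseteq> ?E \<and> card D = card R. (set_det R D ?x)\<^sup>2 * (\<Prod>e\<in>D. if e \<in> S then z else 1))"
  proof (intro sum.cong refl)
    fix D assume "D \<in> {D. D \<subseteq> ?E \<and> card D = card R}"
    then have "finite D" using E finite_subset by auto
    then show "(real_of_int (set_det R D incidence))\<^sup>2 * z ^ card (D \<inter> S) =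
        (set_det R D ?x)\<^sup>2 * (\<Prod>e\<in>D. if e \<in> S then z else 1)"
      by (simp add: set_det_of_int prod.If_cases)
  qed
  also have "\<dots> = set_det R R (\<lambda>i j. \<Sum>e\<in>?E. (if e \<in> S then z else 1) * ?x i e * ?x j e)"
    by (rule set_det_cauchy_binet[OF E, symmetric])
  also have "\<dots> \<le> set_det R R (\<lambda>i j. \<Sum>e\<in>?E. ?x i e * ?x j e) * exp ((z - 1) * ((real d +
      1) / ?n) * real (card S))"
  proof (rule set_det_gram_reweight_le[OF R E z S, where y="\<lambda>\<tau> j. real_of_int (Y \<tau> j) / ?n"])
    fix u assume u: "\<And>e. e \<in> ?E \<Longrightarrow> (\<Sum>i\<in>R. ?x i e * u i) = 0"
    show "\<forall>i\<in>R. u i = 0"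
    proof
      fix \<sigma> assume s: "\<sigma> \<in> R"
      then have s': "v \<notin> \<sigma>" "\<sigma> \<in> ksets V d" by (auto simp: R_def ksets_def)
      have fs: "finite \<sigma>" using ksets_finite[OF V s'(2)] .
      \<comment> \<open>The reduced boundary of \<open>insert v \<sigma>\<close> is plus or minus
        the unit vector at \<open>\<sigma>\<close>. So the vectors of all faces span, and the Gram
        matrix is positive definite.\<close>
      have "(\<Sum>i\<in>R. ?x i (insert v \<sigma>) * u i) = (\<Sum>i\<in>R. if i = \<sigma> then ?x \<sigma> (insert v \<sigma>) * u \<sigma> else 0)"
      proof (intro sum.cong refl)
        fix i assume i: "i \<in> R"
        have "incidence i (insert v \<sigma>) = 0" if "i \<noteq> \<sigma>"
          using incidence_nonzeroD[of i "insert v \<sigma>"] that i s' by (auto simp: R_def ksets_def)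
        then show "?x i (insert v \<sigma>) * u i = (if i = \<sigma> then ?x \<sigma> (insert v \<sigma>) * u \<sigma> else 0)" by auto
      qed
      then have "?x \<sigma> (insert v \<sigma>) * u \<sigma> = 0"
        using u[of "insert v \<sigma>"] insert_ksets[OF V s'(2), of v] v s' s R by simp
      then show "u \<sigma> = 0" using incidence_insert[OF fs s'(1)] by simp
    qed
  next
    fix e i assume ei: "e \<in> S" "i \<in> R"
    have "(\<Sum>j\<in>R. (\<Sum>g\<in>?E. incidence i g * incidence j g) * Y e j) = int (card V) * incidence i e"
      unfolding Y_def R_def by (rule reduced_gram_solution(1)[OF V v d]) (use ei S in \<open>auto simp:
          R_def\<close>)
    then have "real_of_int (\<Sum>j\<in>R. (\<Sum>g\<in>?E. incidence i g * incidence j g) * Y e j) = ?n * ?x i e"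
        by simp
    then show "(\<Sum>j\<in>R. (\<Sum>g\<in>?E. ?x i g * ?x j g) * (real_of_int (Y e j) / ?n)) = ?x i e"
      using c by (simp add: sum_divide_distrib[symmetric] field_simps)
  next
    fix e assume "e \<in> S"
    then have "(\<Sum>j\<in>R. incidence j e * Y e j) = int d + 1"
      unfolding Y_def R_def using S by (intro reduced_gram_solution(2)[OF V v d]) auto
    then have "real_of_int (\<Sum>j\<in>R. incidence j e * Y e j) = real d + 1" by simp
    then show "(\<Sum>j\<in>R. ?x j e * (real_of_int (Y e j) / ?n)) = (real d + 1) / ?n"
      by (simp add: sum_divide_distrib[symmetric])
  qed
  also have "set_det R R (\<lambda>i j. \<Sum>e\<in>?E. ?x i e * ?x j e) = ?n ^ ((card V - 2) choose d)"
  proof -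
    have "set_det R R (\<lambda>i j. \<Sum>e\<in>?E. ?x i e * ?x j e) =
        real_of_int (set_det R R (\<lambda>i j. \<Sum>e\<in>?E. 1 * incidence i e * incidence j e))"
      by (simp add: set_det_of_int[symmetric])
    also have "set_det R R (\<lambda>i j. \<Sum>e\<in>?E. 1 * incidence i e * incidence j e) =
        int (card V) ^ ((card V - 2) choose d)"
      using set_det_cauchy_binet[OF E, of R "\<lambda>_. 1" incidence] sum_squared_minors[OF V v c, of d]
          unfolding R_def by simp
    finally show ?thesis by simp
  qed
  finally show ?thesis by simp
qed


section \<open>Homology of hypertrees\<close>

lemma below_sign_nth:
  assumes "finite \<sigma>" "j < card \<sigma>"
  shows "below_sign (sorted_list_of_set \<sigma> ! j) \<sigma> = (-1) ^ j"
proof -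
  let ?s = "sorted_list_of_set \<sigma>"
  have l: "length ?s = card \<sigma>" by simp
  have sd: "sorted_wrt (<) ?s" by (rule strict_sorted_list_of_set)
  have "{u\<in>\<sigma>. u < ?s ! j} = (\<lambda>i. ?s ! i) ` {..<j}"
  proof safe
    fix u assume u: "u \<in> \<sigma>" "u < ?s ! j"
    then have "u \<in> set ?s" using assms(1) by simp
    then obtain i where i: "i < length ?s" "u = ?s ! i" unfolding in_set_conv_nth by auto
    have "i < j"
    proof (rule ccontr)
      assume "\<not> i < j"
      then have "?s ! j \<le> ?s ! i" using i(1) by (intro sorted_nth_mono) auto
      then show False using u(2) unfolding i(2) by (meson leD)
    qed
    then show "u \<in> (\<lambda>i. ?s ! i) ` {..<j}" using i by auto
  next
    fix i assume i: "i < j"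
    show "?s ! i \<in> \<sigma>" using i assms l nth_mem[of i ?s] by simp
    show "?s ! i < ?s ! j" using sorted_wrt_nth_less[OF sd i] assms l by simp
  qed
  moreover have "inj_on (\<lambda>i. ?s ! i) {..<j}" using assms l
      by (auto simp: inj_on_def nth_eq_iff_index_eq)
  ultimately show ?thesis unfolding below_sign_def by (simp add: card_image)
qed

lemma lookup_simplicial_boundary:
  assumes K: "finite K" "Poly_Mapping.keys c \<subseteq> K" and fin: "\<And>\<sigma>. \<sigma> \<in> K \<Longrightarrow> finite \<sigma>"
  shows "Poly_Mapping.lookup (simplicial_boundary c) \<rho> =
      (\<Sum>\<sigma>\<in>K. Poly_Mapping.lookup c \<sigma> * incidence \<rho> \<sigma>)"
proof -
  have one: "Poly_Mapping.lookup (\<Sum>j<card \<sigma>. frag_cmul ((-1) ^ j) (frag_of (\<sigma> - {sorted_list_of_set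
      \<sigma> ! j}))) \<rho> = incidence \<rho> \<sigma>"
    if f: "finite \<sigma>" for \<sigma> :: "'a set"
  proof -
    let ?s = "sorted_list_of_set \<sigma>"
    have b: "bij_betw (\<lambda>j. ?s ! j) {..<card \<sigma>} \<sigma>"
      using f bij_betw_nth[of ?s "{..<card \<sigma>}" \<sigma>] by simp
    have "Poly_Mapping.lookup (\<Sum>j<card \<sigma>. frag_cmul ((-1) ^ j) (frag_of (\<sigma> - {?s ! j}))) \<rho> =
       (\<Sum>j<card \<sigma>. if \<sigma> - {?s ! j} = \<rho> then below_sign (?s ! j) \<sigma> else 0)"
      unfolding lookup_sum by (intro sum.cong refl) (auto simp: lookup_frag_of below_sign_nth f)
    also have "\<dots> = incidence \<rho> \<sigma>" unfolding incidence_def by (rule sum.reindex_bij_betw[OF b])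
    finally show ?thesis .
  qed
  have "Poly_Mapping.lookup (simplicial_boundary c) \<rho> =
      (\<Sum>\<sigma>\<in>Poly_Mapping.keys c. Poly_Mapping.lookup c \<sigma> * incidence \<rho> \<sigma>)"
  proof -
    have out: "Poly_Mapping.lookup (frag_extend b c) \<rho> =
        (\<Sum>\<sigma>\<in>Poly_Mapping.keys c. Poly_Mapping.lookup c \<sigma> * Poly_Mapping.lookup (b \<sigma>) \<rho>)"
      for b :: "'a set \<Rightarrow> ('a set \<Rightarrow>\<^sub>0 int)"
      unfolding frag_extend_def by (simp add: lookup_sum)
    show ?thesis unfolding simplicial_boundary_def out
    proof (intro sum.cong refl arg_cong2[where f="(*)"])
      fix \<sigma> assume "\<sigma> \<in> Poly_Mapping.keys c"
      then have "finite \<sigma>" using K fin by blast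
      then show "Poly_Mapping.lookup (\<Sum>j<card \<sigma>. frag_cmul ((-1) ^ j) (frag_of (\<sigma> -
          {sorted_list_of_set \<sigma> ! j}))) \<rho> = incidence \<rho> \<sigma>"
        by (rule one)
    qed
  qed
  also have "\<dots> = (\<Sum>\<sigma>\<in>K. Poly_Mapping.lookup c \<sigma> * incidence \<rho> \<sigma>)"
    using K by (intro sum.mono_neutral_left) (auto simp: in_keys_iff)
  finally show ?thesis .
qed

definition chain_of :: "('a set \<Rightarrow> int) \<Rightarrow> 'a set set \<Rightarrow> ('a set \<Rightarrow>\<^sub>0 int)" where
  "chain_of g D = (\<Sum>\<tau>\<in>D. frag_cmul (g \<tau>) (frag_of \<tau>))"

lemma lookup_chain_of: "finite D \<Longrightarrow> Poly_Mapping.lookup (chain_of g D) \<tau> =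
    (if \<tau> \<in> D then g \<tau> else 0)"
  unfolding chain_of_def lookup_sum
  by (simp add: lookup_frag_of if_distrib[where f="\<lambda>x. _ * x"] cong: if_cong)

lemma keys_chain_of: "finite D \<Longrightarrow> Poly_Mapping.keys (chain_of g D) \<subseteq> D"
proof (rule subsetI, rule ccontr)
  fix x assume "finite D" and x: "x \<in> Poly_Mapping.keys (chain_of g D)" "x \<notin> D"
  then have "Poly_Mapping.lookup (chain_of g D) x = 0" using lookup_chain_of[of D g x]
      by (simp only: if_False)
  then show False using x(1) by (simp only: in_keys_iff simp_thms)
qed

lemma carrier_homology_group:
  fixes K :: "'a::linorder set set"
  assumes sub: "subgroup (simplicial_cycles K i) (simplicial_chain_group K i)"
  shows "carrier (simplicial_homology_group i K) =
    (\<lambda>z. (\<lambda>b. b + z) ` simplicial_boundaries K i) ` simplicial_cycles K i"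
proof -
  have c: "carrier (subgroup_generated (simplicial_chain_group K i) (simplicial_cycles K i)) =
      simplicial_cycles K i"
    by (rule subgroup.carrier_subgroup_generated_subgroup[OF sub])
  show ?thesis
    unfolding simplicial_homology_group_def FactGroup_def RCOSETS_def r_coset_def
    by (simp add: c) (auto simp: simplicial_chain_group_def free_Abelian_group_def)
qed

text \<open>Restriction to the ridges avoiding \<open>v\<close> identifies the group of (d-1)-cycles
  of the complete skeleton with the integer vectors on \<open>R\<close>, and carries boundaries to
  the column lattice of the minor. Homology is thus the cokernel of a square integer matrix: of
  order |det| if this is nonzero, and infinite otherwise.\<close>

lemma homology_order_eq_det:
  fixes T :: "'a::linorder set set"
  assumes V: "finite V" and v: "v \<in> V" and d: "d \<ge> 1"
    and F: "faces T (int d - 1) = ksets V d" and D: "faces T (int d) = D" "D \<subseteq> ksets V (Suc d)"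
    and cD: "card D = card (ksets (V - {v}) d)"
  defines "H \<equiv> simplicial_homology_group (int d - 1) T"
  defines "R \<equiv> ksets (V - {v}) d"
  shows "finite (carrier H) \<longleftrightarrow> set_det R D incidence \<noteq> 0"
    and "set_det R D incidence \<noteq> 0 \<Longrightarrow> order H = nat \<bar>set_det R D incidence\<bar>"
proof -
  let ?lk = "Poly_Mapping.lookup :: ('a set \<Rightarrow>\<^sub>0 int) \<Rightarrow> 'a set \<Rightarrow> int"
  obtain p where p: "d = Suc p" using d by (cases d) auto
  have fR: "finite R" unfolding R_def using V by simp
  have fE: "finite (ksets V (Suc d))" using V by simp
  have fD: "finite D" using D(2) fE finite_subset by blast
  have RV: "R \<subseteq> ksets V d" unfolding R_def ksets_def by auto
  define Z where "Z = simplicial_cycles T (int d - 1)"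
  define B where "B = simplicial_boundaries T (int d - 1)"
  let ?G = "simplicial_chain_group T (int d - 1)"
  have G: "?G = free_Abelian_group (ksets V d)" unfolding simplicial_chain_group_def F ..
  have bd: "?lk (simplicial_boundary c) \<rho> = (\<Sum>\<sigma>\<in>ksets V q. ?lk c \<sigma> * incidence \<rho> \<sigma>)"
    if "Poly_Mapping.keys c \<subseteq> ksets V q" for c \<rho> q
    using lookup_simplicial_boundary[OF _ that] V ksets_finite[OF V] by blast
  have Z: "z \<in> Z \<longleftrightarrow> Poly_Mapping.keys z \<subseteq> ksets V d \<and> (\<forall>\<rho>. (\<Sum>\<sigma>\<in>ksets V d. ?lk z \<sigma> * incidence \<rho> \<sigma>) =
      0)" for z
    unfolding Z_def simplicial_cycles_def G using bd[of z d]
    by (auto simp: carrier_free_Abelian_group_iff intro!: poly_mapping_eqI)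
  have Beq: "B = simplicial_boundary ` {c. Poly_Mapping.keys c \<subseteq> D}"
    unfolding B_def simplicial_boundaries_def simplicial_chain_group_def using D(1)
    by (auto simp: carrier_free_Abelian_group_iff)
  have bdZ: "simplicial_boundary c \<in> Z" if c: "Poly_Mapping.keys c \<subseteq> ksets V (Suc d)" for c
    unfolding Z
  proof (intro conjI allI subsetI)
    fix \<sigma> assume "\<sigma> \<in> Poly_Mapping.keys (simplicial_boundary c)"
    then have "(\<Sum>\<tau>\<in>ksets V (Suc d). ?lk c \<tau> * incidence \<sigma> \<tau>) \<noteq> 0" 
      unfolding bd[OF c, symmetric] by (simp only: in_keys_iff simp_thms)
    then obtain \<tau> where t: "\<tau> \<in> ksets V (Suc d)" "incidence \<sigma> \<tau> \<noteq> 0"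
      by (metis (no_types, lifting) mult_zero_right sum.neutral)
    then show "\<sigma> \<in> ksets V d" using incidence_nonzeroD[OF t(2)] remove_ksets[OF V t(1)] by auto
  next
    fix \<rho>
    have "(\<Sum>\<sigma>\<in>ksets V d. ?lk (simplicial_boundary c) \<sigma> * incidence \<rho> \<sigma>) =
       (\<Sum>\<sigma>\<in>ksets V d. \<Sum>\<tau>\<in>ksets V (Suc d). ?lk c \<tau> * (incidence \<sigma> \<tau> * incidence \<rho> \<sigma>))"
      unfolding bd[OF c] by (simp add: sum_distrib_right mult.assoc)
    also have "\<dots> = (\<Sum>\<tau>\<in>ksets V (Suc d). ?lk c \<tau> * (\<Sum>\<sigma>\<in>ksets V d. incidence \<sigma> \<tau> * incidence \<rho> \<sigma>))"
      unfolding sum_distrib_left by (rule sum.swap)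
    also have "\<dots> = 0" unfolding p using incidence_incidence[OF V] by simp
    finally show "(\<Sum>\<sigma>\<in>ksets V d. ?lk (simplicial_boundary c) \<sigma> * incidence \<rho> \<sigma>) = 0" .
  qed
  have BZ: "B \<subseteq> Z" unfolding Beq using bdZ D(2) by auto
  have Zadd: "z + z' \<in> Z" and Zminus: "- z \<in> Z" if "z \<in> Z" "z' \<in> Z" for z z'
    using that keys_add[of z z'] unfolding Z
    by (auto simp: lookup_add sum.distrib distrib_right sum_negf)
  have Z0: "0 \<in> Z" unfolding Z by simp
  have Zdiff: "z - z' \<in> Z" if "z \<in> Z" "z' \<in> Z" for z z'
    using Zadd[OF that(1) Zminus[OF that(2,2)]] by simp
  have sub: "subgroup Z ?G"
  proof (rule subgroup.intro)
    show "Z \<subseteq> carrier ?G" unfolding G using Z by (auto simp: carrier_free_Abelian_group_iff)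
    fix x assume x: "x \<in> Z"
    then have "Poly_Mapping.keys x \<subseteq> ksets V d" using Z by auto
    then show "inv\<^bsub>?G\<^esub> x \<in> Z" unfolding G using inv_free_Abelian_group Zminus x by metis
  qed (use Zadd Z0 in \<open>auto simp: G\<close>)
  have cH: "carrier H = (\<lambda>z. (\<lambda>b. b + z) ` B) ` Z"
    unfolding H_def B_def Z_def by (rule carrier_homology_group) (use sub Z_def in simp)
  \<comment> \<open>If a ridge contains \<open>v\<close>, every other ridge above its facet opposite
    to \<open>v\<close> avoids \<open>v\<close>. When the cycle vanishes on those, the vanishing of
    its boundary at that facet removes the coefficient of the ridge itself.\<close>
  have inj0: "z = 0" if z: "z \<in> Z" and 0: "\<And>\<sigma>. \<sigma> \<in> R \<Longrightarrow> ?lk z \<sigma> = 0" for z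
  proof (rule poly_mapping_eqI)
    fix \<sigma>
    show "?lk z \<sigma> = ?lk 0 \<sigma>"
    proof (rule ccontr)
      assume n: "?lk z \<sigma> \<noteq> ?lk 0 \<sigma>"
      then have "\<sigma> \<in> Poly_Mapping.keys z" by (simp only: in_keys_iff lookup_zero simp_thms)
      then have s: "\<sigma> \<in> ksets V d" using z unfolding Z by blast
      have vs: "v \<in> \<sigma>" using 0[of \<sigma>] n s by (auto simp: R_def ksets_def)
      have fs: "finite \<sigma>" using ksets_finite[OF V s] .
      let ?r = "\<sigma> - {v}"
      have "(\<Sum>\<kappa>\<in>ksets V d. ?lk z \<kappa> * incidence ?r \<kappa>) = (\<Sum>\<kappa>\<in>ksets V d.
          if \<kappa> = \<sigma> then ?lk z \<sigma> * incidence ?r \<sigma> else 0)"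
      proof (intro sum.cong refl)
        fix \<kappa> assume k: "\<kappa> \<in> ksets V d"
        show "?lk z \<kappa> * incidence ?r \<kappa> = (if \<kappa> = \<sigma> then ?lk z \<sigma> * incidence ?r \<sigma> else 0)"
        proof (cases "\<kappa> = \<sigma> \<or> incidence ?r \<kappa> = 0")
          case False
          then obtain x where x: "x \<in> \<kappa>" "?r = \<kappa> - {x}" using incidence_nonzeroD by blast
          have "v \<notin> \<kappa>"
          proof
            assume vk: "v \<in> \<kappa>"
            then have "x = v" using x by blast
            then have "\<kappa> = \<sigma>" using x vk vs by blast
            then show False using False by blast
          qed
          then have "\<kappa> \<in> R" using k by (auto simp: R_def ksets_def)
          then show ?thesis using 0 False by simp
        qed auto
      qed
      also have "\<dots> = ?lk z \<sigma> * incidence ?r \<sigma>" using V s by simp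
      finally have "?lk z \<sigma> * incidence ?r \<sigma> = 0" using z unfolding Z by auto
      then show False using n incidence_remove[OF fs vs] by simp
    qed
  qed
  \<comment> \<open>A prescribed restriction is realised by the boundary of a cone: the chain of the
    faces \<open>insert v \<sigma>\<close>, with coefficients corrected by the sign of
    \<open>v\<close>.\<close>
  have lift: "\<exists>z\<in>Z. \<forall>\<sigma>\<in>R. ?lk z \<sigma> = u \<sigma>" for u
  proof -
    define g where "g \<tau> = (if v \<in> \<tau> then u (\<tau> - {v}) * below_sign v \<tau> else 0)" for \<tau>
    let ?c = "chain_of g (ksets V (Suc d))"
    have kc: "Poly_Mapping.keys ?c \<subseteq> ksets V (Suc d)" by (rule keys_chain_of[OF fE])
    have "?lk (simplicial_boundary ?c) \<sigma> = u \<sigma>" if s: "\<sigma> \<in> R" for \<sigma>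
    proof -
      have sV: "\<sigma> \<in> ksets V d" and vs: "v \<notin> \<sigma>" using s by (auto simp: R_def ksets_def)
      have fs: "finite \<sigma>" using ksets_finite[OF V sV] .
      have "?lk (simplicial_boundary ?c) \<sigma> = (\<Sum>\<tau>\<in>ksets V (Suc d). incidence \<sigma> \<tau> * g \<tau>)"
        unfolding bd[OF kc] by (intro sum.cong refl) (auto simp: lookup_chain_of[OF fE])
      also have "\<dots> = (\<Sum>x\<in>V - \<sigma>. below_sign x \<sigma> * g (insert x \<sigma>))"
          by (rule sum_incidence_up[OF V sV])
      also have "\<dots> = (\<Sum>x\<in>V - \<sigma>. if x = v then u \<sigma> else 0)"
      proof (intro sum.cong refl)
        fix x assume "x \<in> V - \<sigma>"
        have "below_sign v (insert v \<sigma>) = below_sign v \<sigma>" using below_sign_insert[OF fs vs, of v]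
            by simp
        then have "below_sign v \<sigma> * g (insert v \<sigma>) = u \<sigma> * (below_sign v \<sigma> * below_sign v \<sigma>)"
          unfolding g_def using vs by simp
        then show "below_sign x \<sigma> * g (insert x \<sigma>) = (if x = v then u \<sigma> else 0)"
          using vs by (auto simp: g_def)
      qed
      finally show ?thesis using V v vs by simp
    qed
    then show ?thesis using bdZ[OF kc] by blast
  qed
  \<comment> \<open>The column lattice of the minor, in coordinates \<open>R\<close>.\<close>
  define S where "S u \<longleftrightarrow> (\<exists>c. \<forall>\<sigma>\<in>R. u \<sigma> = (\<Sum>\<tau>\<in>D. incidence \<sigma> \<tau> * c \<tau>))" for u :: "'a set \<Rightarrow> int"
  have bdD: "?lk (simplicial_boundary c) \<sigma> = (\<Sum>\<tau>\<in>D. incidence \<sigma> \<tau> * ?lk c \<tau>)"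
      if "Poly_Mapping.keys c \<subseteq> D" for c \<sigma>
    using lookup_simplicial_boundary[OF fD that] D(2) ksets_finite[OF V]
        by (auto simp: mult.commute)
  have inB: "z \<in> B \<longleftrightarrow> S (?lk z)" if z: "z \<in> Z" for z
  proof
    assume "z \<in> B"
    then obtain c where c: "Poly_Mapping.keys c \<subseteq> D" "z = simplicial_boundary c" unfolding Beq
        by auto
    show "S (?lk z)" unfolding S_def c(2) by (intro exI[of _ "?lk c"]) (simp add: bdD[OF c(1)])
  next
    assume "S (?lk z)"
    then obtain c where c: "\<And>\<sigma>. \<sigma> \<in> R \<Longrightarrow> ?lk z \<sigma> = (\<Sum>\<tau>\<in>D. incidence \<sigma> \<tau> * c \<tau>)" unfolding S_def
        by auto
    let ?b = "simplicial_boundary (chain_of c D)"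
    have b: "?b \<in> B" unfolding Beq using keys_chain_of[OF fD] by auto
    have "z - ?b = 0"
    proof (rule inj0)
      show "z - ?b \<in> Z" using Zdiff z b BZ by auto
      fix \<sigma> assume s: "\<sigma> \<in> R"
      have "?lk ?b \<sigma> = (\<Sum>\<tau>\<in>D. incidence \<sigma> \<tau> * c \<tau>)"
        unfolding bdD[OF keys_chain_of[OF fD]]
            by (intro sum.cong refl) (simp add: lookup_chain_of[OF fD])
      then show "?lk (z - ?b) \<sigma> = 0" using c[OF s] by (simp add: lookup_minus)
    qed
    then show "z \<in> B" using b by simp
  qed
  have Scong: "S u \<longleftrightarrow> S u'" if "\<And>\<sigma>. \<sigma> \<in> R \<Longrightarrow> u \<sigma> = u' \<sigma>" for u u'
    unfolding S_def using that by (intro iff_exI ball_cong) auto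
  have S0: "S (\<lambda>_. 0)" unfolding S_def by (intro exI[of _ "\<lambda>_. 0"]) simp
  have Sadd: "S (\<lambda>\<sigma>. u \<sigma> + u' \<sigma>)" if s: "S u" "S u'" for u u'
  proof -
    obtain c where c: "\<And>\<sigma>. \<sigma> \<in> R \<Longrightarrow> u \<sigma> = (\<Sum>\<tau>\<in>D. incidence \<sigma> \<tau> * c \<tau>)" using s(1) unfolding S_def
        by auto
    obtain c' where c': "\<And>\<sigma>. \<sigma> \<in> R \<Longrightarrow> u' \<sigma> = (\<Sum>\<tau>\<in>D. incidence \<sigma> \<tau> * c' \<tau>)" using s(2) unfolding S_def
        by auto
    show ?thesis unfolding S_def by (intro exI[of _ "\<lambda>\<tau>. c \<tau> +
        c' \<tau>"]) (simp add: c c' distrib_left sum.distrib)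
  qed
  have Sneg: "S (\<lambda>\<sigma>. - u \<sigma>)" if s: "S u" for u
  proof -
    obtain c where c: "\<And>\<sigma>. \<sigma> \<in> R \<Longrightarrow> u \<sigma> = (\<Sum>\<tau>\<in>D. incidence \<sigma> \<tau> * c \<tau>)" using s(1) unfolding S_def
        by auto
    show ?thesis unfolding S_def by (intro exI[of _ "\<lambda>\<tau>. - c \<tau>"]) (simp add: c sum_negf)
  qed
  have coset: "(\<lambda>b. b + z) ` B = (\<lambda>b. b + z') ` B \<longleftrightarrow> S (\<lambda>\<sigma>. ?lk z \<sigma> - ?lk z' \<sigma>)"
      if z: "z \<in> Z" "z' \<in> Z" for z z'
  proof -
    have d: "S (\<lambda>\<sigma>. ?lk z \<sigma> - ?lk z' \<sigma>) \<longleftrightarrow> z - z' \<in> B" using inB[OF Zdiff[OF z]]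
        by (simp add: lookup_minus[abs_def])
    have B0: "0 \<in> B" using inB[OF Z0] S0 Scong[of "?lk 0" "\<lambda>_. 0"] by simp
    have Badd: "a + b \<in> B" if "a \<in> B" "b \<in> B" for a b
      using inB[OF Zadd, of a b] that BZ Sadd[of "?lk a" "?lk b"] inB[of a] inB[of b]
          by (auto simp: lookup_add[abs_def])
    have Bneg: "- a \<in> B" if "a \<in> B" for a
      using inB[OF Zminus, of a a] that BZ Sneg[of "?lk a"] inB[of a]
          by (auto simp: lookup_uminus[abs_def])
    show ?thesis unfolding d
    proof
      assume e: "(\<lambda>b. b + z) ` B = (\<lambda>b. b + z') ` B"
      have "z \<in> (\<lambda>b. b + z) ` B" using B0 by (auto intro: image_eqI[of _ _ 0])
      then obtain b where "b \<in> B" "z = b + z'" unfolding e by auto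
      then show "z - z' \<in> B" by simp
    next
      assume b: "z - z' \<in> B"
      show "(\<lambda>b. b + z) ` B = (\<lambda>b. b + z') ` B"
      proof safe
        fix a assume "a \<in> B"
        then have "a + (z - z') \<in> B" using Badd b by blast
        then show "a + z \<in> (\<lambda>b. b + z') ` B" by (auto intro!: image_eqI[of _ _ "a + (z - z')"])
      next
        fix a assume "a \<in> B"
        then have "a + - (z - z') \<in> B" using Badd Bneg b by blast
        then show "a + z' \<in> (\<lambda>b. b + z) ` B" by (auto intro!: image_eqI[of _ _ "a + - (z - z')"])
      qed
    qed
  qed
  obtain L where L: "\<And>u. L u \<in> Z" "\<And>u \<sigma>. \<sigma> \<in> R \<Longrightarrow> ?lk (L u) \<sigma> = u \<sigma>" using lift by metis
  {
    assume dn: "set_det R D incidence \<noteq> 0"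
    obtain P where P0: "finite P \<and> card P = nat \<bar>set_det R D incidence\<bar> \<and>
      (\<forall>u. \<exists>!p. p \<in> P \<and> (\<exists>c. \<forall>r\<in>R. u r - p r = (\<Sum>t\<in>D. incidence r t * c t)))"
      using set_det_lattice_transversal[OF fR fD _ dn] cD unfolding R_def by auto
    have P: "finite P" "card P = nat \<bar>set_det R D incidence\<bar>" "\<And>u. \<exists>!p. p \<in> P \<and> S (\<lambda>r. u r - p r)"
      using P0 unfolding S_def by (simp_all only:)
    have "bij_betw (\<lambda>p. (\<lambda>b. b + L p) ` B) P (carrier H)"
    proof (rule bij_betw_imageI)
      show "inj_on (\<lambda>p. (\<lambda>b. b + L p) ` B) P"
      proof (rule inj_onI)
        fix a b assume ab: "a \<in> P" "b \<in> P" "(\<lambda>x. x + L a) ` B = (\<lambda>x. x + L b) ` B"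
        then have "S (\<lambda>\<sigma>. a \<sigma> - b \<sigma>)" using coset[OF L(1) L(1), of a b] Scong[of "\<lambda>\<sigma>. ?lk (L a) \<sigma> -
            ?lk (L b) \<sigma>" "\<lambda>\<sigma>. a \<sigma> - b \<sigma>"] L(2) by simp
        moreover have "S (\<lambda>\<sigma>. a \<sigma> - a \<sigma>)" using S0 by simp
        ultimately show "a = b" using P(3)[of a] ab by blast
      qed
      show "(\<lambda>p. (\<lambda>b. b + L p) ` B) ` P = carrier H" unfolding cH
      proof safe
        fix z assume z: "z \<in> Z"
        obtain a where a: "a \<in> P" "S (\<lambda>r. ?lk z r - a r)" using P(3)[of "?lk z"] by blast
        have "S (\<lambda>\<sigma>. ?lk z \<sigma> - ?lk (L a) \<sigma>)" using a(2) Scong[of "\<lambda>\<sigma>. ?lk z \<sigma> - ?lk (L a) \<sigma>" "\<lambda>r.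
            ?lk z r - a r"] L(2) by simp
        then have "(\<lambda>b. b + z) ` B = (\<lambda>b. b + L a) ` B" using coset[OF z L(1)] by blast
        then show "(\<lambda>b. b + z) ` B \<in> (\<lambda>p. (\<lambda>b. b + L p) ` B) ` P" using a(1) by blast
      qed (use L(1) in blast)
    qed
    then have "card (carrier H) = card P" "finite (carrier H)"
        using P(1) bij_betw_same_card bij_betw_finite by metis+
    then have fin: "finite (carrier H)" and ord: "order H = nat \<bar>set_det R D incidence\<bar>"
        using P unfolding order_def by auto
  }
  note nz = this
  show "set_det R D incidence \<noteq> 0 \<Longrightarrow> order H = nat \<bar>set_det R D incidence\<bar>" by (rule nz(2))
  \<comment> \<open>A nonzero integer vector \<open>y\<close> in the left kernel annihilates all
    boundaries, and it separates the multiples of the unit vector at a ridge where \<open>y\<close>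
    is nonzero; these lie in pairwise different classes.\<close>
  have "infinite (carrier H)" if det0: "set_det R D incidence = 0"
  proof -
    obtain y r where y: "r \<in> R" "y r \<noteq> 0" "\<And>t. t \<in> D \<Longrightarrow> (\<Sum>r\<in>R. y r * incidence r t) = 0"
      using det0 set_det_zero_left_kernel[OF fR fD, of incidence] cD unfolding R_def by auto
    define u where "u k = (\<lambda>\<sigma>. if \<sigma> = r then k else 0)" for k :: int
    have "inj (\<lambda>k. (\<lambda>b. b + L (u k)) ` B)"
    proof (rule injI)
      fix k l assume "(\<lambda>b. b + L (u k)) ` B = (\<lambda>b. b + L (u l)) ` B"
      then have "S (\<lambda>\<sigma>. u k \<sigma> - u l \<sigma>)"
        using coset[OF L(1) L(1), of "u k" "u l"] Scong[of "\<lambda>\<sigma>. ?lk (L (u k)) \<sigma> - ?lk (L (u l)) \<sigma>"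
            "\<lambda>\<sigma>. u k \<sigma> - u l \<sigma>"] L(2) by simp
      then obtain c where c: "\<And>\<sigma>. \<sigma> \<in> R \<Longrightarrow> u k \<sigma> - u l \<sigma> = (\<Sum>\<tau>\<in>D. incidence \<sigma> \<tau> * c \<tau>)"
          unfolding S_def by auto
      have "(\<Sum>\<sigma>\<in>R. y \<sigma> * (u k \<sigma> - u l \<sigma>)) = (\<Sum>\<sigma>\<in>R. \<Sum>\<tau>\<in>D. (y \<sigma> * incidence \<sigma> \<tau>) * c \<tau>)"
        using c by (intro sum.cong refl) (simp add: sum_distrib_left mult.assoc)
      also have "\<dots> = (\<Sum>\<tau>\<in>D. (\<Sum>\<sigma>\<in>R. y \<sigma> * incidence \<sigma> \<tau>) * c \<tau>)"
        unfolding sum_distrib_right by (rule sum.swap)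
      also have "\<dots> = 0" using y(3) by simp
      finally have "(\<Sum>\<sigma>\<in>R. y \<sigma> * (u k \<sigma> - u l \<sigma>)) = 0" .
      moreover have "(\<Sum>\<sigma>\<in>R. y \<sigma> * (u k \<sigma> - u l \<sigma>)) = (\<Sum>\<sigma>\<in>R. if \<sigma> = r then y r * (k - l) else 0)"
        by (intro sum.cong refl) (auto simp: u_def)
      ultimately have "y r * (k - l) = 0" using fR y(1) by simp
      then show "k = l" using y(2) by simp
    qed
    then have "infinite (range (\<lambda>k. (\<lambda>b. b + L (u k)) ` B))" using finite_imageD infinite_UNIV_int
        by blast
    moreover have "range (\<lambda>k. (\<lambda>b. b + L (u k)) ` B) \<subseteq> carrier H" unfolding cH using L(1) by auto
    ultimately show ?thesis using finite_subset by blast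
  qed
  then show "finite (carrier H) \<longleftrightarrow> set_det R D incidence \<noteq> 0" using nz(1) by blast
qed


lemma faces_skeleton_union:
  fixes n d :: nat
  assumes D: "D \<subseteq> ksets {1..n} (Suc d)"
  defines "T \<equiv> complete_skeleton {1..n} (int d - 1) \<union> D"
  shows "faces T (int d) = D" "faces T (int d - 1) = ksets {1..n} d" "simplicial_complex {1..n} T"
    and "D \<noteq> {} \<Longrightarrow> has_dimension T d"
proof -
  have fin: "finite \<sigma>" if "\<sigma> \<subseteq> {1..n}" for \<sigma> :: "nat set" using that finite_subset by blast
  have mem: "\<sigma> \<in> T \<longleftrightarrow> (\<sigma> \<subseteq> {1..n} \<and> card \<sigma> \<le> d) \<or> \<sigma> \<in> D" for \<sigma>
    unfolding T_def complete_skeleton_def using fin by auto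
  have Dm: "\<sigma> \<subseteq> {1..n} \<and> card \<sigma> = Suc d \<and> finite \<sigma>" if "\<sigma> \<in> D" for \<sigma>
    using that D fin by (auto simp: ksets_def)
  have fm: "\<sigma> \<in> faces T i \<longleftrightarrow> \<sigma> \<in> T \<and> int (card \<sigma>) = i + 1" for \<sigma> i
    unfolding faces_def using fin[of \<sigma>] Dm[of \<sigma>] mem[of \<sigma>] by blast
  show f: "faces T (int d) = D"
  proof (rule Set.set_eqI)
    fix \<sigma> show "\<sigma> \<in> faces T (int d) \<longleftrightarrow> \<sigma> \<in> D"
      unfolding fm mem using Dm[of \<sigma>] by (cases "\<sigma> \<in> D") simp_all
  qed
  show "faces T (int d - 1) = ksets {1..n} d"
  proof (rule Set.set_eqI)
    fix \<sigma> show "\<sigma> \<in> faces T (int d - 1) \<longleftrightarrow> \<sigma> \<in> ksets {1..n} d"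
      unfolding fm mem ksets_def using Dm[of \<sigma>] by (cases "\<sigma> \<in> D") auto
  qed
  show "simplicial_complex {1..n} T"
    unfolding simplicial_complex_def
  proof (intro conjI ballI)
    show "{} \<in> T" unfolding mem by simp
    fix \<sigma> assume s: "\<sigma> \<in> T"
    then show sn: "\<sigma> \<subseteq> {1..n}" using Dm[of \<sigma>] mem[of \<sigma>] by blast
    then show fs: "finite \<sigma>" by (rule fin)
    show "Pow \<sigma> \<subseteq> T"
    proof
      fix \<rho> assume "\<rho> \<in> Pow \<sigma>"
      then have r: "\<rho> \<subseteq> \<sigma>" by simp
      show "\<rho> \<in> T"
      proof (cases "\<rho> = \<sigma>")
        case False
        then have "card \<rho> < card \<sigma>" using r fs by (simp add: psubset_card_mono psubsetI)
        moreover have "card \<sigma> \<le> Suc d" using s Dm[of \<sigma>] mem[of \<sigma>] by linarith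
        ultimately have "card \<rho> \<le> d" by linarith
        then show ?thesis using mem[of \<rho>] r sn by blast
      qed (use s in simp)
    qed
  qed
  show "has_dimension T d" if "D \<noteq> {}"
    unfolding has_dimension_def f
  proof (intro conjI allI impI)
    fix i assume i: "i > int d"
    have "\<sigma> \<notin> faces T i" for \<sigma>
      unfolding fm mem using Dm[of \<sigma>] i by (cases "\<sigma> \<in> D") auto
    then show "faces T i = {}" by blast
  qed (rule that)
qed

lemma hypertree_decompose:
  assumes "hypertree n d T"
  shows "T = complete_skeleton {1..n} (int d - 1) \<union> faces T (int d)" "faces T (int d) \<subseteq> ksets {1..n}
      (Suc d)"
proof -
  have h: "simplicial_complex {1..n} T" "has_dimension T d" "complete_skeleton {1..n} (int d - 1) \<subseteq>
      T"
    using assms by (auto simp: hypertree_def)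
  have "\<sigma> \<in> complete_skeleton {1..n} (int d - 1) \<union> faces T (int d)" if s: "\<sigma> \<in> T" for \<sigma>
  proof -
    have f: "finite \<sigma>" "\<sigma> \<subseteq> {1..n}" using h(1) s by (auto simp: simplicial_complex_def)
    have "\<sigma> \<in> faces T (int (card \<sigma>) - 1)" using s f by (simp add: faces_def)
    then have "int (card \<sigma>) - 1 \<le> int d" using h(2) by (force simp: has_dimension_def)
    then show ?thesis using s f by (auto simp: faces_def complete_skeleton_def)
  qed
  then show "T = complete_skeleton {1..n} (int d - 1) \<union> faces T (int d)" using h(3)
      by (auto simp: faces_def)
  show "faces T (int d) \<subseteq> ksets {1..n} (Suc d)"
    using h(1) by (auto simp: faces_def ksets_def simplicial_complex_def)
qed

text \<open>Hypertrees correspond to the nonsingular square column selections of the reduced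
  boundary matrix. The deleted vertex is kept arbitrary, so that it can later be chosen outside a
  given ridge.\<close>

lemma hypertree_skeleton_union_iff:
  assumes d: "d \<ge> 1" and n: "n \<ge> d + 1" and v: "v \<in> {1..n}" and D: "D \<subseteq> ksets {1..n} (Suc d)"
  defines "R \<equiv> ksets ({1..n} - {v}) d" and "T \<equiv> complete_skeleton {1..n} (int d - 1) \<union> D"
  shows "hypertree n d T \<longleftrightarrow> card D = card R \<and> set_det R D incidence \<noteq> 0"
    and "hypertree n d T \<Longrightarrow> order (simplicial_homology_group (int d - 1) T) =
        nat \<bar>set_det R D incidence\<bar>"
proof -
  note F = faces_skeleton_union[OF D, folded T_def]
  have cR: "card R = (n - 1) choose d" unfolding R_def using v by (subst card_ksets) auto
  note H = homology_order_eq_det[OF _ v d F(2,1) D]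
  have "(n - 1) choose d > 0" using n by simp
  then have nonempty: "card D = card R \<Longrightarrow> D \<noteq> {}" using cR by auto
  show iff: "hypertree n d T \<longleftrightarrow> card D = card R \<and> set_det R D incidence \<noteq> 0"
  proof
    assume h: "hypertree n d T"
    then have c: "card D = card R" using cR F(1) by (simp add: hypertree_def)
    then show "card D = card R \<and> set_det R D incidence \<noteq> 0"
      using h H(1) unfolding R_def hypertree_def by auto
  next
    assume h: "card D = card R \<and> set_det R D incidence \<noteq> 0"
    then have "finite (carrier (simplicial_homology_group (int d - 1) T))"
        using H(1) unfolding R_def by auto
    then show "hypertree n d T" unfolding hypertree_def using F nonempty h cR T_def by auto
  qed
  assume "hypertree n d T"
  then show "order (simplicial_homology_group (int d - 1) T) = nat \<bar>set_det R D incidence\<bar>"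
    using iff H(2) unfolding R_def by auto
qed

lemma finite_hypertrees: "finite {T. hypertree n d T}"
proof (rule finite_subset)
  show "{T. hypertree n d T} \<subseteq> Pow (Pow {1..n})"
      by (auto simp: hypertree_def simplicial_complex_def)
qed simp

section \<open>Exponential moments of determinantal hypertrees\<close>

definition hypertree_mass :: "nat \<Rightarrow> nat \<Rightarrow> nat set set \<Rightarrow> real" where
  "hypertree_mass n d T = real (order (simplicial_homology_group (int d - 1) T)) ^ 2 / real n ^ ((n
      - 2) choose d)"

lemma sum_hypertree_mass:
  assumes d: "d \<ge> 1" and n: "n \<ge> d + 1"
  shows "(\<Sum>T | hypertree n d T. hypertree_mass n d T) = 1"
    and "z > 0 \<Longrightarrow> S \<subseteq> ksets {1..n} (Suc d) \<Longrightarrow>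
      (\<Sum>T | hypertree n d T. hypertree_mass n d T * z ^ card (faces T (int d) \<inter> S)) \<le>
          exp ((z - 1) * (real d + 1) / real n * real (card S))"
proof -
  let ?V = "{1..n}" and ?E = "ksets {1..n} (Suc d)"
  have v: "1 \<in> ?V" using n by auto
  define R where "R = ksets (?V - {1}) d"
  let ?DD = "{D. D \<subseteq> ?E \<and> card D = card R}"
  let ?T = "\<lambda>D. complete_skeleton {1..n} (int d - 1) \<union> D"
  have fDD: "finite ?DD" by simp
  have c2: "card ?V \<ge> 2" using d n by simp
  \<comment> \<open>Sums over hypertrees become sums over all column sets of the right size, since
    the singular ones have weight zero. This is the form to which Cauchy-Binet applies.\<close>
  have key: "(\<Sum>T | hypertree n d T. hypertree_mass n d T * g (faces T (int d))) =
     (\<Sum>D\<in>?DD. (real_of_int (set_det R D incidence))\<^sup>2 *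
         g D) / real n ^ ((n - 2) choose d)" for g :: "nat set set \<Rightarrow> real"
  proof -
    have "(\<Sum>T | hypertree n d T. hypertree_mass n d T * g (faces T (int d))) =
       (\<Sum>D\<in>{D\<in>?DD. set_det R D incidence \<noteq> 0}. (real_of_int (set_det R D incidence))\<^sup>2 *
           g D / real n ^ ((n - 2) choose d))"
    proof (rule sum.reindex_bij_witness[where j="\<lambda>T. faces T (int d)" and i="?T"])
      fix T assume "T \<in> {T. hypertree n d T}"
      then have h: "hypertree n d T" by simp
      note dc = hypertree_decompose[OF h]
      show "?T (faces T (int d)) = T" using dc by simp
      have h': "hypertree n d (?T (faces T (int d)))" using h dc(1) by simp
      note iff = hypertree_skeleton_union_iff[OF d n v dc(2), folded R_def]
      show "faces T (int d) \<in> {D\<in>?DD. set_det R D incidence \<noteq> 0}" using iff(1) h' dc(2) by auto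
      show "(real_of_int (set_det R (faces T (int d)) incidence))\<^sup>2 *
          g (faces T (int d)) / real n ^ ((n - 2) choose d) =
        hypertree_mass n d T * g (faces T (int d))"
        unfolding hypertree_mass_def using iff(2)[OF h'] dc(1) by simp
    next
      fix D assume "D \<in> {D\<in>?DD. set_det R D incidence \<noteq> 0}"
      then have D: "D \<subseteq> ?E" "card D = card R" "set_det R D incidence \<noteq> 0" by auto
      show "faces (?T D) (int d) = D" by (rule faces_skeleton_union[OF D(1)])
      show "?T D \<in> {T. hypertree n d T}" using hypertree_skeleton_union_iff(1)[OF d n v D(1)] D
          R_def by auto
    qed
    also have "\<dots> = (\<Sum>D\<in>?DD. (real_of_int (set_det R D incidence))\<^sup>2 *
        g D / real n ^ ((n - 2) choose d))"
      by (rule sum.mono_neutral_left) (use fDD in auto)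
    finally show ?thesis by (simp add: sum_divide_distrib)
  qed
  have npos: "real n ^ ((n - 2) choose d) > 0" using n by simp
  have "(\<Sum>D\<in>?DD. (set_det R D incidence)\<^sup>2) = int n ^ ((n - 2) choose d)"
    using sum_squared_minors[OF _ v c2, of d] unfolding R_def by simp
  then have "real_of_int (\<Sum>D\<in>?DD. (set_det R D incidence)\<^sup>2) = real n ^ ((n - 2) choose d)" by simp
  then show "(\<Sum>T | hypertree n d T. hypertree_mass n d T) = 1"
    using key[of "\<lambda>_. 1"] n by simp
  assume z: "z > 0" and S: "S \<subseteq> ?E"
  have "(\<Sum>D\<in>?DD. (real_of_int (set_det R D incidence))\<^sup>2 * z ^ card (D \<inter> S)) \<le>
     exp ((z - 1) * (real d + 1) / real n * real (card S)) * real n ^ ((n - 2) choose d)"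
    using sum_squared_minors_reweight[OF _ v c2 d z S] unfolding R_def by (subst mult.commute) simp
  then show "(\<Sum>T | hypertree n d T. hypertree_mass n d T * z ^ card (faces T (int d) \<inter> S)) \<le>
      exp ((z - 1) * (real d + 1) / real n * real (card S))"
    unfolding key[of "\<lambda>D. z ^ card (D \<inter> S)"] pos_divide_le_eq[OF npos] .
qed

text \<open>With a vertex outside the ridge deleted, an uncovered ridge would give a zero row in the
  minor of the tree. This yields the minimum degree \<open>k\<close> of ridges with certainty, which
  no tail bound with constant \<open>k\<close> could give for all ridges at once.\<close>

lemma hypertree_covers_ridge:
  assumes d: "d \<ge> 1" and n: "n \<ge> d + 1" and h: "hypertree n d T" and s: "\<sigma> \<in> ksets {1..n} d"
  shows "\<exists>\<tau>\<in>faces T (int d). \<sigma> \<subseteq> \<tau>"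
proof (rule ccontr)
  assume no: "\<not> (\<exists>\<tau>\<in>faces T (int d). \<sigma> \<subseteq> \<tau>)"
  have fs: "finite \<sigma>" "card \<sigma> = d" "\<sigma> \<subseteq> {1..n}" using s ksets_finite[OF _ s]
      by (auto simp: ksets_def)
  have "\<exists>v\<in>{1..n}. v \<notin> \<sigma>"
  proof (rule ccontr)
    assume "\<not> (\<exists>v\<in>{1..n}. v \<notin> \<sigma>)"
    then have "card {1..n} \<le> card \<sigma>" using fs by (intro card_mono) auto
    then show False using fs n by simp
  qed
  then obtain v where v: "v \<in> {1..n}" "v \<notin> \<sigma>" by auto
  let ?R = "ksets ({1..n} - {v}) d"
  note dc = hypertree_decompose[OF h]
  note iff = hypertree_skeleton_union_iff[OF d n v(1) dc(2)]
  have c: "card (faces T (int d)) = card ?R" and dn: "set_det ?R (faces T (int d)) incidence \<noteq> 0"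
    using iff(1) h dc(1) by auto
  have sR: "\<sigma> \<in> ?R" using s v by (auto simp: ksets_def)
  have "finite (faces T (int d))" using dc(2) finite_subset[OF dc(2)] by simp
  moreover have "\<exists>y. (\<exists>r\<in>?R. y r \<noteq> 0) \<and> (\<forall>t\<in>faces T (int d). (\<Sum>r\<in>?R. y r * incidence r t) = 0)"
  proof (intro exI[of _ "\<lambda>r. if r = \<sigma> then 1 else 0"] conjI ballI)
    show "\<exists>r\<in>?R. (if r = \<sigma> then 1 else 0) \<noteq> (0::int)" using sR by auto
    fix t assume t: "t \<in> faces T (int d)"
    have "incidence \<sigma> t = 0" using incidence_nonzeroD[of \<sigma> t] no t by auto
    then show "(\<Sum>r\<in>?R. (if r = \<sigma> then 1 else 0) * incidence r t) = 0" by (intro sum.neutral) auto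
  qed
  ultimately show False using set_det_zero_left_kernel[of ?R "faces T (int d)" incidence] c dn
      by auto
qed

section \<open>Independent hypertrees and their face counts\<close>

lemma determinantal_hypertree_eq:
  "determinantal_hypertree n d = point_measure {T. hypertree n d T} (\<lambda>T. ennreal (hypertree_mass n d
      T))"
  unfolding determinantal_hypertree_def hypertree_mass_def ..

lemma hypertree_mass_nonneg: "hypertree_mass n d T \<ge> 0"
  unfolding hypertree_mass_def by simp

lemma prob_space_determinantal_hypertree:
  assumes "d \<ge> 1" "n \<ge> d + 1"
  shows "prob_space (determinantal_hypertree n d)"
proof (rule prob_spaceI)
  have "emeasure (determinantal_hypertree n d) {T. hypertree n d T} =
      (\<Sum>T | hypertree n d T. ennreal (hypertree_mass n d T))"
    unfolding determinantal_hypertree_eq by (rule emeasure_point_measure_finite[OF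
        finite_hypertrees]) simp
  also have "\<dots> = ennreal (\<Sum>T | hypertree n d T. hypertree_mass n d T)"
    by (rule sum_ennreal) (simp add: hypertree_mass_nonneg)
  also have "\<dots> = 1" using sum_hypertree_mass(1)[OF assms] by simp
  finally show "emeasure (determinantal_hypertree n d) (space (determinantal_hypertree n d)) = 1"
    by (simp add: determinantal_hypertree_eq space_point_measure)
qed

text \<open>Multiplicities over the \<open>k\<close> trees are kept: this is a sum of independent
  variables, whereas the number of faces of the union is not. The loss is at most the largest
  multiplicity.\<close>

definition face_count :: "nat \<Rightarrow> nat \<Rightarrow> (nat \<Rightarrow> nat set set) \<Rightarrow> nat set set \<Rightarrow> nat" where
  "face_count d k T S = (\<Sum>j\<in>{1..k}. card (faces (T j) (int d) \<inter> S))"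

lemma space_iid: "space (iid_determinantal_hypertrees n d k) = {1..k} \<rightarrow>\<^sub>E {T. hypertree n d T}"
  unfolding iid_determinantal_hypertrees_def space_PiM determinantal_hypertree_eq
      space_point_measure ..

text \<open>The sample space is finite and its points are boxes, so every event is
  measurable.\<close>

lemma sets_iid:
  assumes "X \<subseteq> space (iid_determinantal_hypertrees n d k)"
  shows "X \<in> sets (iid_determinantal_hypertrees n d k)"
proof -
  have fin: "finite (space (iid_determinantal_hypertrees n d k))"
    unfolding space_iid using finite_hypertrees by (intro finite_PiE) auto
  have "{x} \<in> sets (iid_determinantal_hypertrees n d k)" if "x \<in> X" for x
  proof -
    have x: "x \<in> {1..k} \<rightarrow>\<^sub>E {T. hypertree n d T}" using that assms space_iid by auto
    then have "{x} = (\<Pi>\<^sub>E j\<in>{1..k}. {x j})" by (subst PiE_singleton) (auto simp: PiE_def)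
    moreover have "(\<Pi>\<^sub>E j\<in>{1..k}. {x j}) \<in> sets (iid_determinantal_hypertrees n d k)"
      unfolding iid_determinantal_hypertrees_def
      by (rule sets_PiM_I_finite) (use x in \<open>auto simp: determinantal_hypertree_eq
          sets_point_measure PiE_def Pi_def\<close>)
    ultimately show ?thesis by simp
  qed
  then have "(\<Union>x\<in>X. {x}) \<in> sets (iid_determinantal_hypertrees n d k)"
    using finite_subset[OF assms fin] by (intro sets.finite_UN) auto
  then show ?thesis by simp
qed

lemma prob_space_iid:
  assumes "d \<ge> 1" "n \<ge> d + 1"
  shows "prob_space (iid_determinantal_hypertrees n d k)"
  unfolding iid_determinantal_hypertrees_def
  by (rule prob_space_PiM) (rule prob_space_determinantal_hypertree[OF assms])

text \<open>Markov's inequality for \<open>z ^ face_count\<close>, whose expectation factorises over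
  the trees. The event is left in exponential form so that z > 1 gives upper tails and z < 1 lower
  tails.\<close>

lemma face_count_tail:
  assumes d: "d \<ge> 1" and n: "n \<ge> d + 1" and z: "z > 0" and c: "c > 0" and S: "S \<subseteq> ksets {1..n} (Suc
      d)"
  shows "measure (iid_determinantal_hypertrees n d k)
     {T \<in> space (iid_determinantal_hypertrees n d k). c \<le> z ^ face_count d k T S}
    \<le> exp (real k * ((z - 1) * (real d + 1) / real n * real (card S))) / c"
proof -
  let ?P = "iid_determinantal_hypertrees n d k" and ?M = "determinantal_hypertree n d"
  let ?e = "exp ((z - 1) * (real d + 1) / real n * real (card S))"
  let ?A = "{T \<in> space ?P. c \<le> z ^ face_count d k T S}"
  interpret M: prob_space ?M by (rule prob_space_determinantal_hypertree[OF d n])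
  interpret P: prob_space ?P by (rule prob_space_iid[OF d n])
  interpret product_sigma_finite "\<lambda>_::nat. ?M"
      by (rule product_sigma_finite.intro) (rule M.sigma_finite_measure_axioms)
  define g where "g T = ennreal (z ^ card (faces T (int d) \<inter> S))" for T
  have gm: "g \<in> borel_measurable ?M" unfolding determinantal_hypertree_eq by simp
  have "(\<integral>\<^sup>+T. g T \<partial>?M) = (\<Sum>T | hypertree n d T. ennreal (hypertree_mass n d T) * g T)"
    unfolding determinantal_hypertree_eq by (rule nn_integral_point_measure_finite[OF
        finite_hypertrees])
  also have "\<dots> = (\<Sum>T | hypertree n d T. ennreal (hypertree_mass n d T *
      z ^ card (faces T (int d) \<inter> S)))"
    unfolding g_def using z by (intro sum.cong refl) (simp add: ennreal_mult hypertree_mass_nonneg)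
  also have "\<dots> = ennreal (\<Sum>T | hypertree n d T. hypertree_mass n d T *
      z ^ card (faces T (int d) \<inter> S))"
    using z by (intro sum_ennreal) (simp add: hypertree_mass_nonneg)
  finally have one: "(\<integral>\<^sup>+T. g T \<partial>?M) = ennreal (\<Sum>T | hypertree n d T. hypertree_mass n d T *
      z ^ card (faces T (int d) \<inter> S))" (is "_ = ennreal ?r") .
  have r: "0 \<le> ?r" using z by (auto intro!: sum_nonneg simp: hypertree_mass_nonneg)
  have r': "?r \<le> ?e" by (rule sum_hypertree_mass(2)[OF d n z S])
  have "(\<integral>\<^sup>+T. (\<Prod>j\<in>{1..k}. g (T j)) \<partial>?P) = (\<Prod>j\<in>{1..k}. \<integral>\<^sup>+T. g T \<partial>?M)"
    unfolding iid_determinantal_hypertrees_def by (rule product_nn_integral_prod) (use gm in auto)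
  also have "\<dots> = ennreal (?r ^ k)" unfolding one using r by (simp add: ennreal_power)
  also have "\<dots> \<le> ennreal (?e ^ k)" using r r' by (intro ennreal_leI power_mono)
  finally have int: "(\<integral>\<^sup>+T. (\<Prod>j\<in>{1..k}. g (T j)) \<partial>?P) \<le> ennreal (?e ^ k)" .
  have prod: "(\<Prod>j\<in>{1..k}. g (T j)) = ennreal (z ^ face_count d k T S)" for T
    unfolding g_def face_count_def using z by (simp add: prod_ennreal power_sum)
  have A: "?A \<in> sets ?P" by (rule sets_iid) auto
  have "ennreal c * emeasure ?P ?A = (\<integral>\<^sup>+T. ennreal c * indicator ?A T \<partial>?P)"
    using A by (simp add: nn_integral_cmult_indicator)
  also have "\<dots> \<le> (\<integral>\<^sup>+T. (\<Prod>j\<in>{1..k}. g (T j)) \<partial>?P)"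
    unfolding prod by (intro nn_integral_mono) (auto simp: indicator_def intro!: ennreal_leI)
  also note int
  finally have "ennreal (c * measure ?P ?A) \<le> ennreal (?e ^ k)"
    using c by (simp add: P.emeasure_eq_measure ennreal_mult)
  then have "c * measure ?P ?A \<le> ?e ^ k" by (simp add: ennreal_le_iff)
  moreover have "?e ^ k = exp (real k * ((z - 1) * (real d + 1) / real n * real (card S)))"
    by (rule exp_of_nat_mult[symmetric])
  ultimately show ?thesis using c by (simp add: pos_le_divide_eq mult.commute)
qed


section \<open>Expansion of the complete complex\<close>

text \<open>Cochains over the field with two elements are identified with their supports, with
  symmetric difference as addition. This is the coboundary in the full simplex on \<open>V\<close>;
  the one of the random complex is its intersection with the faces present.\<close>

definition cobd :: "'a set \<Rightarrow> nat \<Rightarrow> 'a set set \<Rightarrow> 'a set set" where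
  "cobd V q G = {\<tau> \<in> ksets V (Suc q). odd (card {\<sigma>\<in>G. \<sigma> \<subseteq> \<tau>})}"

definition star :: "'a set \<Rightarrow> nat \<Rightarrow> 'a set \<Rightarrow> 'a set set" where
  "star V d \<sigma> = {\<tau> \<in> ksets V (Suc d). \<sigma> \<subseteq> \<tau>}"

text \<open>Minimality refers to the number of faces and to coboundaries in the full simplex, not to
  the weights of the random complex. So it does not depend on the sample. \<open>A\<close> lives one
  size above the index \<open>q\<close>.\<close>

definition cobd_minimal :: "'a set \<Rightarrow> nat \<Rightarrow> 'a set set \<Rightarrow> bool" where
  "cobd_minimal V q A \<longleftrightarrow> A \<subseteq> ksets V (Suc q) \<and>
     (\<forall>b \<subseteq> ksets V q. card A \<le> card (sym_diff A (cobd V q b)))"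

lemma cobd_subset_ksets: "cobd V q G \<subseteq> ksets V (Suc q)"
  unfolding cobd_def by auto

lemma ksets_facet:
  assumes V: "finite V" and t: "\<tau> \<in> ksets V (Suc q)" and s: "\<sigma> \<subseteq> \<tau>" "card \<sigma> = q"
  shows "\<exists>x\<in>\<tau>. x \<notin> \<sigma> \<and> \<sigma> = \<tau> - {x}"
proof -
  have ft: "finite \<tau>" using ksets_finite[OF V t] .
  have "card (\<tau> - \<sigma>) = 1" using t s ft by (subst card_Diff_subset) (auto simp: ksets_def
      finite_subset)
  then obtain x where "\<tau> - \<sigma> = {x}" by (auto simp: card_1_singleton_iff)
  then show ?thesis using s by (intro bexI[of _ x]) auto
qed

text \<open>A coboundary that shrinks \<open>A'\<close> would also shrink \<open>A\<close>, because
  passing from one to the other changes the count by at most \<open>card (A - A')\<close>. This lets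
  the pieces of a minimal cochain inherit minimality.\<close>

lemma cobd_minimal_subset:
  assumes V: "finite V" and A: "cobd_minimal V q A" and A': "A' \<subseteq> A"
  shows "cobd_minimal V q A'"
  unfolding cobd_minimal_def
proof (intro conjI allI impI)
  show "A' \<subseteq> ksets V (Suc q)" using A A' unfolding cobd_minimal_def by auto
  fix b assume b: "b \<subseteq> ksets V q"
  let ?C = "cobd V q b"
  have fA: "finite A" using A V finite_subset[OF _ finite_ksets[OF V]] unfolding cobd_minimal_def
      by auto
  have fC: "finite ?C" using finite_subset[OF cobd_subset_ksets finite_ksets[OF V]] .
  have fA': "finite A'" using A' fA finite_subset by auto
  have "card A \<le> card (sym_diff A ?C)" using A b unfolding cobd_minimal_def by auto
  also have "\<dots> \<le> card (sym_diff A' ?C \<union> (A - A'))" using fA fA' fC A' by (intro card_mono) auto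
  also have "\<dots> \<le> card (sym_diff A' ?C) + card (A - A')" by (rule card_Un_le)
  also have "card (A - A') = card A - card A'" using fA' A' by (rule card_Diff_subset)
  finally show "card A' \<le> card (sym_diff A' ?C)" using card_mono[OF fA A'] by linarith
qed

text \<open>Contracting a cochain along a vertex \<open>v\<close> is a homotopy between \<open>A\<close> and the contraction of
  its coboundary; averaging over \<open>v\<close> gives the expansion of the complete complex.\<close>

lemma cone_sym_diff:
  assumes V: "finite V" and v: "v \<in> V" and A: "A \<subseteq> ksets V (Suc q)"
  defines "g \<equiv> {\<omega> \<in> ksets V q. v \<notin> \<omega> \<and> insert v \<omega> \<in> A}"
  shows "sym_diff A (cobd V q g) = {\<sigma> \<in> ksets V (Suc q). v \<notin> \<sigma> \<and> insert v \<sigma> \<in> cobd V (Suc q) A}"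
proof (rule Set.set_eqI)
  fix \<sigma>
  show "\<sigma> \<in> sym_diff A (cobd V q g) \<longleftrightarrow> \<sigma> \<in> {\<sigma> \<in> ksets V (Suc q). v \<notin> \<sigma> \<and>
      insert v \<sigma> \<in> cobd V (Suc q) A}"
  proof (cases "\<sigma> \<in> ksets V (Suc q)")
    case False
    then show ?thesis using A cobd_subset_ksets[of V q g] by blast
  next
    case s: True
    have fs: "finite \<sigma>" using ksets_finite[OF V s] .
    have cs: "card \<sigma> = Suc q" "\<sigma> \<subseteq> V" using s by (auto simp: ksets_def)
    have cob: "\<sigma> \<in> cobd V q g \<longleftrightarrow> odd (card {\<omega>\<in>g. \<omega> \<subseteq> \<sigma>})" using s by (simp add: cobd_def)
    show ?thesis
    proof (cases "v \<in> \<sigma>")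
      case True
      have "{\<omega>\<in>g. \<omega> \<subseteq> \<sigma>} = (if \<sigma> \<in> A then {\<sigma> - {v}} else {})"
      proof -
        have "\<omega> = \<sigma> - {v}" if w: "\<omega> \<in> g" "\<omega> \<subseteq> \<sigma>" for \<omega>
        proof -
          have "card \<omega> = q" "v \<notin> \<omega>" using w by (auto simp: g_def ksets_def)
          then obtain x where "x \<in> \<sigma>" "\<omega> = \<sigma> - {x}" using ksets_facet[OF V s w(2)] by auto
          then show ?thesis using True \<open>v \<notin> \<omega>\<close> by auto
        qed
        moreover have "\<sigma> - {v} \<in> g \<longleftrightarrow> \<sigma> \<in> A"
          using True remove_ksets[OF V s True] by (auto simp: g_def insert_absorb)
        ultimately show ?thesis by auto
      qed
      then have "\<sigma> \<in> cobd V q g \<longleftrightarrow> \<sigma> \<in> A" using cob by auto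
      then show ?thesis using True by auto
    next
      case False
      let ?t = "insert v \<sigma>"
      have t: "?t \<in> ksets V (Suc (Suc q))" using insert_ksets[OF V s] v False by auto
      \<comment> \<open>The facets of the cone over \<open>\<sigma>\<close> are
        \<open>\<sigma>\<close> itself and the cones over facets of \<open>\<sigma>\<close>. Hence
        the parity for \<open>A\<close> at the cone differs from that for \<open>g\<close> at
        \<open>\<sigma>\<close> exactly when \<open>\<sigma>\<close> is in \<open>A\<close>.\<close>
      have "{\<kappa>\<in>A. \<kappa> \<subseteq> ?t} = (insert v) ` {\<omega>\<in>g. \<omega> \<subseteq> \<sigma>} \<union> (if \<sigma> \<in> A then {\<sigma>} else {})"
      proof safe
        fix \<kappa> assume k: "\<kappa> \<in> A" "\<kappa> \<subseteq> ?t" "\<kappa> \<notin> (if \<sigma> \<in> A then {\<sigma>} else {})"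
        have kV: "\<kappa> \<in> ksets V (Suc q)" using k A by auto
        have kc: "card \<kappa> = Suc q" using kV by (auto simp: ksets_def)
        have vk: "v \<in> \<kappa>"
        proof (rule ccontr)
          assume "v \<notin> \<kappa>"
          then have "\<kappa> \<subseteq> \<sigma>" using k by auto
          then have "\<kappa> = \<sigma>" using card_subset_eq[OF fs] kc cs by simp
          then show False using k by auto
        qed
        have "\<kappa> - {v} \<in> g" using remove_ksets[OF V kV vk] k vk by (auto simp: g_def insert_absorb)
        moreover have "\<kappa> - {v} \<subseteq> \<sigma>" using k by auto
        moreover have "\<kappa> = insert v (\<kappa> - {v})" using vk by auto
        ultimately show "\<kappa> \<in> (insert v) ` {\<omega>\<in>g. \<omega> \<subseteq> \<sigma>}" by blast
      qed (auto simp: g_def split: if_splits)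
      moreover have "finite {\<omega>\<in>g. \<omega> \<subseteq> \<sigma>}" using finite_subset[OF _ finite_ksets[OF V, of q]]
          by (auto simp: g_def)
      moreover have "(insert v) ` {\<omega>\<in>g. \<omega> \<subseteq> \<sigma>} \<inter> (if \<sigma> \<in> A then {\<sigma>} else {}) = {}" using False
          by auto
      moreover have "inj_on (insert v) {\<omega>\<in>g. \<omega> \<subseteq> \<sigma>}" by (auto simp: inj_on_def g_def)
      ultimately have "card {\<kappa>\<in>A. \<kappa> \<subseteq> ?t} = card {\<omega>\<in>g. \<omega> \<subseteq> \<sigma>} + (if \<sigma> \<in> A then 1 else 0)"
        by (simp add: card_Un_disjoint card_image)
      then have "?t \<in> cobd V (Suc q) A \<longleftrightarrow> (odd (card {\<omega>\<in>g. \<omega> \<subseteq> \<sigma>}) \<noteq> (\<sigma> \<in> A))"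
        using t by (simp add: cobd_def)
      then show ?thesis using cob s False by auto
    qed
  qed
qed

text \<open>Contraction along a vertex \<open>v\<close> gives at least \<open>card A\<close>
  coboundary faces through \<open>v\<close>. Only vertices outside \<open>\<rho>\<close> are
  averaged over: every coboundary face contains \<open>\<rho>\<close>, so it is counted once for
  each of its remaining vertices. The empty \<open>\<rho>\<close> gives the global bound, a terminal
  fat face the one inside a link.\<close>

lemma minimal_cobd_expansion:
  assumes V: "finite V" and A: "cobd_minimal V q A" and r: "\<And>\<sigma>. \<sigma> \<in> A \<Longrightarrow> \<rho> \<subseteq> \<sigma>" and rV: "\<rho> \<subseteq> V"
  shows "card (V - \<rho>) * card A \<le> (Suc (Suc q) - card \<rho>) * card (cobd V (Suc q) A)"
proof -
  let ?D = "cobd V (Suc q) A"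
  have AK: "A \<subseteq> ksets V (Suc q)" using A by (simp add: cobd_minimal_def)
  have fD: "finite ?D" using finite_subset[OF cobd_subset_ksets finite_ksets[OF V]] .
  have fr: "finite \<rho>" using rV V finite_subset by auto
  have each: "card A \<le> card {\<tau>\<in>?D. v \<in> \<tau>}" if v: "v \<in> V - \<rho>" for v
  proof -
    let ?g = "{\<omega> \<in> ksets V q. v \<notin> \<omega> \<and> insert v \<omega> \<in> A}"
    let ?C = "{\<sigma> \<in> ksets V (Suc q). v \<notin> \<sigma> \<and> insert v \<sigma> \<in> ?D}"
    have "?g \<subseteq> ksets V q" by auto
    then have "card A \<le> card (sym_diff A (cobd V q ?g))" using A unfolding cobd_minimal_def by blast
    also have "sym_diff A (cobd V q ?g) = ?C" using cone_sym_diff[OF V _ AK] v by auto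
    also have "card ?C = card ((insert v) ` ?C)"
        by (rule card_image[symmetric]) (auto simp: inj_on_def)
    also have "\<dots> \<le> card {\<tau>\<in>?D. v \<in> \<tau>}" using fD by (intro card_mono) auto
    finally show ?thesis .
  qed
  have sub: "\<rho> \<subseteq> \<tau>" if "\<tau> \<in> ?D" for \<tau>
  proof -
    have "card {\<sigma>\<in>A. \<sigma> \<subseteq> \<tau>} \<noteq> 0" using that unfolding cobd_def by (auto intro: odd_pos)
    then have "{\<sigma>\<in>A. \<sigma> \<subseteq> \<tau>} \<noteq> {}" by (metis card.empty)
    then show ?thesis using r by blast
  qed
  have "card (V - \<rho>) * card A = (\<Sum>v\<in>V - \<rho>. card A)" by simp
  also have "\<dots> \<le> (\<Sum>v\<in>V - \<rho>. card {\<tau>\<in>?D. v \<in> \<tau>})" by (rule sum_mono) (rule each)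
  also have "\<dots> = (\<Sum>v\<in>V - \<rho>. \<Sum>\<tau>\<in>?D. if v \<in> \<tau> then 1 else 0)"
    using fD by (intro sum.cong refl) (simp add: sum.If_cases Int_def conj_commute)
  also have "\<dots> = (\<Sum>\<tau>\<in>?D. \<Sum>v\<in>V - \<rho>. if v \<in> \<tau> then 1 else 0)" by (rule sum.swap)
  also have "\<dots> = (\<Sum>\<tau>\<in>?D. card (\<tau> - \<rho>))"
  proof (rule sum.cong[OF refl])
    fix \<tau> assume "\<tau> \<in> ?D"
    then have "\<tau> \<subseteq> V" unfolding cobd_def ksets_def by auto
    then have "(V - \<rho>) \<inter> {v. v \<in> \<tau>} = \<tau> - \<rho>" by auto
    then show "(\<Sum>v\<in>V - \<rho>. if v \<in> \<tau> then 1 else 0) = card (\<tau> - \<rho>)" using V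
        by (simp add: sum.If_cases)
  qed
  also have "\<dots> = (\<Sum>\<tau>\<in>?D. Suc (Suc q) - card \<rho>)"
  proof (rule sum.cong[OF refl])
    fix \<tau> assume t: "\<tau> \<in> ?D"
    then have "card \<tau> = Suc (Suc q)" unfolding cobd_def ksets_def by auto
    then show "card (\<tau> - \<rho>) = Suc (Suc q) - card \<rho>" using sub[OF t] fr
        by (simp add: card_Diff_subset)
  qed
  finally show ?thesis by (simp add: mult.commute)
qed

lemma sum_UN_le:
  fixes m :: "'b \<Rightarrow> real"
  assumes I: "finite I" and S: "\<And>i. i \<in> I \<Longrightarrow> finite (S i)" and m: "\<And>x. m x \<ge> 0"
  shows "sum m (\<Union>i\<in>I. S i) \<le> (\<Sum>i\<in>I. sum m (S i))"
  using I S
proof (induction I rule: finite_induct)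
  case (insert i I)
  have fin: "finite (S i)" "finite (\<Union>i\<in>I. S i)" using insert by auto
  have "sum m (\<Union>i\<in>insert i I. S i) = sum m (S i \<union> (\<Union>i\<in>I. S i))" by simp
  also have "\<dots> \<le> sum m (S i) + sum m (\<Union>i\<in>I. S i)"
    using sum_Un[OF fin, of m] sum_nonneg[of "S i \<inter> (\<Union>i\<in>I. S i)" m] m by simp
  also have "\<dots> \<le> sum m (S i) + (\<Sum>i\<in>I. sum m (S i))" using insert by simp
  finally show ?case using insert by simp
qed simp

text \<open>A face above \<open>\<rho>\<close> has only d + 1 facets, hence belongs to the stars of
  at most d + 1 members of \<open>G\<close>.\<close>

lemma sum_star_le:
  fixes m :: "'a set \<Rightarrow> real"
  assumes V: "finite V" and m: "\<And>\<tau>. m \<tau> \<ge> 0" and G: "G \<subseteq> ksets V d" "\<And>\<sigma>. \<sigma> \<in> G \<Longrightarrow> \<rho> \<subseteq> \<sigma>"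
  shows "(\<Sum>\<sigma>\<in>G. sum m (star V d \<sigma>)) \<le> (real d + 1) * sum m (star V d \<rho>)"
proof -
  have fG: "finite G" using G(1) finite_ksets[OF V] finite_subset by blast
  have "(\<Sum>\<sigma>\<in>G. sum m (star V d \<sigma>)) = (\<Sum>\<sigma>\<in>G. \<Sum>\<tau>\<in>star V d \<rho>. if \<sigma> \<subseteq> \<tau> then m \<tau> else 0)"
  proof (rule sum.cong[OF refl])
    fix \<sigma> assume "\<sigma> \<in> G"
    then have "star V d \<rho> \<inter> {\<tau>. \<sigma> \<subseteq> \<tau>} = star V d \<sigma>" using G(2) unfolding star_def by blast
    moreover have "finite (star V d \<rho>)" unfolding star_def using V by simp
    ultimately show "sum m (star V d \<sigma>) = (\<Sum>\<tau>\<in>star V d \<rho>. if \<sigma> \<subseteq> \<tau> then m \<tau> else 0)"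
      by (simp add: sum.If_cases)
  qed
  also have "\<dots> = (\<Sum>\<tau>\<in>star V d \<rho>. \<Sum>\<sigma>\<in>G. if \<sigma> \<subseteq> \<tau> then m \<tau> else 0)" by (rule sum.swap)
  also have "\<dots> \<le> (\<Sum>\<tau>\<in>star V d \<rho>. (real d + 1) * m \<tau>)"
  proof (rule sum_mono)
    fix \<tau> assume "\<tau> \<in> star V d \<rho>"
    then have t: "\<tau> \<in> ksets V (Suc d)" by (simp add: star_def)
    have "G \<inter> {\<sigma>. \<sigma> \<subseteq> \<tau>} \<subseteq> (\<lambda>x. \<tau> - {x}) ` \<tau>"
    proof
      fix \<sigma> assume s: "\<sigma> \<in> G \<inter> {\<sigma>. \<sigma> \<subseteq> \<tau>}"
      then have "card \<sigma> = d" using G(1) by (auto simp: ksets_def)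
      then show "\<sigma> \<in> (\<lambda>x. \<tau> - {x}) ` \<tau>" using ksets_facet[OF V t, of \<sigma>] s by auto
    qed
    then have "card (G \<inter> {\<sigma>. \<sigma> \<subseteq> \<tau>}) \<le> card \<tau>"
      using ksets_finite[OF V t] by (meson card_image_le card_mono finite_imageI le_trans)
    then have "real (card (G \<inter> {\<sigma>. \<sigma> \<subseteq> \<tau>})) \<le> real d + 1" using t by (simp add: ksets_def)
    then have "real (card (G \<inter> {\<sigma>. \<sigma> \<subseteq> \<tau>})) * m \<tau> \<le> (real d + 1) * m \<tau>" using m
        by (intro mult_right_mono)
    then show "(\<Sum>\<sigma>\<in>G. if \<sigma> \<subseteq> \<tau> then m \<tau> else 0) \<le> (real d + 1) * m \<tau>"
      using fG by (simp add: sum.If_cases)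
  qed
  finally show ?thesis by (simp add: sum_distrib_left)
qed

section \<open>Fat faces\<close>

locale fat_faces =
  fixes V :: "'a set" and d :: nat and A :: "'a set set" and eps :: "nat \<Rightarrow> real"
  assumes V: "finite V" and A: "A \<subseteq> ksets V d" and eps: "\<And>r. eps r > 0"
begin

text \<open>Level \<open>r\<close> consists of faces with d - r vertices. The threshold varies with
  the level because the threshold at one level has to be small compared with constants accumulated
  from the levels before it.\<close>

primrec fat_level :: "nat \<Rightarrow> 'a set set" where
  "fat_level 0 = A"
| "fat_level (Suc r) = {\<psi>. \<psi> \<subseteq> V \<and> card \<psi> + Suc r = d \<and>
     eps r * real (card V) \<le> real (card {x\<in>V - \<psi>. insert x \<psi> \<in> fat_level r})}"

definition fat :: "'a set set" where "fat = {\<psi>. \<exists>r. \<psi> \<in> fat_level r}"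

definition ext :: "'a set \<Rightarrow> 'a set" where "ext \<psi> = {x\<in>V - \<psi>. insert x \<psi> \<in> fat}"

lemma fat_levelD: "\<psi> \<in> fat_level r \<Longrightarrow> \<psi> \<subseteq> V \<and> card \<psi> + r = d"
  using A by (cases r) (auto simp: ksets_def)

lemma fat_iff_level: "card \<psi> + r = d \<Longrightarrow> \<psi> \<in> fat \<longleftrightarrow> \<psi> \<in> fat_level r"
proof
  assume c: "card \<psi> + r = d" and "\<psi> \<in> fat"
  then obtain s where s: "\<psi> \<in> fat_level s" unfolding fat_def by auto
  then have "s = r" using fat_levelD[OF s] c by simp
  then show "\<psi> \<in> fat_level r" using s by simp
qed (auto simp: fat_def)

lemma fatD: "\<psi> \<in> fat \<Longrightarrow> \<psi> \<subseteq> V \<and> card \<psi> \<le> d \<and> finite \<psi>"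
  unfolding fat_def using fat_levelD V finite_subset by fastforce

lemma fat_top: "card \<psi> = d \<Longrightarrow> \<psi> \<in> fat \<longleftrightarrow> \<psi> \<in> A"
  using fat_iff_level[of \<psi> 0] by simp

lemma A_fat: "\<sigma> \<in> A \<Longrightarrow> \<sigma> \<in> fat"
  using fat_top[of \<sigma>] A by (auto simp: ksets_def)

lemma fat_iff_ext:
  assumes "\<psi> \<subseteq> V" "card \<psi> + Suc r = d"
  shows "\<psi> \<in> fat \<longleftrightarrow> eps r * real (card V) \<le> real (card (ext \<psi>))"
proof -
  have f: "finite \<psi>" using assms V finite_subset by auto
  have "insert x \<psi> \<in> fat \<longleftrightarrow> insert x \<psi> \<in> fat_level r" if "x \<in> V - \<psi>" for x
    using fat_iff_level[of "insert x \<psi>" r] assms f that by simp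
  then have "ext \<psi> = {x\<in>V - \<psi>. insert x \<psi> \<in> fat_level r}" unfolding ext_def by blast
  then show ?thesis using fat_iff_level[OF assms(2)] assms by simp
qed

definition step :: "'a set \<Rightarrow> 'a set \<Rightarrow> bool" where
  "step \<phi> \<psi> \<longleftrightarrow> \<phi> \<in> fat \<and> \<psi> \<in> fat \<and> (\<exists>x\<in>\<phi>. \<psi> = \<phi> - {x})"

text \<open>Reachability by a chain of fat faces is required, not mere containment of
  \<open>\<rho>\<close>: such chains can be moved between the faces of \<open>A\<close> inside one
  top face.\<close>

definition climb :: "'a set \<Rightarrow> 'a set set" where "climb \<rho> = {\<sigma>\<in>A. step\<^sup>*\<^sup>* \<sigma> \<rho>}"

definition terminal :: "'a set \<Rightarrow> bool" where
  "terminal \<rho> \<longleftrightarrow> \<rho> \<in> fat \<and> (\<forall>x\<in>\<rho>. \<rho> - {x} \<notin> fat)"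

definition bad :: "'a set \<Rightarrow> bool" where
  "bad \<tau> \<longleftrightarrow> (\<exists>\<psi> x y. x \<noteq> y \<and> x \<notin> \<psi> \<and> y \<notin> \<psi> \<and> insert x (insert y \<psi>) \<subseteq> \<tau> \<and>
      insert x \<psi> \<in> fat \<and> insert y \<psi> \<in> fat \<and> \<psi> \<notin> fat)"

lemma steps_subset: "step\<^sup>*\<^sup>* \<sigma> \<phi> \<Longrightarrow> \<phi> \<subseteq> \<sigma>"
  by (induction rule: rtranclp_induct) (auto simp: step_def)

lemma steps_fat: "step\<^sup>*\<^sup>* \<sigma> \<phi> \<Longrightarrow> \<sigma> \<in> fat \<Longrightarrow> \<phi> \<in> fat"
  by (induction rule: rtranclp_induct) (auto simp: step_def)

lemma not_badD:
  assumes "\<not> bad \<tau>" "\<phi> \<subseteq> \<tau>" "x \<in> \<phi>" "z \<in> \<phi>" "x \<noteq> z" "\<phi> - {x} \<in> fat" "\<phi> - {z} \<in> fat"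
  shows "\<phi> - {x} - {z} \<in> fat"
proof (rule ccontr)
  assume n: "\<phi> - {x} - {z} \<notin> fat"
  have e: "insert x (\<phi> - {x} - {z}) = \<phi> - {z}" "insert z (\<phi> - {x} - {z}) = \<phi> - {x}" using assms(3-5)
      by auto
  have "bad \<tau>" unfolding bad_def
  proof (intro exI conjI)
    show "x \<noteq> z" "x \<notin> \<phi> - {x} - {z}" "z \<notin> \<phi> - {x} - {z}" using assms(5) by auto
    show "insert x (insert z (\<phi> - {x} - {z})) \<subseteq> \<tau>" using assms(2-4) by auto
    show "insert x (\<phi> - {x} - {z}) \<in> fat" "insert z (\<phi> - {x} - {z}) \<in> fat" unfolding e
        using assms(7,6) .
    show "\<phi> - {x} - {z} \<notin> fat" by (rule n)
  qed
  then show False using assms(1) by simp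
qed

text \<open>Inside a face that is not bad, a descending chain of fat faces can be pushed off any vertex,
  so a terminal \<open>\<rho>\<close> below one face of \<open>A\<close> in \<open>\<tau>\<close> lies below all of them.\<close>

lemma steps_remove:
  assumes t: "\<tau> \<in> ksets V (Suc d)" and nb: "\<not> bad \<tau>" and s: "\<sigma> \<in> A" "\<sigma> \<subseteq> \<tau>"
    and x: "x \<in> \<sigma>" and tx: "\<tau> - {x} \<in> A" and st: "step\<^sup>*\<^sup>* \<sigma> \<phi>"
  shows "step\<^sup>*\<^sup>* (\<tau> - {x}) (\<phi> - {x})"
  using st
proof (induction rule: rtranclp_induct)
  \<comment> \<open>\<open>\<sigma>\<close> and \<open>\<tau> - {x}\<close> are two faces of
    \<open>A\<close> in \<open>\<tau>\<close> that meet in a common facet; as \<open>\<tau>\<close>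
    is not bad, that facet is fat.\<close>
  case base
  have "card \<sigma> = d" using s A by (auto simp: ksets_def)
  then obtain y where y: "y \<in> \<tau>" "y \<notin> \<sigma>" "\<sigma> = \<tau> - {y}" using ksets_facet[OF V t s(2)] by blast
  have xy: "x \<noteq> y" using x y by auto
  have "\<tau> - {x} - {y} \<in> fat"
    using not_badD[OF nb subset_refl, of x y] xy x y s A_fat[OF tx] A_fat[OF s(1)] by auto
  moreover have "\<sigma> - {x} = \<tau> - {x} - {y}" using y by auto
  ultimately have "step (\<tau> - {x}) (\<sigma> - {x})"
    unfolding step_def using A_fat[OF tx] y xy by auto
  then show ?case by blast
next
  case (step \<phi> \<phi>')
  from step.hyps(2) obtain z where z: "z \<in> \<phi>" "\<phi>' = \<phi> - {z}" "\<phi> \<in> fat" "\<phi>' \<in> fat" unfolding step_def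
      by blast
  have ft: "\<phi> \<subseteq> \<tau>" using steps_subset[OF step.hyps(1)] s by auto
  show ?case
  proof (cases "z = x")
    case True
    then have "\<phi>' - {x} = \<phi> - {x}" using z by auto
    then show ?thesis using step.IH by simp
  next
    case zx: False
    show ?thesis
    proof (cases "x \<in> \<phi>")
      case False
      then have "\<phi> - {x} = \<phi>" "\<phi>' - {x} = \<phi>'" using z by auto
      then show ?thesis using step.IH step.hyps(2) by (metis rtranclp.rtrancl_into_rtrancl)
    next
      case True
      \<comment> \<open>The only case with a genuine move: \<open>\<phi>\<close> with
        \<open>x\<close> removed and \<open>\<phi>\<close> with \<open>z\<close> removed are both
        fat, so in a face that is not bad the square closes. In the other cases the shifted chain
        stalls or follows the original one.\<close>
      have f1: "\<phi> - {x} \<in> fat" using steps_fat[OF step.IH A_fat[OF tx]] .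
      have "\<phi> - {x} - {z} \<in> fat" using not_badD[OF nb ft True z(1)] zx f1 z by auto
      moreover have e: "\<phi>' - {x} = \<phi> - {x} - {z}" using z by auto
      ultimately have "step (\<phi> - {x}) (\<phi>' - {x})" unfolding step_def using f1 z zx by auto
      then show ?thesis using step.IH by (rule rtranclp.rtrancl_into_rtrancl[rotated])
    qed
  qed
qed

text \<open>Equality of these sets means equal parities, so at \<open>\<tau>\<close> the coboundary
  of \<open>A\<close> and that of its part above \<open>\<rho>\<close> agree as soon as one face of
  that part lies in \<open>\<tau>\<close>.\<close>

lemma climb_faces_eq:
  assumes t: "\<tau> \<in> ksets V (Suc d)" and nb: "\<not> bad \<tau>" and r: "terminal \<rho>" and s: "\<sigma> \<in> climb \<rho>" "\<sigma> \<subseteq>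
      \<tau>"
  shows "{\<kappa>\<in>A. \<kappa> \<subseteq> \<tau>} = {\<kappa>\<in>climb \<rho>. \<kappa> \<subseteq> \<tau>}"
proof -
  have sA: "\<sigma> \<in> A" and st: "step\<^sup>*\<^sup>* \<sigma> \<rho>" using s by (auto simp: climb_def)
  have "\<kappa> \<in> climb \<rho>" if k: "\<kappa> \<in> A" "\<kappa> \<subseteq> \<tau>" for \<kappa>
  proof (cases "\<kappa> = \<sigma>")
    case False
    have c: "card \<kappa> = d" "card \<sigma> = d" using k sA A by (auto simp: ksets_def)
    obtain x where x: "x \<in> \<tau>" "x \<notin> \<kappa>" "\<kappa> = \<tau> - {x}" using ksets_facet[OF V t k(2) c(1)] by blast
    obtain y where y: "y \<in> \<tau>" "y \<notin> \<sigma>" "\<sigma> = \<tau> - {y}" using ksets_facet[OF V t s(2) c(2)] by blast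
    have xs: "x \<in> \<sigma>" using x y False by auto
    have st': "step\<^sup>*\<^sup>* (\<tau> - {x}) (\<rho> - {x})" using steps_remove[OF t nb sA s(2) xs _ st] k x by simp
    have "\<rho> - {x} \<in> fat" using steps_fat[OF st'] A_fat k x by auto
    \<comment> \<open>If \<open>x\<close> were in \<open>\<rho>\<close>, the pushed chain would end
      at a fat facet of \<open>\<rho>\<close>, against terminality. So the chain still ends at
      \<open>\<rho>\<close>.\<close>
    then have "x \<notin> \<rho>" using r unfolding terminal_def by auto
    then have "\<rho> - {x} = \<rho>" by auto
    then show ?thesis using st' k x by (simp add: climb_def)
  qed (use s in simp)
  then show ?thesis unfolding climb_def by auto
qed

lemma exists_terminal:
  assumes "\<phi> \<in> fat" "step\<^sup>*\<^sup>* \<sigma> \<phi>"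
  shows "\<exists>\<rho>. terminal \<rho> \<and> step\<^sup>*\<^sup>* \<sigma> \<rho>"
  using assms
proof (induction "card \<phi>" arbitrary: \<phi> rule: less_induct)
  case less
  show ?case
  proof (cases "terminal \<phi>")
    case False
    then obtain x where x: "x \<in> \<phi>" "\<phi> - {x} \<in> fat" using less.prems unfolding terminal_def by auto
    have "card (\<phi> - {x}) < card \<phi>" using x fatD[OF less.prems(1)] by (meson card_Diff1_less)
    moreover have "step\<^sup>*\<^sup>* \<sigma> (\<phi> - {x})"
      using less.prems x by (intro rtranclp.rtrancl_into_rtrancl[OF less.prems(2)]) (auto simp:
          step_def)
    ultimately show ?thesis using less.hyps x by blast
  qed (use less.prems in blast)
qed

lemma finite_A: "finite A" using A finite_ksets[OF V] finite_subset by blast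

lemma finite_fat: "finite fat"
  by (rule finite_subset[of _ "Pow V"]) (use fatD V in auto)

lemma climb_subset: "climb \<rho> \<subseteq> A" unfolding climb_def by auto

lemma climb_top:
  assumes s: "\<sigma> \<in> A"
  shows "climb \<sigma> = {\<sigma>}"
proof -
  have "\<kappa> = \<sigma>" if k: "\<kappa> \<in> climb \<sigma>" for \<kappa>
  proof -
    have kA: "\<kappa> \<in> A" and sk: "\<sigma> \<subseteq> \<kappa>" using k steps_subset by (auto simp: climb_def)
    have c: "card \<sigma> = card \<kappa>" using s kA A by (auto simp: ksets_def)
    have "finite \<kappa>" using fatD[OF A_fat[OF kA]] by simp
    then show ?thesis using card_subset_eq[OF _ sk c] by simp
  qed
  moreover have "\<sigma> \<in> climb \<sigma>" using s by (simp add: climb_def)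
  ultimately show ?thesis by blast
qed

end

text \<open>\<open>M r\<close> is the product of the factors d / eps lost at each level below
  \<open>r\<close>. The same factor arises in the lower bound for the faces above a fat face and in
  the upper bound for the number of fat faces.\<close>

locale fat_faces_const = fat_faces +
  fixes M :: "nat \<Rightarrow> real"
  assumes M0: "M 0 = 1" and MS: "\<And>r. M (Suc r) * eps r = M r * real d" and Mpos: "\<And>r. M r > 0"
begin

text \<open>Double counting of pairs of a vertex \<open>x\<close> in \<open>ext \<rho>\<close> and a
  face in the climb of \<open>insert x \<rho>\<close>: fatness supplies many \<open>x\<close>,
  induction many faces for each, and a face occurs for at most d vertices. So \<open>A\<close> is
  dense above every fat face.\<close>

lemma card_climb:
  assumes "\<rho> \<in> fat" "card \<rho> + r = d"
  shows "real (card V) ^ r \<le> M r * real (card (climb \<rho>))"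
  using assms
proof (induction r arbitrary: \<rho>)
  case 0
  then have "\<rho> \<in> A" using fat_top by auto
  then show ?case using climb_top M0 by simp
next
  case (Suc r)
  have rV: "\<rho> \<subseteq> V" "finite \<rho>" using fatD[OF Suc.prems(1)] by auto
  have e: "eps r * real (card V) \<le> real (card (ext \<rho>))"
      using fat_iff_ext[OF rV(1) Suc.prems(2)] Suc.prems by simp
  have fe: "finite (ext \<rho>)" unfolding ext_def using V by simp
  have fc: "finite (climb \<sigma>)" for \<sigma> using climb_subset finite_A finite_subset by metis
  have sub: "climb (insert x \<rho>) \<subseteq> {\<sigma>\<in>climb \<rho>. x \<in> \<sigma>}" if x: "x \<in> ext \<rho>" for x
  proof
    fix \<sigma> assume s: "\<sigma> \<in> climb (insert x \<rho>)"
    have "x \<notin> \<rho>" "insert x \<rho> \<in> fat" using x by (auto simp: ext_def)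
    then have "step (insert x \<rho>) \<rho>" unfolding step_def using Suc.prems
        by (auto intro!: bexI[of _ x])
    then have "step\<^sup>*\<^sup>* \<sigma> \<rho>" using s by (auto simp: climb_def intro: rtranclp.rtrancl_into_rtrancl)
    moreover have "x \<in> \<sigma>" using s steps_subset by (auto simp: climb_def)
    ultimately show "\<sigma> \<in> {\<sigma>\<in>climb \<rho>. x \<in> \<sigma>}" using s by (auto simp: climb_def)
  qed
  have "real (card V) ^ Suc r * eps r = real (card V) ^ r * (eps r * real (card V))" by simp
  also have "\<dots> \<le> real (card V) ^ r * real (card (ext \<rho>))" using e by (intro mult_left_mono) auto
  also have "\<dots> = (\<Sum>x\<in>ext \<rho>. real (card V) ^ r)" by simp
  also have "\<dots> \<le> (\<Sum>x\<in>ext \<rho>. M r * real (card {\<sigma>\<in>climb \<rho>. x \<in> \<sigma>}))"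
  proof (rule sum_mono)
    fix x assume x: "x \<in> ext \<rho>"
    have "real (card V) ^ r \<le> M r * real (card (climb (insert x \<rho>)))"
      using x Suc.prems rV by (intro Suc.IH) (auto simp: ext_def)
    also have "\<dots> \<le> M r * real (card {\<sigma>\<in>climb \<rho>. x \<in> \<sigma>})"
      using Mpos[of r] sub[OF x] fc by (intro mult_left_mono) (auto intro!: card_mono)
    finally show "real (card V) ^ r \<le> M r * real (card {\<sigma>\<in>climb \<rho>. x \<in> \<sigma>})" .
  qed
  also have "\<dots> = M r * real (\<Sum>x\<in>ext \<rho>. \<Sum>\<sigma>\<in>climb \<rho>. if x \<in> \<sigma> then 1 else 0)"
    using fc by (simp add: sum_distrib_left sum.If_cases Int_def)
  also have "(\<Sum>x\<in>ext \<rho>. \<Sum>\<sigma>\<in>climb \<rho>. if x \<in> \<sigma> then 1 else 0) = (\<Sum>\<sigma>\<in>climb \<rho>. \<Sum>x\<in>ext \<rho>.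
      if x \<in> \<sigma> then 1 else (0::nat))"
    by (rule sum.swap)
  also have "M r * real \<dots> \<le> M r * real (\<Sum>\<sigma>\<in>climb \<rho>. d)"
  proof (intro mult_left_mono of_nat_mono sum_mono)
    fix \<sigma> assume "\<sigma> \<in> climb \<rho>"
    then have sk: "\<sigma> \<in> ksets V d" using climb_subset A by blast
    have "finite \<sigma>" using ksets_finite[OF V sk] .
    moreover have "card \<sigma> = d" using sk by (simp add: ksets_def)
    moreover have "(\<Sum>x\<in>ext \<rho>. if x \<in> \<sigma> then 1 else (0::nat)) = card (ext \<rho> \<inter> \<sigma>)" using fe
        by (simp add: sum.If_cases)
    moreover have "card (ext \<rho> \<inter> \<sigma>) \<le> card \<sigma>" using \<open>finite \<sigma>\<close> by (intro card_mono) auto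
    ultimately show "(\<Sum>x\<in>ext \<rho>. if x \<in> \<sigma> then 1 else (0::nat)) \<le> d" by simp
  qed (use Mpos[of r] in auto)
  also have "\<dots> = M (Suc r) * real (card (climb \<rho>)) * eps r" using MS[of r]
      by (simp add: algebra_simps)
  finally show ?case using eps[of r] by (rule mult_right_le_imp_le)
qed

text \<open>A pair of \<open>\<psi>\<close> and an extending vertex is recovered from the fat face
  they form and the marked vertex in it, of which there are at most d.\<close>

lemma card_ext_sum:
  "(\<Sum>\<psi> | \<psi> \<subseteq> V \<and> card \<psi> + Suc r = d. card (ext \<psi>)) \<le> d * card {\<phi>\<in>fat. card \<phi> + r = d}"
proof -
  let ?P = "{\<psi>. \<psi> \<subseteq> V \<and> card \<psi> + Suc r = d}" and ?F = "{\<phi>\<in>fat. card \<phi> + r = d}"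
  have fP: "finite ?P" using V by simp
  have "(\<Sum>\<psi>\<in>?P. card (ext \<psi>)) = card (SIGMA \<psi>:?P. ext \<psi>)"
    using fP V by (subst card_SigmaI) (auto simp: ext_def)
  also have "\<dots> \<le> card (SIGMA \<phi>:?F. \<phi>)"
  proof (rule card_inj_on_le[where f="\<lambda>(\<psi>, x). (insert x \<psi>, x)"])
    show "inj_on (\<lambda>(\<psi>, x). (insert x \<psi>, x)) (SIGMA \<psi>:?P. ext \<psi>)"
      by (auto simp: inj_on_def ext_def insert_ident)
    show "(\<lambda>(\<psi>, x). (insert x \<psi>, x)) ` (SIGMA \<psi>:?P. ext \<psi>) \<subseteq> (SIGMA \<phi>:?F. \<phi>)"
      using finite_subset[OF _ V] by (auto simp: ext_def)
    show "finite (SIGMA \<phi>:?F. \<phi>)" using finite_fat fatD by (intro finite_SigmaI) auto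
  qed
  also have "\<dots> = (\<Sum>\<phi>\<in>?F. card \<phi>)" using finite_fat fatD by (subst card_SigmaI) auto
  also have "\<dots> \<le> (\<Sum>\<phi>\<in>?F. d)" by (rule sum_mono) auto
  finally show ?thesis by (simp add: mult.commute)
qed

text \<open>Each fat face of the next level has at least \<open>eps r * card V\<close> fat
  extensions, and \<open>card_ext_sum\<close> bounds their total. Thus fat faces lose a factor n
  with every codimension.\<close>

lemma card_fat_level:
  assumes "r \<le> d"
  shows "real (card {\<phi>\<in>fat. card \<phi> + r = d}) * real (card V) ^ r \<le> M r * real (card A)"
  using assms
proof (induction r)
  case 0
  have "{\<phi>\<in>fat. card \<phi> + 0 = d} = A" using fat_top A A_fat by (auto simp: ksets_def)
  then show ?case using M0 by simp
next
  case (Suc r)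
  let ?F = "\<lambda>r. {\<phi>\<in>fat. card \<phi> + r = d}"
  have "real (card (?F (Suc r))) * (eps r * real (card V)) = (\<Sum>\<psi>\<in>?F (Suc r). eps r * real (card V))"
      by simp
  also have "\<dots> \<le> (\<Sum>\<psi>\<in>?F (Suc r). real (card (ext \<psi>)))"
    using fat_iff_ext fatD by (intro sum_mono) auto
  also have "\<dots> \<le> (\<Sum>\<psi> | \<psi> \<subseteq> V \<and> card \<psi> + Suc r = d. real (card (ext \<psi>)))"
    using V fatD by (intro sum_mono2) auto
  also have "\<dots> \<le> real d * real (card (?F r))" 
    using of_nat_mono[OF card_ext_sum[of r], where 'a=real] by simp
  finally have 1: "real (card (?F (Suc r))) * (eps r * real (card V)) \<le>
      real d * real (card (?F r))" .
  have "real (card (?F (Suc r))) * real (card V) ^ Suc r * eps r =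
      real (card (?F (Suc r))) * (eps r * real (card V)) * real (card V) ^ r"
    by (simp add: algebra_simps)
  also have "\<dots> \<le> real d * real (card (?F r)) * real (card V) ^ r" using 1
      by (intro mult_right_mono) auto
  also have "\<dots> \<le> real d * (M r * real (card A))"
    using Suc by (simp only: mult.assoc) (intro mult_left_mono, auto)
  also have "\<dots> = M (Suc r) * real (card A) * eps r" using MS[of r] by (simp add: algebra_simps)
  finally show ?case using eps[of r] by (rule mult_right_le_imp_le)
qed
end


section \<open>Expansion of a minimal cochain in top dimension\<close>

context fat_faces_const begin

text \<open>A bad face contains a non-fat \<open>\<psi>\<close> together with two vertices of
  \<open>ext \<psi>\<close>, and this set is small exactly because \<open>\<psi>\<close> is not fat,
  so \<open>sparse\<close> applies. The bound is linear in \<open>card (ext \<psi>)\<close>; summed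
  over \<open>\<psi>\<close> it meets \<open>card_ext_sum\<close> and \<open>card_fat_level\<close>,
  and the factor \<open>M r\<close> cancels.\<close>

lemma bad_weight:
  fixes m :: "'a set \<Rightarrow> real" and k a :: real
  assumes m: "\<And>\<tau>. m \<tau> \<ge> 0" and k: "k \<ge> 0" and a: "a \<ge> 0"
    and sparse: "\<And>\<psi> r X. \<psi> \<subseteq> V \<Longrightarrow> card \<psi> + Suc r = d \<Longrightarrow> X \<subseteq> V - \<psi> \<Longrightarrow> X \<noteq> {} \<Longrightarrow>
      real (card X) < eps r * real (card V) \<Longrightarrow>
      sum m {\<tau>\<in>ksets V (Suc d). \<exists>x\<in>X. \<exists>y\<in>X. x \<noteq> y \<and> insert x (insert y \<psi>) \<subseteq> \<tau>}
        \<le> a / M r * k * real (card V) ^ r * real (card X)"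
  shows "sum m {\<tau>\<in>ksets V (Suc d). bad \<tau>} \<le> a * k * real d ^ 2 * real (card A)"
proof -
  let ?n = "real (card V)"
  let ?P = "\<lambda>r. {\<psi>. \<psi> \<subseteq> V \<and> card \<psi> + Suc r = d \<and> \<psi> \<notin> fat}"
  let ?S = "\<lambda>\<psi>. {\<tau>\<in>ksets V (Suc d). \<exists>x\<in>ext \<psi>. \<exists>y\<in>ext \<psi>. x \<noteq> y \<and> insert x (insert y \<psi>) \<subseteq> \<tau>}"
  have fK: "finite (ksets V (Suc d))" using V by simp
  have fP: "finite (?P r)" for r by (rule finite_subset[of _ "Pow V"]) (use V in auto)
  have fS: "finite (?S \<psi>)" for \<psi> using fK by (rule rev_finite_subset) auto
  have "{\<tau>\<in>ksets V (Suc d). bad \<tau>} \<subseteq> (\<Union>r\<in>{..<d}. \<Union>\<psi>\<in>?P r. ?S \<psi>)"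
  proof
    fix \<tau> assume "\<tau> \<in> {\<tau>\<in>ksets V (Suc d). bad \<tau>}"
    then have t: "\<tau> \<in> ksets V (Suc d)" and "bad \<tau>" by auto
    then obtain \<psi> x y where b: "x \<noteq> y" "x \<notin> \<psi>" "y \<notin> \<psi>" "insert x (insert y \<psi>) \<subseteq> \<tau>"
      "insert x \<psi> \<in> fat" "insert y \<psi> \<in> fat" "\<psi> \<notin> fat" unfolding bad_def by blast
    have pV: "\<psi> \<subseteq> V" "x \<in> V" "y \<in> V" using b t by (auto simp: ksets_def)
    have f: "finite \<psi>" using pV V finite_subset by auto
    have "card (insert x \<psi>) \<le> d" using fatD[OF b(5)] by simp
    then have c: "card \<psi> + Suc (d - Suc (card \<psi>)) = d" "d - Suc (card \<psi>) < d" using f b by auto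
    have "x \<in> ext \<psi>" "y \<in> ext \<psi>" using b pV by (auto simp: ext_def)
    then have "\<tau> \<in> ?S \<psi>" using b t by blast
    then show "\<tau> \<in> (\<Union>r\<in>{..<d}. \<Union>\<psi>\<in>?P r. ?S \<psi>)" using c b pV by blast
  qed
  then have "sum m {\<tau>\<in>ksets V (Suc d). bad \<tau>} \<le> sum m (\<Union>r\<in>{..<d}. \<Union>\<psi>\<in>?P r. ?S \<psi>)"
    using m fP fS by (intro sum_mono2) auto
  also have "\<dots> \<le> (\<Sum>r<d. sum m (\<Union>\<psi>\<in>?P r. ?S \<psi>))"
    by (rule sum_UN_le) (use m fP fS in auto)
  also have "\<dots> \<le> (\<Sum>r<d. a * k * real d * real (card A))"
  proof (rule sum_mono)
    fix r assume r: "r \<in> {..<d}"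
    have "sum m (\<Union>\<psi>\<in>?P r. ?S \<psi>) \<le> (\<Sum>\<psi>\<in>?P r. sum m (?S \<psi>))"
      by (rule sum_UN_le) (use m fP fS in auto)
    also have "\<dots> \<le> (\<Sum>\<psi>\<in>?P r. a / M r * k * ?n ^ r * real (card (ext \<psi>)))"
    proof (rule sum_mono)
      fix \<psi> assume p: "\<psi> \<in> ?P r"
      show "sum m (?S \<psi>) \<le> a / M r * k * ?n ^ r * real (card (ext \<psi>))"
      proof (cases "ext \<psi> = {}")
        case False
        show ?thesis
          by (rule sparse) (use p False fat_iff_ext[of \<psi> r] in \<open>auto simp: ext_def\<close>)
      qed simp
    qed
    also have "\<dots> \<le> (\<Sum>\<psi> | \<psi> \<subseteq> V \<and> card \<psi> + Suc r = d. a / M r * k * ?n ^ r * real (card (ext \<psi>)))"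
      using V a k Mpos[of r] by (intro sum_mono2) auto
    also have "\<dots> = a / M r * k * ?n ^ r * real (\<Sum>\<psi> | \<psi> \<subseteq> V \<and> card \<psi> + Suc r = d. card (ext \<psi>))"
      by (simp add: sum_distrib_left)
    also have "\<dots> \<le> a / M r * k * ?n ^ r * real (d * card {\<phi>\<in>fat. card \<phi> + r = d})"
      using a k Mpos[of r] card_ext_sum[of r] by (intro mult_left_mono of_nat_mono) auto
    also have "\<dots> = a / M r * k * real d * (real (card {\<phi>\<in>fat. card \<phi> + r = d}) * ?n ^ r)"
      by (simp add: algebra_simps)
    also have "\<dots> \<le> a / M r * k * real d * (M r * real (card A))"
      using a k Mpos[of r] card_fat_level[of r] r by (intro mult_left_mono) auto
    also have "\<dots> = a * k * real d * real (card A)" using Mpos[of r] by simp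
    finally show "sum m (\<Union>\<psi>\<in>?P r. ?S \<psi>) \<le> a * k * real d * real (card A)" .
  qed
  also have "\<dots> = a * k * real d ^ 2 * real (card A)" by (simp add: power2_eq_square)
  finally show ?thesis .
qed

text \<open>The deterministic core of the top dimension. \<open>m\<close> is to be the multiplicity
  of a face in the sample, and \<open>ridge\<close>, \<open>sparse\<close>, \<open>link\<close>,
  \<open>deg\<close> are what the sample must satisfy. \<open>h\<close> is the expansion of a single
  piece: a factor 2(d + 1) is lost in the link and another 2 in passing to the random faces.
  \<open>a\<close> is the tolerated rate of bad faces.\<close>

lemma fat_expansion:
  fixes m :: "'a set \<Rightarrow> real" and k C h a Mx :: real
  assumes d: "d = Suc d'" and min: "cobd_minimal V d' A" and n: "2 * d \<le> card V" "card V > 0"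
    and m: "\<And>\<tau>. m \<tau> \<ge> 0" and k: "k > 0" and C: "C \<ge> 0"
    and h: "h = 1 / (4 * (real d + 1))" and a: "a = h / (2 ^ (d + 2) * real d ^ 2)"
    and Mx: "\<And>r. r \<le> d \<Longrightarrow> M r \<le> Mx"
    and ridge: "\<And>\<sigma>. \<sigma> \<in> ksets V d \<Longrightarrow> k \<le> sum m (star V d \<sigma>)"
    and sparse: "\<And>\<psi> r X. \<psi> \<subseteq> V \<Longrightarrow> card \<psi> + Suc r = d \<Longrightarrow> X \<subseteq> V - \<psi> \<Longrightarrow> X \<noteq> {} \<Longrightarrow>
      real (card X) < eps r * real (card V) \<Longrightarrow>
      sum m {\<tau>\<in>ksets V (Suc d). \<exists>x\<in>X. \<exists>y\<in>X. x \<noteq> y \<and> insert x (insert y \<psi>) \<subseteq> \<tau>}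
        \<le> a / M r * k * real (card V) ^ r * real (card X)"
    and link: "\<And>\<rho> r G. \<rho> \<subseteq> V \<Longrightarrow> card \<rho> + r = d \<Longrightarrow> r > 0 \<Longrightarrow> G \<subseteq> {\<sigma>\<in>ksets V d. \<rho> \<subseteq> \<sigma>} \<Longrightarrow>
      real (card V) ^ Suc r \<le> 2 * (real d + 1) * Mx * real (card (cobd V d G)) \<Longrightarrow>
      k * real (card (cobd V d G)) \<le> 2 * real (card V) * sum m (cobd V d G)"
    and deg: "\<And>\<rho> r. \<rho> \<subseteq> V \<Longrightarrow> card \<rho> + r = d \<Longrightarrow> r > 0 \<Longrightarrow> sum m (star V d \<rho>) \<le> C * k * real (card V) ^ r"
  shows "(\<Sum>\<sigma>\<in>A. sum m (star V d \<sigma>)) \<le> (1 + (real d + 1) * C * Mx / h) * 2 ^ (d +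
      2) * sum m (cobd V d A)"
proof -
  let ?n = "real (card V)"
  let ?N = "sum m"
  define Tm where "Tm = {\<rho>. terminal \<rho>}"
  define \<Delta> where "\<Delta> = (\<Sum>\<rho>\<in>Tm. ?N (cobd V d (climb \<rho>)))"
  have h0: "h > 0" unfolding h by simp
  have d0: "d > 0" using d by simp
  have a0: "a > 0" unfolding a using h0 d0 by simp
  have fK: "finite (ksets V (Suc d))" using V by simp
  have fTm: "finite Tm" unfolding Tm_def by (rule finite_subset[OF _ finite_fat]) (auto simp:
      terminal_def)
  have Nmono: "?N S \<le> ?N S'" if "S \<subseteq> S'" "S' \<subseteq> ksets V (Suc d)" for S S'
    using that m finite_subset[OF that(2) fK] by (intro sum_mono2) auto
  have Nnn: "?N S \<ge> 0" for S using m by (rule sum_nonneg)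
  have fc: "finite (climb \<sigma>)" for \<sigma> using climb_subset finite_A finite_subset by metis
  have climb_sub: "\<rho> \<subseteq> \<sigma>" if "\<sigma> \<in> climb \<rho>" for \<rho> \<sigma> using that steps_subset by (auto simp: climb_def)
  have Mx0: "Mx > 0" using Mx[of 0] M0 by simp
  \<comment> \<open>Each piece expands on its own, and its total degree is controlled by its own
    coboundary; the second half is needed because the claim weighs \<open>A\<close> by degrees and
    not by cardinality.\<close>
  have each: "h * k * real (card (climb \<rho>)) \<le> ?N (cobd V d (climb \<rho>)) \<and>
      (\<Sum>\<sigma>\<in>climb \<rho>. ?N (star V d \<sigma>)) \<le> (1 + (real d + 1) * C * Mx / h) * ?N (cobd V d (climb \<rho>))"
    if r: "\<rho> \<in> Tm" for \<rho>
  proof -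
    have rf: "\<rho> \<in> fat" using r by (auto simp: Tm_def terminal_def)
    have rV: "\<rho> \<subseteq> V" "card \<rho> \<le> d" "finite \<rho>" using fatD[OF rf] by auto
    define r where "r = d - card \<rho>"
    have cr: "card \<rho> + r = d" using rV by (simp add: r_def)
    show ?thesis
    proof (cases "r = 0")
      case True
      \<comment> \<open>A terminal face that is itself in \<open>A\<close>: its coboundary is its
        whole star, and no union bound is involved, only the minimum degree.\<close>
      then have rA: "\<rho> \<in> A" using fat_top rf cr by auto
      then have rK: "\<rho> \<in> ksets V d" using A by auto
      have cl: "climb \<rho> = {\<rho>}" using climb_top[OF rA] .
      have "cobd V d {\<rho>} = star V d \<rho>"
      proof -
        have "odd (card {\<sigma>\<in>{\<rho>}. \<sigma> \<subseteq> \<tau>}) \<longleftrightarrow> \<rho> \<subseteq> \<tau>" for \<tau>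
        proof (cases "\<rho> \<subseteq> \<tau>")
          case True
          then have e: "{\<sigma>\<in>{\<rho>}. \<sigma> \<subseteq> \<tau>} = {\<rho>}" by auto
          show ?thesis unfolding e using True by simp
        next
          case False
          then have e: "{\<sigma>\<in>{\<rho>}. \<sigma> \<subseteq> \<tau>} = {}" by auto
          show ?thesis unfolding e using False by simp
        qed
        then show ?thesis unfolding cobd_def star_def by simp
      qed
      then have eq: "?N (cobd V d (climb \<rho>)) = ?N (star V d \<rho>)" unfolding cl by simp
      have "h * k * real (card (climb \<rho>)) \<le> k" unfolding cl using h0 k by (simp add: h divide_le_eq)
      also have "k \<le> ?N (star V d \<rho>)" by (rule ridge[OF rK])
      finally have 1: "h * k * real (card (climb \<rho>)) \<le> ?N (cobd V d (climb \<rho>))" unfolding eq .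
      have "(\<Sum>\<sigma>\<in>climb \<rho>. ?N (star V d \<sigma>)) = 1 * ?N (cobd V d (climb \<rho>))" unfolding eq unfolding cl
          by simp
      also have "\<dots> \<le> (1 + (real d + 1) * C * Mx / h) * ?N (cobd V d (climb \<rho>))"
        using Nnn C Mx0 h0 by (intro mult_right_mono) auto
      finally show ?thesis using 1 by simp
    next
      case False
      then have r0: "r > 0" by simp
      let ?c = "card (climb \<rho>)" and ?e = "card (cobd V d (climb \<rho>))"
      have "card (V - \<rho>) * ?c \<le> (Suc d - card \<rho>) * ?e"
        using minimal_cobd_expansion[OF V cobd_minimal_subset[OF V min climb_subset] climb_sub
            rV(1)] unfolding d by simp
      also have "\<dots> \<le> (d + 1) * ?e" by (intro mult_right_mono) auto
      finally have "real (card (V - \<rho>) * ?c) \<le> real ((d + 1) * ?e)" by (rule of_nat_mono)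
      moreover have "?n / 2 \<le> real (card (V - \<rho>))"
        using rV n by (simp add: card_Diff_subset of_nat_diff)
      then have "?n / 2 * real ?c \<le> real (card (V - \<rho>)) * real ?c" by (intro mult_right_mono) auto
      ultimately have exp: "?n * real ?c \<le> 2 * (real d + 1) * real ?e" by (simp add: algebra_simps)
      have cc: "?n ^ r \<le> Mx * real ?c"
        using card_climb[OF rf cr] Mx[of r] cr
            by (meson le_add2 mult_right_mono of_nat_0_le_iff order_trans)
      \<comment> \<open>Density of the piece and expansion in the link together give a coboundary of
        order n^(r+1), the size above which \<open>link\<close> is available.\<close>
      have big: "?n ^ Suc r \<le> 2 * (real d + 1) * Mx * real ?e"
      proof -
        have "?n ^ Suc r \<le> ?n * (Mx * real ?c)" using mult_left_mono[OF cc, of ?n] by simp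
        also have "\<dots> = Mx * (?n * real ?c)" by simp
        also have "\<dots> \<le> Mx * (2 * (real d + 1) * real ?e)" using exp Mx0
            by (intro mult_left_mono) auto
        finally show ?thesis by (simp add: algebra_simps)
      qed
      have G: "climb \<rho> \<subseteq> {\<sigma>\<in>ksets V d. \<rho> \<subseteq> \<sigma>}" using climb_sub climb_subset A by blast
      have lk: "k * real ?e \<le> 2 * ?n * ?N (cobd V d (climb \<rho>))" by (rule link[OF rV(1) cr r0 G big])
      have "h * k * real ?c * ?n \<le> ?N (cobd V d (climb \<rho>)) * ?n"
      proof -
        have "h * k * real ?c * ?n = h * k * (?n * real ?c)" by simp
        also have "\<dots> \<le> h * k * (2 * (real d + 1) * real ?e)" using exp h0 k
            by (intro mult_left_mono) auto
        also have "\<dots> = k * real ?e / 2" unfolding h by (simp add: field_simps)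
        also have "\<dots> \<le> ?N (cobd V d (climb \<rho>)) * ?n" using lk by (simp add: algebra_simps)
        finally show ?thesis .
      qed
      then have 1: "h * k * real ?c \<le> ?N (cobd V d (climb \<rho>))" using n
          by (simp add: mult_le_cancel_right)
      \<comment> \<open>The degrees in the piece sum to at most a constant times the degree of
        \<open>\<rho>\<close>, of order k n^r; by density this is of order k times the size of the
        piece.\<close>
      have "(\<Sum>\<sigma>\<in>climb \<rho>. ?N (star V d \<sigma>)) \<le> (real d + 1) * ?N (star V d \<rho>)"
        by (rule sum_star_le[OF V m]) (use G in auto)
      also have "\<dots> \<le> (real d + 1) * (C * k * ?n ^ r)" using deg[OF rV(1) cr r0]
          by (intro mult_left_mono) auto
      also have "\<dots> \<le> (real d + 1) * (C * k * (Mx * real ?c))" using cc C k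
          by (intro mult_left_mono) auto
      also have "\<dots> = (real d + 1) * C * Mx / h * (h * k * real ?c)" using h0 by simp
      also have "\<dots> \<le> (real d + 1) * C * Mx / h * ?N (cobd V d (climb \<rho>))"
        using 1 C Mx0 h0 by (intro mult_left_mono) auto
      also have "\<dots> \<le> (1 + (real d + 1) * C * Mx / h) * ?N (cobd V d (climb \<rho>))"
        using Nnn by (intro mult_right_mono) auto
      finally show ?thesis using 1 by simp
    qed
  qed
  have cover: "A \<subseteq> (\<Union>\<rho>\<in>Tm. climb \<rho>)"
  proof
    fix \<sigma> assume s: "\<sigma> \<in> A"
    then obtain \<rho> where "terminal \<rho>" "step\<^sup>*\<^sup>* \<sigma> \<rho>" using exists_terminal[OF A_fat[OF s], of \<sigma>]
        by blast
    then show "\<sigma> \<in> (\<Union>\<rho>\<in>Tm. climb \<rho>)" using s by (auto simp: Tm_def climb_def)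
  qed
  \<comment> \<open>The pieces may overlap, but they cover \<open>A\<close>, which suffices for a
    lower bound on the sum of their coboundaries.\<close>
  have "card A \<le> (\<Sum>\<rho>\<in>Tm. card (climb \<rho>))"
    using card_mono[OF _ cover] card_UN_le[OF fTm, of climb] fTm fc by (meson finite_UN_I le_trans)
  then have "h * k * real (card A) \<le> h * k * real (\<Sum>\<rho>\<in>Tm. card (climb \<rho>))"
    using h0 k by (intro mult_left_mono of_nat_mono) auto
  also have "\<dots> = (\<Sum>\<rho>\<in>Tm. h * k * real (card (climb \<rho>)))" by (simp add: sum_distrib_left)
  also have "\<dots> \<le> \<Delta>" unfolding \<Delta>_def by (rule sum_mono) (use each in blast)
  finally have low: "h * k * real (card A) \<le> \<Delta>" .
  let ?B = "{\<tau>\<in>ksets V (Suc d). bad \<tau>}"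
  \<comment> \<open>Locality: outside bad faces, the coboundary of a piece lies in the coboundary of
    \<open>A\<close>.\<close>
  have in_cob: "\<rho> \<subseteq> \<tau> \<and> \<tau> \<in> cobd V d A \<union> ?B" if r: "\<rho> \<in> Tm" and t: "\<tau> \<in> cobd V d (climb \<rho>)" for \<rho> \<tau>
  proof -
    have tK: "\<tau> \<in> ksets V (Suc d)" and od: "odd (card {\<sigma>\<in>climb \<rho>. \<sigma> \<subseteq> \<tau>})" using t
        by (auto simp: cobd_def)
    then have "{\<sigma>\<in>climb \<rho>. \<sigma> \<subseteq> \<tau>} \<noteq> {}" by (metis card.empty even_zero)
    then obtain \<sigma> where s: "\<sigma> \<in> climb \<rho>" "\<sigma> \<subseteq> \<tau>" by blast
    have "\<tau> \<in> cobd V d A" if nb: "\<not> bad \<tau>"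
      using climb_faces_eq[OF tK nb _ s] r od tK by (simp add: Tm_def cobd_def)
    then show ?thesis using climb_sub[OF s(1)] s tK by blast
  qed
  have "\<Delta> = (\<Sum>\<rho>\<in>Tm. \<Sum>\<tau>\<in>cobd V d A \<union> ?B. if \<tau> \<in> cobd V d (climb \<rho>) then m \<tau> else 0)"
    unfolding \<Delta>_def
  proof (rule sum.cong[OF refl])
    fix \<rho> assume "\<rho> \<in> Tm"
    then have "(cobd V d A \<union> ?B) \<inter> {\<tau>. \<tau> \<in> cobd V d (climb \<rho>)} = cobd V d (climb \<rho>)" using in_cob
        by blast
    moreover have "finite (cobd V d A \<union> ?B)" using fK cobd_subset_ksets[of V d A] finite_subset
        by auto
    ultimately show "?N (cobd V d (climb \<rho>)) = (\<Sum>\<tau>\<in>cobd V d A \<union> ?B.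
        if \<tau> \<in> cobd V d (climb \<rho>) then m \<tau> else 0)"
      by (simp add: sum.If_cases)
  qed
  also have "\<dots> = (\<Sum>\<tau>\<in>cobd V d A \<union> ?B. \<Sum>\<rho>\<in>Tm. if \<tau> \<in> cobd V d (climb \<rho>) then m \<tau> else 0)"
      by (rule sum.swap)
  also have "\<dots> \<le> (\<Sum>\<tau>\<in>cobd V d A \<union> ?B. 2 ^ (d + 1) * m \<tau>)"
  proof (rule sum_mono)
    fix \<tau> assume "\<tau> \<in> cobd V d A \<union> ?B"
    then have t: "\<tau> \<in> ksets V (Suc d)" using cobd_subset_ksets[of V d A] by auto
    \<comment> \<open>A face is charged only by terminal faces contained in it, at most 2^(d+1) of
      them.\<close>
    have "Tm \<inter> {\<rho>. \<tau> \<in> cobd V d (climb \<rho>)} \<subseteq> Pow \<tau>" using in_cob by blast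
    then have "card (Tm \<inter> {\<rho>. \<tau> \<in> cobd V d (climb \<rho>)}) \<le> card (Pow \<tau>)"
      using ksets_finite[OF V t] by (intro card_mono) auto
    also have "\<dots> = 2 ^ (d + 1)" using t ksets_finite[OF V t] by (simp add: card_Pow ksets_def)
    finally have "real (card (Tm \<inter> {\<rho>. \<tau> \<in> cobd V d (climb \<rho>)})) \<le> 2 ^ (d + 1)"
      by (metis of_nat_le_iff of_nat_numeral of_nat_power)
    then have "real (card (Tm \<inter> {\<rho>. \<tau> \<in> cobd V d (climb \<rho>)})) * m \<tau> \<le> 2 ^ (d + 1) * m \<tau>" using m
        by (intro mult_right_mono)
    then show "(\<Sum>\<rho>\<in>Tm. if \<tau> \<in> cobd V d (climb \<rho>) then m \<tau> else 0) \<le> 2 ^ (d + 1) * m \<tau>"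
      using fTm by (simp add: sum.If_cases)
  qed
  also have "\<dots> = 2 ^ (d + 1) * ?N (cobd V d A \<union> ?B)" by (simp add: sum_distrib_left)
  also have "\<dots> \<le> 2 ^ (d + 1) * (?N (cobd V d A) + ?N ?B)"
  proof (rule mult_left_mono)
    have fin: "finite (cobd V d A)" "finite ?B" using fK cobd_subset_ksets[of V d A] finite_subset
        by auto
    show "?N (cobd V d A \<union> ?B) \<le> ?N (cobd V d A) + ?N ?B"
      using sum_Un[OF fin, of m] Nnn[of "cobd V d A \<inter> ?B"] by simp
  qed simp
  also have "\<dots> \<le> 2 ^ (d + 1) * (?N (cobd V d A) + a * k * real d ^ 2 * real (card A))"
    using bad_weight[OF m _ _ sparse] k a0 by (intro mult_left_mono add_left_mono) auto
  \<comment> \<open>The value of \<open>a\<close> makes the bad faces cost h k |A| / 2, at most half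
    of the sum \<open>\<Delta>\<close> being bounded, so they are absorbed on the left.\<close>
  also have "\<dots> = 2 ^ (d + 1) * ?N (cobd V d A) + h * k * real (card A) / 2"
    unfolding a using d0 by (simp add: field_simps)
  also have "\<dots> \<le> 2 ^ (d + 1) * ?N (cobd V d A) + \<Delta> / 2" using low by simp
  finally have up: "\<Delta> \<le> 2 ^ (d + 2) * ?N (cobd V d A)" by simp
  have "(\<Sum>\<sigma>\<in>A. ?N (star V d \<sigma>)) \<le> (\<Sum>\<sigma>\<in>(\<Union>\<rho>\<in>Tm. climb \<rho>). ?N (star V d \<sigma>))"
    using cover fTm fc Nnn by (intro sum_mono2) auto
  also have "\<dots> \<le> (\<Sum>\<rho>\<in>Tm. \<Sum>\<sigma>\<in>climb \<rho>. ?N (star V d \<sigma>))"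
    by (rule sum_UN_le) (use fTm fc Nnn in auto)
  also have "\<dots> \<le> (\<Sum>\<rho>\<in>Tm. (1 + (real d + 1) * C * Mx / h) * ?N (cobd V d (climb \<rho>)))"
    by (rule sum_mono) (use each in blast)
  also have "\<dots> = (1 + (real d + 1) * C * Mx / h) * \<Delta>" unfolding \<Delta>_def
      by (simp add: sum_distrib_left)
  also have "\<dots> \<le> (1 + (real d + 1) * C * Mx / h) * (2 ^ (d + 2) * ?N (cobd V d A))"
    using up C Mx0 h0 by (intro mult_left_mono) auto
  finally show ?thesis by (simp add: mult.assoc)
qed
end


section \<open>Tail bounds\<close>

lemma card_ksets_le:
  assumes "finite V" shows "card (ksets V q) \<le> card V ^ q"
  using assms by (cases "q \<le> card V") (auto simp: card_ksets binomial_le_pow binomial_eq_0)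

lemma card_supersets_le:
  assumes V: "finite V" and r: "\<rho> \<subseteq> V"
  shows "card {\<sigma>\<in>ksets V q. \<rho> \<subseteq> \<sigma>} \<le> card V ^ (q - card \<rho>)"
proof -
  have fr: "finite \<rho>" using V r finite_subset by auto
  have "card {\<sigma>\<in>ksets V q. \<rho> \<subseteq> \<sigma>} \<le> card (ksets V (q - card \<rho>))"
  proof (rule card_inj_on_le[where f="\<lambda>\<sigma>. \<sigma> - \<rho>"])
    show "inj_on (\<lambda>\<sigma>. \<sigma> - \<rho>) {\<sigma>\<in>ksets V q. \<rho> \<subseteq> \<sigma>}" by (auto simp: inj_on_def)
    show "(\<lambda>\<sigma>. \<sigma> - \<rho>) ` {\<sigma>\<in>ksets V q. \<rho> \<subseteq> \<sigma>} \<subseteq> ksets V (q - card \<rho>)"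
      using fr by (auto simp: ksets_def card_Diff_subset)
  qed (use V in auto)
  also have "\<dots> \<le> card V ^ (q - card \<rho>)" by (rule card_ksets_le[OF V])
  finally show ?thesis .
qed

text \<open>The left side is a single term in the expansion of (1 + x/n)^n. It is the usual estimate
  of a binomial coefficient by (e n / x)^x.\<close>

lemma binomial_mult_le_exp:
  assumes "0 < x" "x \<le> n"
  shows "real (n choose x) * (real x / real n) ^ x \<le> exp (real x)"
proof -
  have "real (n choose x) * (real x / real n) ^ x \<le>
      (\<Sum>i\<le>n. real (n choose i) * (real x / real n) ^ i * 1 ^ (n - i))"
    using member_le_sum[of x "{..n}" "\<lambda>i. real (n choose i) * (real x / real n) ^ i *
        1 ^ (n - i)"] assms by simp
  also have "\<dots> = (real x / real n + 1) ^ n" by (simp add: binomial_ring)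
  also have "\<dots> \<le> exp (real x / real n) ^ n" by (intro power_mono) (simp_all add: exp_ge_add_one_self
      add.commute)
  also have "\<dots> = exp (real x)" using assms by (simp add: exp_of_nat_mult[symmetric])
  finally show ?thesis .
qed

text \<open>The function x ln (n/x) increases up to x = n/e, so its minimum on the interval is ln n,
  at x = 1. It lets even one-element sets pay a power of n in
  \<open>prob_sparse_single\<close>.\<close>

lemma mult_ln_ratio_ge:
  assumes "1 \<le> x" "x * exp 1 \<le> (n::real)"
  shows "ln n \<le> x * ln (n / x)"
proof -
  have x: "0 < x" "0 < n" using assms by (auto intro: less_le_trans[of 0 "x * exp 1"])
  have l: "1 + ln x \<le> ln n" using ln_mono[OF assms(2)] x by (simp add: ln_mult)
  have "x * ln x \<le> (x - 1) * (1 + ln x)" using ln_le_minus_one[OF x(1)] by (simp add: algebra_simps)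
  also have "\<dots> \<le> (x - 1) * ln n" using l assms(1) by (intro mult_left_mono) auto
  finally show ?thesis using x by (simp add: ln_div algebra_simps)
qed

locale hypertree_sample =
  fixes n d k :: nat
  assumes d: "d \<ge> 1" and n: "n \<ge> d + 1" and k: "k \<ge> 1"
begin

abbreviation "V \<equiv> {1..n}"
abbreviation "P \<equiv> iid_determinantal_hypertrees n d k"
abbreviation "cnt T S \<equiv> real (face_count d k T S)"

sublocale P: prob_space P by (rule prob_space_iid[OF d n])

lemma prob_union_le:
  assumes I: "finite I" and b: "\<And>i. i \<in> I \<Longrightarrow> measure P {T\<in>space P. Q i T} \<le> b i"
  shows "measure P {T\<in>space P. \<exists>i\<in>I. Q i T} \<le> (\<Sum>i\<in>I. b i)"
proof -
  have "{T\<in>space P. \<exists>i\<in>I. Q i T} = (\<Union>i\<in>I. {T\<in>space P. Q i T})" by auto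
  then have "measure P {T\<in>space P. \<exists>i\<in>I. Q i T} \<le> (\<Sum>i\<in>I. measure P {T\<in>space P. Q i T})"
    using I by (simp only:) (intro P.finite_measure_subadditive_finite, auto intro!: sets_iid)
  also have "\<dots> \<le> (\<Sum>i\<in>I. b i)" by (rule sum_mono) (rule b)
  finally show ?thesis .
qed

lemma prob_mono:
  assumes "\<And>T. T \<in> space P \<Longrightarrow> Q T \<Longrightarrow> Q' T"
  shows "measure P {T\<in>space P. Q T} \<le> measure P {T\<in>space P. Q' T}"
  by (rule P.finite_measure_mono) (use assms in \<open>auto intro!: sets_iid\<close>)

lemma upper_tail:
  assumes S: "S \<subseteq> ksets V (Suc d)" and z: "z \<ge> 1" and s: "real (card S) \<le> s"
  shows "measure P {T\<in>space P. t \<le> cnt T S} \<le> exp (z * real k * (real d +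
      1) / real n * s) / z powr t"
proof -
  have "measure P {T\<in>space P. t \<le> cnt T S} \<le> measure P {T\<in>space P. z powr t \<le>
      z ^ face_count d k T S}"
  proof (rule prob_mono)
    fix T assume "t \<le> cnt T S"
    then have "z powr t \<le> z powr cnt T S" using z by (intro powr_mono) auto
    then show "z powr t \<le> z ^ face_count d k T S" using z by (simp add: powr_realpow)
  qed
  also have "\<dots> \<le> exp (real k * ((z - 1) * (real d + 1) / real n * real (card S))) / z powr t"
    by (rule face_count_tail[OF d n _ _ S]) (use z in auto)
  also have "\<dots> \<le> exp (z * real k * (real d + 1) / real n * s) / z powr t"
  proof (intro divide_right_mono, subst exp_le_cancel_iff)
    have "real k * ((z - 1) * (real d + 1) / real n * real (card S)) \<le>
        real k * (z * (real d + 1) / real n * s)"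
      using z s by (intro mult_left_mono mult_mono divide_right_mono mult_right_mono) auto
    then show "real k * ((z - 1) * (real d + 1) / real n * real (card S)) \<le>
        z * real k * (real d + 1) / real n * s"
      by (simp add: algebra_simps)
  qed simp
  finally show ?thesis .
qed

text \<open>The choice z = exp(-1), for which (exp(-1) - 1)(d + 1) is at most -1. The moment bound
  then has exponent at most -2t with t = k |S| / (2n), and Markov's inequality gives back t.\<close>

lemma lower_tail:
  assumes S: "S \<subseteq> ksets V (Suc d)"
  shows "measure P {T\<in>space P. 2 * real n * cnt T S < real k * real (card S)} \<le>
      exp (- (real k * real (card S) / (2 * real n)))"
proof -
  let ?t = "real k * real (card S) / (2 * real n)"
  have n0: "real n > 0" using n by simp
  have "measure P {T\<in>space P. 2 * real n * cnt T S < real k * real (card S)} \<le>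
    measure P {T\<in>space P. exp (- ?t) \<le> exp (-1) ^ face_count d k T S}"
  proof (rule prob_mono)
    fix T assume "2 * real n * cnt T S < real k * real (card S)"
    then have "cnt T S \<le> ?t" using n0 by (simp add: field_simps)
    then show "exp (- ?t) \<le> exp (-1) ^ face_count d k T S" by (simp add: exp_of_nat_mult[symmetric])
  qed
  also have "\<dots> \<le> exp (real k * ((exp (-1) - 1) * (real d +
      1) / real n * real (card S))) / exp (- ?t)"
    by (rule face_count_tail[OF d n _ _ S]) auto
  also have "\<dots> = exp (real k * ((exp (-1) - 1) * (real d + 1) / real n * real (card S)) + ?t)"
    by (simp add: exp_add exp_minus field_simps)
  also have "\<dots> \<le> exp (- ?t)"
  proof (subst exp_le_cancel_iff)
    have "2 \<le> exp (1::real)" using exp_ge_add_one_self[of 1] by simp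
    then have "exp (-1) - 1 \<le> - (1/2 :: real)" by (simp add: exp_minus field_simps)
    then have "(exp (-1) - 1) * (real d + 1) \<le> - (1/2) * (real d + 1)"
        by (intro mult_right_mono) auto
    also have "\<dots> \<le> -1" using d by simp
    finally have "(exp (-1) - 1) * (real d + 1) \<le> -1" .
    then have "(exp (-1) - 1) * (real d + 1) * (real k * real (card S) / real n) \<le>
        -1 * (real k * real (card S) / real n)"
      by (intro mult_right_mono) auto
    moreover have "real k * ((exp (-1) - 1) * (real d + 1) / real n * real (card S)) =
        (exp (-1) - 1) * (real d + 1) * (real k * real (card S) / real n)"
      by (simp add: field_simps)
    moreover have "real k * real (card S) / real n = 2 * ?t" by simp
    ultimately show "real k * ((exp (-1) - 1) * (real d + 1) / real n * real (card S)) + ?t \<le> - ?t"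
        by linarith
  qed
  finally show ?thesis .
qed

text \<open>With z = n a fixed face has multiplicity d + 3 with probability of order n^(-d-3),
  against at most n^(d+1) faces.\<close>

lemma prob_multiplicity:
  "measure P {T\<in>space P. \<exists>\<tau>\<in>ksets V (Suc d). real (d + 3) \<le> cnt T {\<tau>}} \<le>
      exp (real k * (real d + 1)) / real n ^ 2"
proof -
  have n0: "real n \<ge> 1" using n by simp
  have "measure P {T\<in>space P. \<exists>\<tau>\<in>ksets V (Suc d). real (d + 3) \<le> cnt T {\<tau>}} \<le>
     (\<Sum>\<tau>\<in>ksets V (Suc d). exp (real k * (real d + 1)) / real n ^ (d + 3))"
  proof (rule prob_union_le)
    fix \<tau> assume t: "\<tau> \<in> ksets V (Suc d)"
    have "measure P {T\<in>space P. real (d + 3) \<le> cnt T {\<tau>}} \<le>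
        exp (real n * real k * (real d + 1) / real n * 1) / real n powr real (d + 3)"
      by (rule upper_tail) (use t n0 in auto)
    also have "\<dots> = exp (real k * (real d + 1)) / real n ^ (d + 3)" using n0
        by (simp add: powr_realpow[symmetric])
    finally show "measure P {T\<in>space P. real (d + 3) \<le> cnt T {\<tau>}} \<le>
        exp (real k * (real d + 1)) / real n ^ (d + 3)" .
  qed simp
  also have "\<dots> = real (card (ksets V (Suc d))) * (exp (real k * (real d + 1)) / real n ^ (d + 3))"
      by simp
  also have "\<dots> \<le> real (n ^ Suc d) * (exp (real k * (real d + 1)) / real n ^ (d + 3))"
    using card_ksets_le[of V "Suc d"] by (intro mult_right_mono of_nat_mono) auto
  also have "\<dots> = exp (real k * (real d + 1)) / real n ^ 2"
    using n0 by (simp add: field_simps power_add eval_nat_numeral)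
  finally show ?thesis .
qed

definition pairs_over :: "nat set \<Rightarrow> nat set \<Rightarrow> nat set set" where
  "pairs_over \<psi> X = {\<tau>\<in>ksets V (Suc d). \<exists>x\<in>X. \<exists>y\<in>X. x \<noteq> y \<and> insert x (insert y \<psi>) \<subseteq> \<tau>}"

lemma card_pairs_over:
  assumes "\<psi> \<subseteq> V" "card \<psi> + Suc r = d" "X \<subseteq> V - \<psi>"
  shows "card (pairs_over \<psi> X) \<le> card X ^ 2 * n ^ r"
proof -
  have f: "finite \<psi>" "finite X" using finite_subset[OF assms(1)] finite_subset[OF assms(3)] by auto
  let ?I = "{(x,y)\<in>X \<times> X. x \<noteq> y}"
  have fI: "finite ?I" by (rule finite_subset[of _ "X \<times> X"]) (use f in auto)
  have "pairs_over \<psi> X \<subseteq> (\<Union>(x,y)\<in>?I. {\<tau>\<in>ksets V (Suc d). insert x (insert y \<psi>) \<subseteq> \<tau>})"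
    unfolding pairs_over_def by blast
  then have "card (pairs_over \<psi> X) \<le> card (\<Union>(x,y)\<in>?I. {\<tau>\<in>ksets V (Suc d). insert x (insert y \<psi>) \<subseteq>
      \<tau>})"
    using fI by (intro card_mono) auto
  also have "\<dots> \<le> (\<Sum>p\<in>?I. card (case p of (x,y) \<Rightarrow> {\<tau>\<in>ksets V (Suc d). insert x (insert y \<psi>) \<subseteq> \<tau>}))"
    by (rule card_UN_le[OF fI])
  also have "\<dots> \<le> (\<Sum>p\<in>?I. n ^ r)"
  proof (rule sum_mono)
    fix p assume "p \<in> ?I"
    then obtain x y where p: "p = (x,y)" "x \<in> X" "y \<in> X" "x \<noteq> y" by auto
    have sub: "insert x (insert y \<psi>) \<subseteq> V" using p assms by auto
    have "card (insert x (insert y \<psi>)) = card \<psi> + 2" using p f assms(3)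
        by (subst card_insert_disjoint) auto
    then have e: "Suc d - card (insert x (insert y \<psi>)) = r" using assms(2) by simp
    show "card (case p of (x,y) \<Rightarrow> {\<tau>\<in>ksets V (Suc d). insert x (insert y \<psi>) \<subseteq> \<tau>}) \<le> n ^ r"
      using card_supersets_le[OF _ sub, of "Suc d"] unfolding e p(1) by simp
  qed
  also have "\<dots> \<le> card (X \<times> X) * n ^ r"
  proof -
    have "card ?I \<le> card (X \<times> X)" using f by (intro card_mono) auto
    then have "card ?I * n ^ r \<le> card (X \<times> X) * n ^ r" by (rule mult_right_mono) simp
    then show ?thesis by (simp only: sum_constant of_nat_id)
  qed
  finally show ?thesis by (simp add: power2_eq_square card_cartesian_product)
qed

text \<open>A set \<open>X\<close> of x vertices gives at most x^2 n^r faces, hence an expected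
  count of order k n^(r-1) x^2, far below eta k n^r x when x/n is small. The tail must beat the
  number of choices of \<open>X\<close>, which is why the bound has the form of a reciprocal
  binomial coefficient.\<close>

lemma prob_sparse_single:
  fixes eta :: real
  assumes p: "\<psi> \<subseteq> V" "card \<psi> + Suc r = d" and X: "X \<subseteq> V - \<psi>" "X \<noteq> {}"
    and eta: "0 < eta" "eta \<le> 1" and ek: "2 * (real d + 4) \<le> eta * real k"
    and small: "real (card X) < (eta / (exp 1 * (real d + 1))) ^ 2 * real n"
  shows "measure P {T\<in>space P. eta * real k * real n ^ r * real (card X) < cnt T (pairs_over \<psi> X)}
     \<le> 1 / (real (n choose card X) * real n ^ (d + 2))"
proof -
  define x where "x = card X"
  define u where "u = real x / real n"
  define t where "t = eta * real k * real n ^ r * real x"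
  \<comment> \<open>The smallness threshold is s^2, so x/n < s^2 says that s exceeds the square root
    of u = x/n; half of the power of u gained below is spent on s.\<close>
  define s where "s = eta / (exp 1 * (real d + 1))"
  have fX: "finite X" using finite_subset[OF X(1)] by auto
  have x1: "x \<ge> 1" using X fX by (simp add: x_def Suc_le_eq card_gt_0_iff)
  have n0: "real n > 0" "real n \<ge> 1" using n by auto
  have xn: "x \<le> n" unfolding x_def using card_mono[of V X] X by auto
  have u0: "0 < u" using x1 n0 by (simp add: u_def)
  have s0: "0 < s" using eta by (simp add: s_def)
  have us: "u < s ^ 2" using small n0 by (simp add: u_def x_def s_def field_simps)
  have e2: "2 \<le> exp (1::real)" using exp_ge_add_one_self[of 1] by simp
  have s1: "s \<le> 1 / exp 1"
  proof -
    have "s \<le> 1 / (exp 1 * 1)" unfolding s_def using eta by (intro frac_le mult_left_mono) auto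
    then show ?thesis by simp
  qed
  have ie: "1 / exp 1 \<le> (1 / 2 :: real)" using e2 by (simp add: field_simps)
  have "s ^ 2 \<le> s * 1" unfolding power2_eq_square using s0 s1 ie
    by (intro mult_left_mono) linarith+
  then have ue: "u \<le> 1 / exp 1" using us s1 by simp
  \<comment> \<open>The value for which the exponent of the moment bound equals the threshold
    \<open>t\<close> itself. The tail is then (e/z)^t, at most u^(t/2).\<close>
  define z where "z = eta / ((real d + 1) * u)"
  have zs: "z = exp 1 * s / u" 
  proof -
    have "exp 1 * s = eta / (real d + 1)" unfolding s_def by simp
    then show ?thesis unfolding z_def by simp
  qed
  have su: "sqrt u \<le> s" using us s0 by (intro real_le_lsqrt) (auto simp: less_imp_le u0)
  have zge: "exp 1 / sqrt u \<le> z"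
  proof -
    have "sqrt u * sqrt u = u" "sqrt u \<noteq> 0" using u0 by auto
    then have "exp 1 / sqrt u = exp 1 * sqrt u / u" using u0 by (simp add: frac_eq_eq mult.assoc)
    also have "\<dots> \<le> exp 1 * s / u" using su u0 by (intro divide_right_mono mult_left_mono) auto
    finally show ?thesis unfolding zs .
  qed
  have u1: "u \<le> 1" using ue ie by linarith
  have su1: "0 < sqrt u" "sqrt u \<le> 1" using u0 u1 by auto
  have z1: "1 \<le> z"
  proof -
    have "sqrt u \<le> exp 1" using su1 e2 by linarith
    then have "1 \<le> exp 1 / sqrt u" using su1 by (simp add: pos_le_divide_eq)
    then show ?thesis using zge by simp
  qed
  have t0: "t \<ge> 0" unfolding t_def using eta by simp
  have "measure P {T\<in>space P. eta * real k * real n ^ r * real (card X) < cnt T (pairs_over \<psi> X)} \<le>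
     measure P {T\<in>space P. t \<le> cnt T (pairs_over \<psi> X)}"
    by (rule prob_mono) (simp add: t_def x_def)
  also have "\<dots> \<le> exp (z * real k * (real d + 1) / real n * (real x ^ 2 * real n ^ r)) / z powr t"
  proof (rule upper_tail)
    show "pairs_over \<psi> X \<subseteq> ksets V (Suc d)" by (auto simp: pairs_over_def)
    show "real (card (pairs_over \<psi> X)) \<le> real x ^ 2 * real n ^ r"
      using of_nat_mono[OF card_pairs_over[OF p X(1)], where 'a=real] by (simp add: x_def)
  qed (rule z1)
  also have "z * real k * (real d + 1) / real n * (real x ^ 2 * real n ^ r) = t"
  proof -
    have "z * (real d + 1) * u = eta" unfolding z_def using u0 by simp
    moreover have "z * real k * (real d + 1) / real n * (real x ^ 2 * real n ^ r) =
        (z * (real d + 1) * u) * real k * real n ^ r * real x"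
      unfolding u_def by (simp add: power2_eq_square)
    ultimately show ?thesis unfolding t_def by simp
  qed
  also have "exp t / z powr t \<le> exp t / (exp 1 / sqrt u) powr t"
    using zge su1 t0 z1 by (intro divide_left_mono powr_mono2 mult_pos_pos) auto
  also have "\<dots> = u powr (t / 2)"
  proof -
    have "(exp 1 / sqrt u) powr t = exp t / sqrt u powr t" using su1
        by (simp add: powr_divide exp_powr_real)
    moreover have "sqrt u powr t = u powr (t / 2)" using u0
        by (simp add: powr_half_sqrt[symmetric] powr_powr)
    ultimately show ?thesis using su1 by simp
  qed
  also have "\<dots> \<le> u powr ((real d + 4) * real x)"
  proof (rule powr_mono')
    have "(real d + 4) * real x \<le> eta * real k / 2 * real x" using ek
        by (intro mult_right_mono) auto
    also have "\<dots> \<le> eta * real k / 2 * real x * real n ^ r"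
      using mult_left_mono[OF one_le_power[OF n0(2), of r], of "eta * real k / 2 * real x"] eta
          by simp
    finally show "(real d + 4) * real x \<le> t / 2" unfolding t_def by (simp add: mult_ac)
  qed (use u0 u1 in auto)
  \<comment> \<open>Of the exponent (d + 4) x secured by the size of \<open>k\<close>, the share 2x
    pays for the choice of \<open>X\<close>, and (d + 2) x yields the factor n^(-d-2) through
    \<open>mult_ln_ratio_ge\<close>.\<close>
  also have "\<dots> = u powr (2 * real x) * u powr (real x * (real d + 2))"
    by (simp add: powr_add[symmetric] algebra_simps)
  also have "\<dots> \<le> 1 / real (n choose x) * (1 / real n ^ (d + 2))"
  proof (rule mult_mono)
    have C: "real (n choose x) > 0" using xn by simp
    have "real (n choose x) * u ^ x \<le> exp (real x)" unfolding u_def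
        by (rule binomial_mult_le_exp) (use x1 xn in auto)
    then have "real (n choose x) * u ^ x * u ^ x \<le> exp (real x) * u ^ x" using u0
        by (intro mult_right_mono) auto
    also have "exp (real x) * u ^ x = (exp 1 * u) ^ x"
        by (simp add: power_mult_distrib exp_of_nat_mult[symmetric])
    also have "\<dots> \<le> 1" using ue u0 by (intro power_le_one) (auto simp: field_simps)
    finally have "real (n choose x) * (u ^ x * u ^ x) \<le> 1" by (simp add: mult.assoc)
    moreover have "u powr (2 * real x) = u ^ x * u ^ x"
      using u0 by (simp add: powr_realpow[symmetric] powr_add[symmetric])
    ultimately show "u powr (2 * real x) \<le> 1 / real (n choose x)" using C by (simp add: field_simps)
    have "real x * exp 1 \<le> real n" using ue n0 by (simp add: u_def field_simps)
    then have "ln (real n) \<le> real x * ln (real n / real x)" using x1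
        by (intro mult_ln_ratio_ge) auto
    moreover have "ln (real n / real x) = - ln u" unfolding u_def using x1 n0 by (simp add: ln_div)
    ultimately have l: "real x * ln u \<le> - ln (real n)" by simp
    have "u powr (real x * (real d + 2)) = exp ((real d + 2) * (real x * ln u))"
      using u0 by (simp add: powr_def algebra_simps)
    also have "\<dots> \<le> exp ((real d + 2) * (- ln (real n)))" using l
        by (subst exp_le_cancel_iff, intro mult_left_mono) auto
    also have "\<dots> = 1 / real n ^ (d + 2)"
    proof -
      have "exp ((real d + 2) * (- ln (real n))) = 1 / (real n powr real (d + 2))"
      proof -
        have "(real d + 2) * (- ln (real n)) = - (real (d + 2) * ln (real n))" by simp
        moreover have "exp (- (real (d + 2) * ln (real n))) = 1 / exp (real (d + 2) * ln (real n))"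
          by (simp only: exp_minus inverse_eq_divide)
        ultimately show ?thesis using n0 unfolding powr_def by (simp only: of_nat_0_less_iff) simp
      qed
      then show ?thesis using n0 by (simp only: powr_realpow)
    qed
    finally show "u powr (real x * (real d + 2)) \<le> 1 / real n ^ (d + 2)" .
  qed (use u0 in auto)
  finally show ?thesis by (simp add: x_def)
qed
end


context hypertree_sample begin

text \<open>The sets \<open>X\<close> of one size cancel the binomial coefficient, the n sizes and
  at most n^d faces \<open>\<psi>\<close> cost n^(d+1), and 1/n remains for each of the d
  levels.\<close>

lemma prob_sparse:
  fixes eta eps :: "nat \<Rightarrow> real"
  assumes eta: "\<And>r. 0 < eta r \<and> eta r \<le> 1" and ek: "\<And>r. r < d \<Longrightarrow> 2 * (real d + 4) \<le> eta r * real k"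
    and eps: "\<And>r. eps r = (eta r / (exp 1 * (real d + 1))) ^ 2"
  shows "measure P {T\<in>space P. \<exists>r\<in>{..<d}. \<exists>\<psi>\<in>ksets V (d - Suc r). \<exists>x\<in>{1..n}. \<exists>X\<in>ksets V x.
      X \<subseteq> V - \<psi> \<and> real (card X) < eps r * real n \<and>
      eta r * real k * real n ^ r * real (card X) < cnt T (pairs_over \<psi> X)} \<le> real d / real n"
proof -
  have n0: "real n \<ge> 1" using n by simp
  have "measure P {T\<in>space P. \<exists>r\<in>{..<d}. \<exists>\<psi>\<in>ksets V (d - Suc r). \<exists>x\<in>{1..n}. \<exists>X\<in>ksets V x.
      X \<subseteq> V - \<psi> \<and> real (card X) < eps r * real n \<and>
      eta r * real k * real n ^ r * real (card X) < cnt T (pairs_over \<psi> X)}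
     \<le> (\<Sum>r\<in>{..<d}. \<Sum>\<psi>\<in>ksets V (d - Suc r). \<Sum>x\<in>{1..n}. \<Sum>X\<in>ksets V x. 1 / (real (n choose x) *
         real n ^ (d + 2)))"
  proof (intro prob_union_le)
    fix r \<psi> x X assume r: "r \<in> {..<d}" and p: "\<psi> \<in> ksets V (d - Suc r)" and x: "x \<in> {1..n}" and X:
        "X \<in> ksets V x"
    let ?Q = "X \<subseteq> V - \<psi> \<and> real (card X) < eps r * real n"
    show "measure P {T\<in>space P. X \<subseteq> V - \<psi> \<and> real (card X) < eps r * real n \<and>
      eta r * real k * real n ^ r * real (card X) < cnt T (pairs_over \<psi> X)} \<le>
          1 / (real (n choose x) * real n ^ (d + 2))"
    proof (cases ?Q)
      case True
      have pv: "\<psi> \<subseteq> V" "card \<psi> + Suc r = d" using p r by (auto simp: ksets_def)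
      have cx: "card X = x" using X by (simp add: ksets_def)
      have Xn: "X \<noteq> {}" using cx x by auto
      have "measure P {T\<in>space P. eta r * real k * real n ^ r *
          real (card X) < cnt T (pairs_over \<psi> X)}
         \<le> 1 / (real (n choose card X) * real n ^ (d + 2))"
        by (rule prob_sparse_single[OF pv _ Xn]) (use True eta[of r] ek[of r] r eps[of r] in auto)
      then show ?thesis using True cx by (simp only: simp_thms)
    next
      case False
      then have "{T\<in>space P. X \<subseteq> V - \<psi> \<and> real (card X) < eps r * real n \<and>
        eta r * real k * real n ^ r * real (card X) < cnt T (pairs_over \<psi> X)} = {}" by blast
      then show ?thesis by (simp only: measure_empty) simp
    qed
  qed auto
  also have "\<dots> \<le> (\<Sum>r\<in>{..<d}. 1 / real n)"
  proof (rule sum_mono)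
    fix r assume "r \<in> {..<d}"
    have "(\<Sum>x\<in>{1..n}. \<Sum>X\<in>ksets V x. 1 / (real (n choose x) * real n ^ (d + 2))) =
        (\<Sum>x\<in>{1..n}. 1 / real n ^ (d + 2))"
      by (intro sum.cong refl) (auto simp: card_ksets)
    also have "\<dots> = real n * (1 / real n ^ (d + 2))" by simp
    also have "\<dots> = 1 / real n ^ (d + 1)" using n0 by simp
    finally have inner: "(\<Sum>x\<in>{1..n}. \<Sum>X\<in>ksets V x. 1 / (real (n choose x) * real n ^ (d + 2))) =
        1 / real n ^ (d + 1)" .
    have "real (card (ksets V (d - Suc r))) \<le> real (n ^ (d - Suc r))"
      using card_ksets_le[of V "d - Suc r"] by (intro of_nat_mono) simp
    also have "\<dots> \<le> real n ^ d" using n0 by (simp add: power_increasing)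
    finally have "real (card (ksets V (d - Suc r))) * (1 / real n ^ (d + 1)) \<le>
        real n ^ d * (1 / real n ^ (d + 1))"
      by (intro mult_right_mono) auto
    also have "\<dots> = 1 / real n" using n0 by simp
    finally show "(\<Sum>\<psi>\<in>ksets V (d - Suc r). \<Sum>x\<in>{1..n}. \<Sum>X\<in>ksets V x. 1 / (real (n choose x) *
        real n ^ (d + 2))) \<le> 1 / real n"
      unfolding inner by simp
  qed
  also have "\<dots> = real d / real n" by simp
  finally show ?thesis .
qed

lemma sum_over_faces_le:
  fixes b :: real
  assumes "b \<ge> 0"
  shows "(\<Sum>r\<in>{1..d}. \<Sum>\<rho>\<in>ksets V (d - r). b) \<le> real d * real n ^ d * b"
proof -
  have n0: "real n \<ge> 1" using n by simp
  have "(\<Sum>r\<in>{1..d}. \<Sum>\<rho>\<in>ksets V (d - r). b) \<le> (\<Sum>r\<in>{1..d}. real n ^ d * b)"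
  proof (rule sum_mono)
    fix r
    have "real (card (ksets V (d - r))) \<le> real (n ^ (d - r))"
      using card_ksets_le[of V "d - r"] by (intro of_nat_mono) simp
    also have "\<dots> \<le> real n ^ d" using n0 by (simp add: power_increasing)
    finally show "(\<Sum>\<rho>\<in>ksets V (d - r). b) \<le> real n ^ d * b" using assms
        by (simp add: mult_right_mono)
  qed
  then show ?thesis by simp
qed

text \<open>Above a face of codimension r there are at most 2^(n^r) cochains. A coboundary of at
  least n^(r+1) / L faces fails with probability at most exp(-2 n^r) once k is at least 4L, which
  beats that number.\<close>

lemma prob_link:
  fixes L :: real
  assumes L: "L > 0" and kL: "4 * L \<le> real k"
  shows "measure P {T\<in>space P. \<exists>r\<in>{1..d}. \<exists>\<rho>\<in>ksets V (d - r). \<exists>G\<in>Pow {\<sigma>\<in>ksets V d. \<rho> \<subseteq> \<sigma>}.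
      real n ^ Suc r \<le> L * real (card (cobd V d G)) \<and>
      2 * real n * cnt T (cobd V d G) < real k * real (card (cobd V d G))} \<le>
          real d * real n ^ d * exp (- real n)"
proof -
  have n0: "real n \<ge> 1" using n by simp
  have "measure P {T\<in>space P. \<exists>r\<in>{1..d}. \<exists>\<rho>\<in>ksets V (d - r). \<exists>G\<in>Pow {\<sigma>\<in>ksets V d. \<rho> \<subseteq> \<sigma>}.
      real n ^ Suc r \<le> L * real (card (cobd V d G)) \<and>
      2 * real n * cnt T (cobd V d G) < real k * real (card (cobd V d G))}
    \<le> (\<Sum>r\<in>{1..d}. \<Sum>\<rho>\<in>ksets V (d - r). \<Sum>G\<in>Pow {\<sigma>\<in>ksets V d. \<rho> \<subseteq> \<sigma>}. exp (- 2 * real n ^ r))"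
  proof (intro prob_union_le)
    fix r \<rho> G
    let ?S = "cobd V d G"
    show "measure P {T\<in>space P. real n ^ Suc r \<le>
        L * real (card ?S) \<and> 2 * real n * cnt T ?S < real k * real (card ?S)} \<le>
        exp (- 2 * real n ^ r)"
    proof (cases "real n ^ Suc r \<le> L * real (card ?S)")
      case True
      have "measure P {T\<in>space P. 2 * real n * cnt T ?S < real k * real (card ?S)} \<le>
          exp (- (real k * real (card ?S) / (2 * real n)))"
        by (rule lower_tail[OF cobd_subset_ksets])
      also have "\<dots> \<le> exp (- 2 * real n ^ r)"
      proof -
        have "4 * real n ^ Suc r \<le> 4 * L * real (card ?S)" using True by simp
        also have "\<dots> \<le> real k * real (card ?S)" using kL by (intro mult_right_mono) auto
        finally have "2 * real n ^ r * (2 * real n) \<le> real k * real (card ?S)"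
            by (simp add: mult_ac)
        then show ?thesis using n0 by (simp add: pos_le_divide_eq)
      qed
      finally show ?thesis using True by (simp only: simp_thms)
    next
      case False
      then have "{T\<in>space P. real n ^ Suc r \<le> L * real (card ?S) \<and>
          2 * real n * cnt T ?S < real k * real (card ?S)} = {}" by blast
      then show ?thesis by (simp only: measure_empty) simp
    qed
  qed auto
  also have "\<dots> \<le> (\<Sum>r\<in>{1..d}. \<Sum>\<rho>\<in>ksets V (d - r). exp (- real n))"
  proof (intro sum_mono)
    fix r \<rho> assume r: "r \<in> {1..d}" and p: "\<rho> \<in> ksets V (d - r)"
    have pv: "\<rho> \<subseteq> V" "card \<rho> = d - r" using p by (auto simp: ksets_def)
    let ?F = "{\<sigma>\<in>ksets V d. \<rho> \<subseteq> \<sigma>}"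
    have cF: "card ?F \<le> n ^ r" using card_supersets_le[OF _ pv(1), of d] pv(2) r by simp
    have "real (card (Pow ?F)) = 2 ^ card ?F" by (simp add: card_Pow)
    also have "\<dots> \<le> 2 ^ (n ^ r)" using cF by (intro power_increasing) auto
    also have "\<dots> \<le> exp 1 ^ (n ^ r)" using exp_ge_add_one_self[of "1::real"]
        by (intro power_mono) auto
    also have "\<dots> = exp (real n ^ r)" by (simp add: exp_of_nat_mult[symmetric])
    finally have "real (card (Pow ?F)) * exp (- 2 * real n ^ r) \<le>
        exp (real n ^ r) * exp (- 2 * real n ^ r)"
      by (intro mult_right_mono) auto
    also have "\<dots> = exp (- (real n ^ r))" by (simp add: exp_add[symmetric])
    also have "\<dots> \<le> exp (- real n)" using n0 r power_increasing[of 1 r "real n"] by simp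
    finally show "(\<Sum>G\<in>Pow ?F. exp (- 2 * real n ^ r)) \<le> exp (- real n)" by simp
  qed
  also have "\<dots> \<le> real d * real n ^ d * exp (- real n)" by (rule sum_over_faces_le) simp
  finally show ?thesis .
qed

text \<open>With z = e the moment bound has exponent at most 3 (d + 1) k n^r; the constant 3d + 4
  exceeds this by k n^r, which is at least n.\<close>

lemma prob_degree:
  "measure P {T\<in>space P. \<exists>r\<in>{1..d}. \<exists>\<rho>\<in>ksets V (d - r).
      (3 * real d + 4) * real k * real n ^ r < cnt T (star V d \<rho>)} \<le>
          real d * real n ^ d * exp (- real n)"
proof -
  have n0: "real n \<ge> 1" using n by simp
  have "measure P {T\<in>space P. \<exists>r\<in>{1..d}. \<exists>\<rho>\<in>ksets V (d - r).
      (3 * real d + 4) * real k * real n ^ r < cnt T (star V d \<rho>)}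
    \<le> (\<Sum>r\<in>{1..d}. \<Sum>\<rho>\<in>ksets V (d - r). exp (- real n))"
  proof (intro prob_union_le)
    fix r \<rho> assume r: "r \<in> {1..d}" and p: "\<rho> \<in> ksets V (d - r)"
    have pv: "\<rho> \<subseteq> V" "card \<rho> = d - r" using p by (auto simp: ksets_def)
    let ?t = "(3 * real d + 4) * real k * real n ^ r"
    have "measure P {T\<in>space P. ?t < cnt T (star V d \<rho>)} \<le> measure P {T\<in>space P. ?t \<le>
        cnt T (star V d \<rho>)}"
      by (rule prob_mono) simp
    also have "\<dots> \<le> exp (exp 1 * real k * (real d + 1) / real n * real n ^ Suc r) / exp 1 powr ?t"
    proof (rule upper_tail)
      show "star V d \<rho> \<subseteq> ksets V (Suc d)" by (auto simp: star_def)
      have "card (star V d \<rho>) \<le> n ^ Suc r" using card_supersets_le[OF _ pv(1), of "Suc d"] pv(2) r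
          unfolding star_def
        by (simp add: Suc_diff_le)
      then show "real (card (star V d \<rho>)) \<le> real n ^ Suc r" by (metis of_nat_mono of_nat_power)
    qed (use exp_ge_add_one_self[of "1::real"] in simp)
    also have "\<dots> = exp (exp 1 * real k * (real d + 1) * real n ^ r - ?t)"
      using n0 by (simp add: powr_def exp_diff)
    also have "\<dots> \<le> exp (- real n)"
    proof (subst exp_le_cancel_iff)
      have k1: "real k \<ge> 1" using k by simp
      have nr: "real n \<le> real n ^ r" using n0 r power_increasing[of 1 r "real n"] by simp
      have e3: "exp 1 \<le> (3::real)" by (rule exp_le)
      have "exp 1 * real k * (real d + 1) * real n ^ r \<le> 3 * real k * (real d + 1) * real n ^ r"
        using e3 n0 by (intro mult_right_mono) auto
      moreover have "?t = 3 * real k * (real d + 1) * real n ^ r + real k * real n ^ r"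
          by (simp add: algebra_simps)
      moreover have "real n \<le> real k * real n ^ r" using mult_mono[OF k1 nr] n0 by simp
      ultimately show "exp 1 * real k * (real d + 1) * real n ^ r - ?t \<le> - real n" by linarith
    qed
    finally show "measure P {T\<in>space P. ?t < cnt T (star V d \<rho>)} \<le> exp (- real n)" .
  qed auto
  also have "\<dots> \<le> real d * real n ^ d * exp (- real n)" by (rule sum_over_faces_le) simp
  finally show ?thesis .
qed

end

text \<open>The clauses are, in order, multiplicity, sparseness, links and degrees; the last three
  are shaped as the hypotheses \<open>sparse\<close>, \<open>link\<close> and \<open>deg\<close> of
  \<open>fat_expansion\<close>.\<close>

definition good_sample :: "nat \<Rightarrow> nat \<Rightarrow> nat \<Rightarrow> (nat \<Rightarrow> real) \<Rightarrow> (nat \<Rightarrow> real) \<Rightarrow> real \<Rightarrow> (nat \<Rightarrow> nat set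
    set) \<Rightarrow> bool" where
  "good_sample n d k eta eps L T \<longleftrightarrow>
    (\<forall>\<tau>\<in>ksets {1..n} (Suc d). face_count d k T {\<tau>} \<le> d + 2) \<and>
    (\<forall>r<d. \<forall>\<psi>\<in>ksets {1..n} (d - Suc r). \<forall>X. X \<subseteq> {1..n} - \<psi> \<longrightarrow> X \<noteq> {} \<longrightarrow> real (card X) < eps r *
        real n \<longrightarrow>
      real (face_count d k T {\<tau>\<in>ksets {1..n} (Suc d). \<exists>x\<in>X. \<exists>y\<in>X. x \<noteq> y \<and>
          insert x (insert y \<psi>) \<subseteq> \<tau>})
       \<le> eta r * real k * real n ^ r * real (card X)) \<and>
    (\<forall>r\<in>{1..d}. \<forall>\<rho>\<in>ksets {1..n} (d - r). \<forall>G\<subseteq>{\<sigma>\<in>ksets {1..n} d. \<rho> \<subseteq> \<sigma>}.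
      real n ^ Suc r \<le> L * real (card (cobd {1..n} d G)) \<longrightarrow>
      real k * real (card (cobd {1..n} d G)) \<le> 2 * real n *
          real (face_count d k T (cobd {1..n} d G))) \<and>
    (\<forall>r\<in>{1..d}. \<forall>\<rho>\<in>ksets {1..n} (d - r).
      real (face_count d k T (star {1..n} d \<rho>)) \<le> (3 * real d + 4) * real k * real n ^ r)"

lemma (in hypertree_sample) prob_good_sample:
  fixes eta eps :: "nat \<Rightarrow> real"
  assumes eta: "\<And>r. 0 < eta r \<and> eta r \<le> 1" and ek: "\<And>r. r < d \<Longrightarrow> 2 * (real d + 4) \<le> eta r * real k"
    and eps: "\<And>r. eps r = (eta r / (exp 1 * (real d + 1))) ^ 2"
    and L: "L > 0" and kL: "4 * L \<le> real k"
  shows "1 - (exp (real k * (real d + 1)) / real n ^ 2 + real d / real n +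
      2 * (real d * real n ^ d * exp (- real n)))
     \<le> measure P {T\<in>space P. good_sample n d k eta eps L T}"
proof -
  let ?A = "{T\<in>space P. \<exists>\<tau>\<in>ksets V (Suc d). real (d + 3) \<le> cnt T {\<tau>}}"
  let ?B = "{T\<in>space P. \<exists>r\<in>{..<d}. \<exists>\<psi>\<in>ksets V (d - Suc r). \<exists>x\<in>{1..n}. \<exists>X\<in>ksets V x.
      X \<subseteq> V - \<psi> \<and> real (card X) < eps r * real n \<and>
      eta r * real k * real n ^ r * real (card X) < cnt T (pairs_over \<psi> X)}"
  let ?C = "{T\<in>space P. \<exists>r\<in>{1..d}. \<exists>\<rho>\<in>ksets V (d - r). \<exists>G\<in>Pow {\<sigma>\<in>ksets V d. \<rho> \<subseteq> \<sigma>}.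
      real n ^ Suc r \<le> L * real (card (cobd V d G)) \<and>
      2 * real n * cnt T (cobd V d G) < real k * real (card (cobd V d G))}"
  let ?D = "{T\<in>space P. \<exists>r\<in>{1..d}. \<exists>\<rho>\<in>ksets V (d - r).
      (3 * real d + 4) * real k * real n ^ r < cnt T (star V d \<rho>)}"
  have sub: "space P - {T\<in>space P. good_sample n d k eta eps L T} \<subseteq> (?A \<union> ?B) \<union> (?C \<union> ?D)"
  proof
    fix T assume T: "T \<in> space P - {T\<in>space P. good_sample n d k eta eps L T}"
    show "T \<in> (?A \<union> ?B) \<union> (?C \<union> ?D)"
    proof (rule ccontr)
      assume no: "T \<notin> (?A \<union> ?B) \<union> (?C \<union> ?D)"
      have TP: "T \<in> space P" using T by simp
      have A: "face_count d k T {\<tau>} \<le> d + 2" if "\<tau> \<in> ksets V (Suc d)" for \<tau>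
      proof -
        have "\<not> real (d + 3) \<le> cnt T {\<tau>}" using no TP that by blast
        then show ?thesis by linarith
      qed
      have B: "cnt T (pairs_over \<psi> X) \<le> eta r * real k * real n ^ r * real (card X)"
        if "r < d" "\<psi> \<in> ksets V (d - Suc r)" "X \<subseteq> V - \<psi>" "X \<noteq> {}" "real (card X) < eps r *
            real n" for r \<psi> X
      proof -
        have fX: "finite X" using finite_subset[OF that(3)] by simp
        have "card X \<le> card V" using that(3) by (intro card_mono) auto
        then have x: "card X \<in> {1..n}" using that(4) fX by (simp add: Suc_le_eq card_gt_0_iff)
        have "X \<in> ksets V (card X)" using that(3) by (auto simp: ksets_def)
        then have "\<not> eta r * real k * real n ^ r * real (card X) < cnt T (pairs_over \<psi> X)"
          using no TP that x by blast
        then show ?thesis by linarith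
      qed
      have C: "real k * real (card (cobd V d G)) \<le> 2 * real n * cnt T (cobd V d G)"
        if "r \<in> {1..d}" "\<rho> \<in> ksets V (d - r)" "G \<subseteq> {\<sigma>\<in>ksets V d. \<rho> \<subseteq> \<sigma>}" "real n ^ Suc r \<le>
            L * real (card (cobd V d G))" for r \<rho> G
      proof -
        have "\<not> 2 * real n * cnt T (cobd V d G) < real k * real (card (cobd V d G))"
            using no TP that by blast
        then show ?thesis by linarith
      qed
      have D: "cnt T (star V d \<rho>) \<le> (3 * real d + 4) * real k * real n ^ r"
          if "r \<in> {1..d}" "\<rho> \<in> ksets V (d - r)" for r \<rho>
      proof -
        have "\<not> (3 * real d + 4) * real k * real n ^ r < cnt T (star V d \<rho>)" using no TP that
            by blast
        then show ?thesis by linarith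
      qed
      have "good_sample n d k eta eps L T"
        unfolding good_sample_def
      proof (intro conjI ballI allI impI)
        fix \<tau> assume "\<tau> \<in> ksets V (Suc d)"
        then show "face_count d k T {\<tau>} \<le> d + 2" by (rule A)
      next
        fix r \<psi> X assume "r < d" "\<psi> \<in> ksets V (d - Suc r)" "X \<subseteq> V - \<psi>" "X \<noteq> {}" "real (card X) < eps
            r * real n"
        then show "cnt T {\<tau>\<in>ksets V (Suc d). \<exists>x\<in>X. \<exists>y\<in>X. x \<noteq> y \<and> insert x (insert y \<psi>) \<subseteq> \<tau>}
          \<le> eta r * real k * real n ^ r * real (card X)" by (rule B[unfolded pairs_over_def])
      next
        fix r \<rho> G assume "r \<in> {1..d}" "\<rho> \<in> ksets V (d - r)" "G \<subseteq> {\<sigma>\<in>ksets V d. \<rho> \<subseteq> \<sigma>}"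
          "real n ^ Suc r \<le> L * real (card (cobd V d G))"
        then show "real k * real (card (cobd V d G)) \<le> 2 * real n * cnt T (cobd V d G)" by (rule C)
      next
        fix r \<rho> assume "r \<in> {1..d}" "\<rho> \<in> ksets V (d - r)"
        then show "cnt T (star V d \<rho>) \<le> (3 * real d + 4) * real k * real n ^ r" by (rule D)
      qed
      then show False using T by blast
    qed
  qed
  have s: "X \<in> sets P" if "X \<subseteq> space P" for X using that by (rule sets_iid)
  have "1 - measure P {T\<in>space P. good_sample n d k eta eps L T} =
      measure P (space P - {T\<in>space P. good_sample n d k eta eps L T})"
    by (rule P.prob_compl[symmetric]) (rule s, auto)
  also have "\<dots> \<le> measure P ((?A \<union> ?B) \<union> (?C \<union> ?D))"
    by (rule P.finite_measure_mono[OF sub]) (rule s, blast)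
  also have "\<dots> \<le> measure P (?A \<union> ?B) + measure P (?C \<union> ?D)"
    by (rule measure_Un_le; rule s, blast)
  also have "\<dots> \<le> (measure P ?A + measure P ?B) + (measure P ?C + measure P ?D)"
    by (rule add_mono; rule measure_Un_le; rule s, blast)
  also have "\<dots> \<le> (exp (real k * (real d + 1)) / real n ^ 2 + real d / real n) +
      (real d * real n ^ d * exp (- real n) + real d * real n ^ d * exp (- real n))"
    by (intro add_mono prob_multiplicity prob_sparse[OF eta ek eps] prob_link[OF L kL] prob_degree)
  finally show ?thesis by simp
qed

lemma good_sample_whp:
  fixes eta eps :: "nat \<Rightarrow> real"
  assumes d: "d \<ge> 1" and k: "k \<ge> 1"
    and eta: "\<And>r. 0 < eta r \<and> eta r \<le> 1" and ek: "\<And>r. r < d \<Longrightarrow> 2 * (real d + 4) \<le> eta r * real k"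
    and eps: "\<And>r. eps r = (eta r / (exp 1 * (real d + 1))) ^ 2"
    and L: "L > 0" and kL: "4 * L \<le> real k"
  shows "(\<lambda>n. measure (iid_determinantal_hypertrees n d k)
     {T\<in>space (iid_determinantal_hypertrees n d k). good_sample n d k eta eps L T}) \<longlonglongrightarrow> 1"
proof (rule tendsto_sandwich)
  let ?c = "exp (real k * (real d + 1))"
  show "\<forall>\<^sub>F n in sequentially. 1 - (?c / real n ^ 2 + real d / real n +
      2 * (real d * real n ^ d * exp (- real n)))
     \<le> measure (iid_determinantal_hypertrees n d k) {T\<in>space (iid_determinantal_hypertrees n d k).
         good_sample n d k eta eps L T}"
  proof (rule eventually_sequentiallyI[of "d + 1"])
    fix n assume "d + 1 \<le> n"
    then interpret hypertree_sample n d k by unfold_locales (use d k in auto)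
    show "1 - (?c / real n ^ 2 + real d / real n + 2 * (real d * real n ^ d * exp (- real n))) \<le>
        measure P {T\<in>space P. good_sample n d k eta eps L T}"
      by (rule prob_good_sample[OF eta ek eps L kL])
  qed
  show "\<forall>\<^sub>F n in sequentially. measure (iid_determinantal_hypertrees n d k) {T\<in>space
      (iid_determinantal_hypertrees n d k). good_sample n d k eta eps L T} \<le> 1"
  proof (rule eventually_sequentiallyI[of "d + 1"])
    fix n assume "d + 1 \<le> n"
    then interpret hypertree_sample n d k by unfold_locales (use d k in auto)
    show "measure P {T\<in>space P. good_sample n d k eta eps L T} \<le> 1" by (rule P.prob_le_1)
  qed
  have e: "(\<lambda>n. real n ^ d * exp (- real n)) \<longlonglongrightarrow> 0"
  proof -
    have "((\<lambda>x::real. x ^ d / exp x) \<longlongrightarrow> 0) at_top" by (rule tendsto_power_div_exp_0)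
    then have "(\<lambda>n. real n ^ d / exp (real n)) \<longlonglongrightarrow> 0"
        by (rule filterlim_compose[OF _ filterlim_real_sequentially])
    then show ?thesis by (simp add: exp_minus field_simps)
  qed
  have i: "(\<lambda>n. c / real n) \<longlonglongrightarrow> 0" for c :: real by (rule lim_const_over_n)
  have "(\<lambda>n. ?c / real n ^ 2) \<longlonglongrightarrow> 0"
  proof -
    have "(\<lambda>n. ?c / real n * (1 / real n)) \<longlonglongrightarrow> 0 * 0" by (intro tendsto_mult i)
    then show ?thesis by (simp add: power2_eq_square)
  qed
  then have "(\<lambda>n. 1 - (?c / real n ^ 2 + real d / real n +
      2 * (real d * (real n ^ d * exp (- real n))))) \<longlonglongrightarrow> 1 - (0 + 0 + 2 * (real d * 0))"
    by (intro tendsto_intros i e)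
  then show "(\<lambda>n. 1 - (?c / real n ^ 2 + real d / real n +
      2 * (real d * real n ^ d * exp (- real n)))) \<longlonglongrightarrow> 1"
    by (simp add: mult.assoc)
qed simp


section \<open>Cochains as sets of faces\<close>

lemma odd_card_sym_diff:
  assumes "finite X" "finite Y"
  shows "odd (card (sym_diff X Y)) \<longleftrightarrow> (odd (card X) \<noteq> odd (card Y))"
proof -
  have "card (sym_diff X Y) + 2 * card (X \<inter> Y) = card X + card Y"
  proof -
    have "card (sym_diff X Y) = card (X - Y) + card (Y - X)" using assms
        by (intro card_Un_disjoint) auto
    moreover have "card (X - Y) + card (X \<inter> Y) = card X"
      using card_Diff_subset_Int[of X Y] card_mono[of X "X \<inter> Y"] assms by simp
    moreover have "card (Y - X) + card (X \<inter> Y) = card Y"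
      using card_Diff_subset_Int[of Y X] card_mono[of Y "Y \<inter> X"] assms by (simp add: Int_commute)
    ultimately show ?thesis by simp
  qed
  then show ?thesis by presburger
qed

lemma odd_card_odd:
  fixes g :: "'b \<Rightarrow> nat"
  assumes "finite F"
  shows "odd (card {\<sigma>\<in>F. odd (g \<sigma>)}) \<longleftrightarrow> odd (\<Sum>\<sigma>\<in>F. g \<sigma>)"
  using assms
proof (induction F rule: finite_induct)
  case (insert a F)
  have "{\<sigma>\<in>insert a F. odd (g \<sigma>)} = (if odd (g a) then insert a {\<sigma>\<in>F. odd (g \<sigma>)} else {\<sigma>\<in>F. odd (g
      \<sigma>)})" by auto
  then show ?case using insert by auto
qed simp

lemma bit_sum_nonzero_iff:
  fixes f :: "'b \<Rightarrow> bit"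
  assumes "finite F"
  shows "(\<Sum>\<sigma>\<in>F. f \<sigma>) \<noteq> 0 \<longleftrightarrow> odd (card {\<sigma>\<in>F. f \<sigma> \<noteq> 0})"
  using assms
proof (induction F rule: finite_induct)
  case (insert a F)
  have "{\<sigma>\<in>insert a F. f \<sigma> \<noteq> 0} = (if f a \<noteq> 0 then insert a {\<sigma>\<in>F. f \<sigma> \<noteq> 0} else {\<sigma>\<in>F. f \<sigma> \<noteq> 0})"
      by auto
  moreover have "x + y \<noteq> 0 \<longleftrightarrow> ((x \<noteq> 0) \<noteq> (y \<noteq> 0))" for x y :: bit by (cases x; cases y) auto
  ultimately show ?case using insert by auto
qed simp

lemma cobd_sym_diff:
  assumes V: "finite V" and ab: "a \<subseteq> ksets V q" "b \<subseteq> ksets V q"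
  shows "cobd V q (sym_diff a b) = sym_diff (cobd V q a) (cobd V q b)"
proof -
  have fin: "finite a" "finite b" using ab finite_subset[OF _ finite_ksets[OF V]] by blast+
  have "odd (card {\<sigma>\<in>sym_diff a b. \<sigma> \<subseteq> \<tau>}) \<longleftrightarrow> (odd (card {\<sigma>\<in>a. \<sigma> \<subseteq> \<tau>}) \<noteq> odd (card {\<sigma>\<in>b. \<sigma> \<subseteq> \<tau>}))"
      for \<tau>
  proof -
    have "{\<sigma>\<in>sym_diff a b. \<sigma> \<subseteq> \<tau>} = sym_diff {\<sigma>\<in>a. \<sigma> \<subseteq> \<tau>} {\<sigma>\<in>b. \<sigma> \<subseteq> \<tau>}" by blast
    then show ?thesis using odd_card_sym_diff[of "{\<sigma>\<in>a. \<sigma> \<subseteq> \<tau>}" "{\<sigma>\<in>b. \<sigma> \<subseteq> \<tau>}"] fin by simp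
  qed
  then show ?thesis unfolding cobd_def by blast
qed

text \<open>Between a face and a subface with two vertices fewer there are exactly two intermediate
  faces, so every contribution is even.\<close>

lemma cobd_cobd:
  assumes V: "finite V" and b: "b \<subseteq> ksets V q"
  shows "cobd V (Suc q) (cobd V q b) = {}"
proof -
  have fb: "finite b" using b finite_subset[OF _ finite_ksets[OF V]] by blast
  have "even (card {\<sigma>\<in>cobd V q b. \<sigma> \<subseteq> \<tau>})" if t: "\<tau> \<in> ksets V (Suc (Suc q))" for \<tau>
  proof -
    let ?F = "{\<sigma>\<in>ksets V (Suc q). \<sigma> \<subseteq> \<tau>}"
    have ft: "finite \<tau>" using ksets_finite[OF V t] .
    have fF: "finite ?F" using V by simp
    have "{\<sigma>\<in>cobd V q b. \<sigma> \<subseteq> \<tau>} = {\<sigma>\<in>?F. odd (card {\<omega>\<in>b. \<omega> \<subseteq> \<sigma>})}" unfolding cobd_def by blast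
    then have "odd (card {\<sigma>\<in>cobd V q b. \<sigma> \<subseteq> \<tau>}) \<longleftrightarrow> odd (\<Sum>\<sigma>\<in>?F. card {\<omega>\<in>b. \<omega> \<subseteq> \<sigma>})"
      using odd_card_odd[OF fF] by simp
    moreover have "(\<Sum>\<sigma>\<in>?F. card {\<omega>\<in>b. \<omega> \<subseteq> \<sigma>}) = (\<Sum>\<sigma>\<in>?F. \<Sum>\<omega>\<in>b. if \<omega> \<subseteq> \<sigma> then 1 else 0)"
      using fb by (intro sum.cong refl) (simp add: sum.If_cases Int_def)
    moreover have "\<dots> = (\<Sum>\<omega>\<in>b. \<Sum>\<sigma>\<in>?F. if \<omega> \<subseteq> \<sigma> then 1 else 0)" by (rule sum.swap)
    moreover have "even (\<Sum>\<omega>\<in>b. \<Sum>\<sigma>\<in>?F. if \<omega> \<subseteq> \<sigma> then 1 else (0::nat))"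
    proof (rule dvd_sum)
      fix \<omega> assume w: "\<omega> \<in> b"
      have wq: "card \<omega> = q" "\<omega> \<in> ksets V q" using w b by (auto simp: ksets_def)
      have "(\<Sum>\<sigma>\<in>?F. if \<omega> \<subseteq> \<sigma> then 1 else (0::nat)) = card {\<sigma>\<in>?F. \<omega> \<subseteq> \<sigma>}"
        using fF by (simp add: sum.If_cases Int_def)
      also have "even \<dots>"
      proof (cases "\<omega> \<subseteq> \<tau>")
        case False
        then have "{\<sigma>\<in>?F. \<omega> \<subseteq> \<sigma>} = {}" by blast
        then show ?thesis by (metis card.empty even_zero)
      next
        case True
        have "{\<sigma>\<in>?F. \<omega> \<subseteq> \<sigma>} = (\<lambda>x. insert x \<omega>) ` (\<tau> - \<omega>)"
        proof (rule equalityI; rule subsetI)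
          fix \<sigma> assume s: "\<sigma> \<in> {\<sigma>\<in>?F. \<omega> \<subseteq> \<sigma>}"
          then obtain x where "x \<in> \<sigma>" "x \<notin> \<omega>" "\<omega> = \<sigma> - {x}" using ksets_facet[OF V, of \<sigma> q \<omega>] wq
              by blast
          then show "\<sigma> \<in> (\<lambda>x. insert x \<omega>) ` (\<tau> - \<omega>)" using s by (intro image_eqI[of _ _ x]) auto
        next
          fix \<sigma> assume "\<sigma> \<in> (\<lambda>x. insert x \<omega>) ` (\<tau> - \<omega>)"
          then obtain x where x: "x \<in> \<tau> - \<omega>" "\<sigma> = insert x \<omega>" by blast
          have "x \<in> V" using x t by (auto simp: ksets_def)
          then show "\<sigma> \<in> {\<sigma>\<in>?F. \<omega> \<subseteq> \<sigma>}" using insert_ksets[OF V wq(2), of x] x True by auto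
        qed
        moreover have "inj_on (\<lambda>x. insert x \<omega>) (\<tau> - \<omega>)" by (auto simp: inj_on_def)
        ultimately have "card {\<sigma>\<in>?F. \<omega> \<subseteq> \<sigma>} = card (\<tau> - \<omega>)" by (simp add: card_image)
        also have "\<dots> = 2" using True wq t ft by (simp add: card_Diff_subset finite_subset ksets_def)
        finally show ?thesis by simp
      qed
      finally show "even (\<Sum>\<sigma>\<in>?F. if \<omega> \<subseteq> \<sigma> then 1 else (0::nat))" .
    qed
    ultimately show ?thesis by simp
  qed
  then show ?thesis unfolding cobd_def[of V "Suc q"] by blast
qed

lemma exists_minimal_representative:
  assumes V: "finite V" and A: "A \<subseteq> ksets V (Suc q)"
  shows "\<exists>b\<subseteq>ksets V q. cobd_minimal V q (sym_diff A (cobd V q b))"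
proof -
  let ?c = "\<lambda>b. card (sym_diff A (cobd V q b))"
  obtain b where b: "b \<subseteq> ksets V q" and min: "\<And>b'. b' \<subseteq> ksets V q \<Longrightarrow> ?c b \<le> ?c b'"
    using ex_has_least_nat[of "\<lambda>b. b \<subseteq> ksets V q" "{}" ?c] by blast
  have "cobd_minimal V q (sym_diff A (cobd V q b))"
    unfolding cobd_minimal_def
  proof (intro conjI allI impI)
    show "sym_diff A (cobd V q b) \<subseteq> ksets V (Suc q)" using A cobd_subset_ksets[of V q b] by blast
    fix b' assume b': "b' \<subseteq> ksets V q"
    have "sym_diff b b' \<subseteq> ksets V q" using b b' by blast
    then have "?c b \<le> ?c (sym_diff b b')" by (rule min)
    also have "sym_diff A (cobd V q (sym_diff b b')) =
        sym_diff (sym_diff A (cobd V q b)) (cobd V q b')"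
      unfolding cobd_sym_diff[OF V b b'] by blast
    finally show "?c b \<le> card (sym_diff (sym_diff A (cobd V q b)) (cobd V q b'))" .
  qed
  then show ?thesis using b by blast
qed

lemma face_count_sum:
  assumes "finite S"
  shows "face_count d k T S = (\<Sum>\<tau>\<in>S. face_count d k T {\<tau>})"
proof -
  have "card (X \<inter> S) = (\<Sum>\<tau>\<in>S. card (X \<inter> {\<tau>}))" for X :: "nat set set"
  proof -
    have "card (X \<inter> {\<tau>}) = (if \<tau> \<in> X then 1 else 0)" for \<tau> by auto
    then show ?thesis using assms by (simp add: sum.If_cases Int_commute Int_def conj_commute)
  qed
  then show ?thesis unfolding face_count_def by (simp only: sum.swap[of _ S])
qed

lemma card_supersets_ge:
  assumes V: "finite V" and s: "\<sigma> \<subseteq> V" "card \<sigma> \<le> q"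
  shows "(card V - card \<sigma>) choose (q - card \<sigma>) \<le> card {\<omega>\<in>ksets V q. \<sigma> \<subseteq> \<omega>}"
proof -
  have fs: "finite \<sigma>" using finite_subset[OF s(1) V] .
  have "(card V - card \<sigma>) choose (q - card \<sigma>) = card (ksets (V - \<sigma>) (q - card \<sigma>))"
    using V fs s by (simp add: card_ksets card_Diff_subset)
  also have "\<dots> \<le> card {\<omega>\<in>ksets V q. \<sigma> \<subseteq> \<omega>}"
  proof (rule card_inj_on_le[where f="\<lambda>\<omega>. \<omega> \<union> \<sigma>"])
    show "inj_on (\<lambda>\<omega>. \<omega> \<union> \<sigma>) (ksets (V - \<sigma>) (q - card \<sigma>))"
      by (rule inj_onI) (unfold ksets_def, blast)
    show "(\<lambda>\<omega>. \<omega> \<union> \<sigma>) ` ksets (V - \<sigma>) (q - card \<sigma>) \<subseteq> {\<omega>\<in>ksets V q. \<sigma> \<subseteq> \<omega>}"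
    proof
      fix x assume "x \<in> (\<lambda>\<omega>. \<omega> \<union> \<sigma>) ` ksets (V - \<sigma>) (q - card \<sigma>)"
      then obtain \<omega> where w: "\<omega> \<subseteq> V - \<sigma>" "card \<omega> = q - card \<sigma>" "x = \<omega> \<union> \<sigma>" by (auto simp: ksets_def)
      have "finite \<omega>" using finite_subset[OF w(1)] V by simp
      then have "card x = q" using w fs s(2) by (simp add: card_Un_disjoint disjoint_iff subset_iff)
      then show "x \<in> {\<omega>\<in>ksets V q. \<sigma> \<subseteq> \<omega>}" using w s(1) by (auto simp: ksets_def)
    qed
  qed (use V in simp)
  finally show ?thesis .
qed


section \<open>Cochains with values in two elements and their supports\<close>

definition csupp :: "('b \<Rightarrow> bit) \<Rightarrow> 'b set" where "csupp f = {\<sigma>. f \<sigma> \<noteq> 0}"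

definition cind :: "'b set \<Rightarrow> 'b \<Rightarrow> bit" where "cind A = (\<lambda>\<sigma>. if \<sigma> \<in> A then 1 else 0)"

lemma csupp_cind [simp]: "csupp (cind A) = A" unfolding csupp_def cind_def by auto

lemma csupp_inject: "csupp f = csupp g \<longleftrightarrow> f = g"
proof
  assume e: "csupp f = csupp g"
  show "f = g"
  proof
    fix x
    have "f x \<noteq> 0 \<longleftrightarrow> g x \<noteq> 0" using e unfolding csupp_def by blast
    then show "f x = g x" by (cases "f x"; cases "g x") auto
  qed
qed simp

lemma csupp_add: "csupp (\<lambda>\<sigma>. f \<sigma> + g \<sigma>) = sym_diff (csupp f) (csupp g)"
proof (rule Set.set_eqI)
  fix x
  have "f x + g x \<noteq> 0 \<longleftrightarrow> ((f x \<noteq> 0) \<noteq> (g x \<noteq> 0))" by (cases "f x"; cases "g x") auto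
  then show "x \<in> csupp (\<lambda>\<sigma>. f \<sigma> + g \<sigma>) \<longleftrightarrow> x \<in> sym_diff (csupp f) (csupp g)" unfolding csupp_def
      by blast
qed

lemma cochains_iff: "f \<in> cochains K i \<longleftrightarrow> csupp f \<subseteq> faces K i"
  unfolding cochains_def csupp_def by auto

lemma finite_cochains:
  assumes "finite (faces K i)"
  shows "finite (cochains K i)"
proof (rule finite_imageD[of csupp])
  show "finite (csupp ` cochains K i)"
    by (rule finite_subset[of _ "Pow (faces K i)"]) (use assms cochains_iff in auto)
  show "inj_on csupp (cochains K i)" by (rule inj_onI) (simp add: csupp_inject)
qed

lemma cochain_norm_eq:
  assumes "f \<in> cochains K i"
  shows "cochain_norm d K i f = (\<Sum>\<sigma>\<in>csupp f. face_weight d K i \<sigma>)"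
proof -
  have "{\<sigma>. \<sigma> \<in> faces K i \<and> f \<sigma> \<noteq> 0} = csupp f" using assms unfolding cochains_iff csupp_def by auto
  then show ?thesis unfolding cochain_norm_def by simp
qed

locale skeleton_complex =
  fixes n d :: nat and D :: "nat set set"
  assumes d: "d \<ge> 1" and n: "n \<ge> d + 1" and D: "D \<subseteq> ksets {1..n} (Suc d)"
begin

abbreviation "V \<equiv> {1..n}"
definition "K = complete_skeleton {1..n} (int d - 1) \<union> D"

lemma faces_low: assumes q: "q \<le> d" shows "faces K (int q - 1) = ksets V q"
proof (rule Set.set_eqI)
  fix \<sigma> :: "nat set"
  have fin: "finite \<sigma>" if "\<sigma> \<subseteq> V" using finite_subset[OF that] by simp
  have Dm: "card \<sigma> = Suc d" if "\<sigma> \<in> D" using that D by (auto simp: ksets_def)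
  show "\<sigma> \<in> faces K (int q - 1) \<longleftrightarrow> \<sigma> \<in> ksets V q"
    unfolding faces_def K_def complete_skeleton_def ksets_def using q fin Dm by (cases "\<sigma> \<in> D") auto
qed

lemma faces_top: "faces K (int d) = D"
  unfolding K_def by (rule faces_skeleton_union(1)[OF D])

lemma faces_Suc_subset: assumes "q \<le> d" shows "faces K (int q) \<subseteq> ksets V (Suc q)"
proof (cases "q = d")
  case True then show ?thesis using faces_top D by simp
next
  case False then show ?thesis using faces_low[of "Suc q"] assms by simp
qed

lemma coboundary_support:
  assumes q: "q \<le> d" and f: "f \<in> cochains K (int q - 1)"
  shows "csupp (coboundary K (int q - 1) f) = cobd V q (csupp f) \<inter> faces K (int q)"
proof (rule Set.set_eqI)
  fix \<tau>
  have i: "int q - 1 + 1 = int q" by simp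
  show "\<tau> \<in> csupp (coboundary K (int q - 1) f) \<longleftrightarrow> \<tau> \<in> cobd V q (csupp f) \<inter> faces K (int q)"
  proof (cases "\<tau> \<in> faces K (int q)")
    case False
    then show ?thesis unfolding csupp_def coboundary_def i by simp
  next
    case True
    let ?F = "{\<sigma>. \<sigma> \<in> faces K (int q - 1) \<and> \<sigma> \<subseteq> \<tau>}"
    have fF: "finite ?F" unfolding faces_low[OF q] by simp
    have "{\<sigma>\<in>?F. f \<sigma> \<noteq> 0} = {\<sigma>\<in>csupp f. \<sigma> \<subseteq> \<tau>}" using f unfolding cochains_iff csupp_def by auto
    then have "(\<Sum>\<sigma>\<in>?F. f \<sigma>) \<noteq> 0 \<longleftrightarrow> odd (card {\<sigma>\<in>csupp f. \<sigma> \<subseteq> \<tau>})"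
        using bit_sum_nonzero_iff[OF fF, of f] by simp
    moreover have "\<tau> \<in> ksets V (Suc q)" using True faces_Suc_subset[OF q] by blast
    moreover have "\<tau> \<in> csupp (coboundary K (int q - 1) f) \<longleftrightarrow> (\<Sum>\<sigma>\<in>?F. f \<sigma>) \<noteq> 0"
      unfolding csupp_def coboundary_def i using True by simp
    ultimately show ?thesis using True unfolding cobd_def by blast
  qed
qed

lemma coboundary_cochain: "coboundary K i f \<in> cochains K (i + 1)"
  unfolding cochains_def coboundary_def by simp

lemma coboundaries_iff:
  assumes q: "1 \<le> q" "q \<le> d"
  shows "b \<in> coboundaries K (int q - 1) \<longleftrightarrow> (\<exists>B\<subseteq>ksets V (q - 1). csupp b = cobd V (q - 1) B)"
proof -
  have i: "int q - 1 - 1 = int (q - 1) - 1" "int q - 1 = int (q - 1)" using q by auto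
  have q': "q - 1 \<le> d" using q by simp
  have Sq: "Suc (q - 1) = q" using q by simp
  have top: "faces K (int (q - 1)) = ksets V q" using faces_low[OF q(2)] unfolding i(2) .
  have sup: "csupp (coboundary K (int (q - 1) - 1) f) = cobd V (q - 1) (csupp f)"
      if "f \<in> cochains K (int (q - 1) - 1)" for f
    unfolding coboundary_support[OF q' that] top
        using cobd_subset_ksets[of V "q - 1" "csupp f", unfolded Sq] by blast
  show ?thesis
  proof
    assume "b \<in> coboundaries K (int q - 1)"
    then obtain f where f: "f \<in> cochains K (int (q - 1) - 1)" "b = coboundary K (int (q - 1) - 1) f"
      unfolding coboundaries_def i(1) by blast
    then show "\<exists>B\<subseteq>ksets V (q - 1). csupp b = cobd V (q - 1) B"
      using sup[OF f(1)] f(1) unfolding cochains_iff faces_low[OF q'] by blast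
  next
    assume "\<exists>B\<subseteq>ksets V (q - 1). csupp b = cobd V (q - 1) B"
    then obtain B where B: "B \<subseteq> ksets V (q - 1)" "csupp b = cobd V (q - 1) B" by blast
    have c: "cind B \<in> cochains K (int (q - 1) - 1)" unfolding cochains_iff faces_low[OF q'] using B
        by simp
    have "b = coboundary K (int (q - 1) - 1) (cind B)"
      unfolding csupp_inject[symmetric] sup[OF c] using B by simp
    then show "b \<in> coboundaries K (int q - 1)" unfolding coboundaries_def i(1) using c by blast
  qed
qed

text \<open>The coset norm is a minimum of weights, while minimality of \<open>A\<close> concerns
  cardinality. This suffices because \<open>A\<close> lies in the coset of \<open>f\<close>, so its
  weight bounds the coset norm from above, and it has the same coboundary as \<open>f\<close>.
  Positive face weights make the denominators positive.\<close>

lemma expansion_from_minimal: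
  fixes \<beta> :: real
  assumes b0: "\<beta> > 0"
    and pos: "\<And>q \<sigma>. 1 \<le> q \<Longrightarrow> q \<le> d \<Longrightarrow> \<sigma> \<in> ksets V q \<Longrightarrow> face_weight d K (int q - 1) \<sigma> > 0"
    and ineq: "\<And>q A. 1 \<le> q \<Longrightarrow> q \<le> d \<Longrightarrow> cobd_minimal V (q - 1) A \<Longrightarrow>
       \<beta> * (\<Sum>\<sigma>\<in>A. face_weight d K (int q - 1) \<sigma>) \<le>
           (\<Sum>\<tau>\<in>cobd V q A \<inter> faces K (int q). face_weight d K (int q) \<tau>)"
  shows "coboundary_expansion d K \<ge> \<beta>"
proof -
  have at: "\<beta> \<le> coboundary_expansion_at d K (int q - 1)" if q: "1 \<le> q" "q \<le> d" for q
  proof -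
    let ?i = "int q - 1"
    have i1: "?i + 1 = int q" by simp
    have fl: "faces K ?i = ksets V q" by (rule faces_low[OF q(2)])
    have Sq: "Suc (q - 1) = q" using q by simp
    have fV: "finite V" by simp
    have ffin: "finite (faces K ?i)" unfolding fl by simp
    have cob_sub: "coboundaries K ?i \<subseteq> cochains K ?i"
      unfolding coboundaries_def using coboundary_cochain[of "?i - 1"] by auto
    have fcob: "finite (coboundaries K ?i)" using finite_subset[OF cob_sub finite_cochains[OF ffin]]
        .
    have addc: "(\<lambda>\<sigma>. f \<sigma> + b \<sigma>) \<in> cochains K ?i"
        if "f \<in> cochains K ?i" "b \<in> coboundaries K ?i" for f b
      using that cob_sub unfolding cochains_def by auto
    have main: "\<beta> \<le> cochain_norm d K (?i + 1) (coboundary K ?i f) / coset_norm d K ?i f"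
      if f: "f \<in> cochains K ?i - coboundaries K ?i" for f
    proof -
      have fc: "f \<in> cochains K ?i" and fnb: "f \<notin> coboundaries K ?i" using f by auto
      let ?N = "{cochain_norm d K ?i (\<lambda>\<sigma>. f \<sigma> + b \<sigma>) | b. b \<in> coboundaries K ?i}"
      have Nim: "?N = (\<lambda>b. cochain_norm d K ?i (\<lambda>\<sigma>. f \<sigma> + b \<sigma>)) ` coboundaries K ?i" by blast
      have fN: "finite ?N" unfolding Nim using fcob by simp
      have fs: "csupp f \<subseteq> ksets V (Suc (q - 1))" using fc unfolding cochains_iff fl Sq .
      obtain B where B: "B \<subseteq> ksets V (q - 1)" "cobd_minimal V (q - 1) (sym_diff (csupp f) (cobd V (q
          - 1) B))"
        using exists_minimal_representative[OF fV fs] by blast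
      let ?b = "cind (cobd V (q - 1) B)"
      have b: "?b \<in> coboundaries K ?i" unfolding coboundaries_iff[OF q] using B
          by (intro exI[of _ B]) simp
      define A where "A = sym_diff (csupp f) (cobd V (q - 1) B)"
      have sA: "csupp (\<lambda>\<sigma>. f \<sigma> + ?b \<sigma>) = A" unfolding csupp_add A_def by simp
      have "coset_norm d K ?i f \<le> cochain_norm d K ?i (\<lambda>\<sigma>. f \<sigma> + ?b \<sigma>)"
        unfolding coset_norm_def by (rule Min_le[OF fN]) (use b in blast)
      also have "\<dots> = (\<Sum>\<sigma>\<in>A. face_weight d K ?i \<sigma>)" using cochain_norm_eq[OF addc[OF fc b]] sA
          by simp
      finally have up: "coset_norm d K ?i f \<le> (\<Sum>\<sigma>\<in>A. face_weight d K ?i \<sigma>)" .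
      have "cobd V q A = sym_diff (cobd V q (csupp f)) (cobd V q (cobd V (q - 1) B))"
        unfolding A_def by (rule cobd_sym_diff[OF fV]) (use fs cobd_subset_ksets[of V "q - 1" B] Sq
            in auto)
      also have "cobd V q (cobd V (q - 1) B) = {}" using cobd_cobd[OF fV B(1)] Sq by simp
      finally have cA: "cobd V q A = cobd V q (csupp f)" by simp
      have "cochain_norm d K (?i + 1) (coboundary K ?i f) =
          (\<Sum>\<tau>\<in>cobd V q A \<inter> faces K (int q). face_weight d K (int q) \<tau>)"
        using cochain_norm_eq[OF coboundary_cochain[of ?i f], of d]
        unfolding coboundary_support[OF q(2) fc] cA i1 .
      then have low: "\<beta> * (\<Sum>\<sigma>\<in>A. face_weight d K ?i \<sigma>) \<le>
          cochain_norm d K (?i + 1) (coboundary K ?i f)"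
        using ineq[OF q, of A] B(2) unfolding A_def by simp
      \<comment> \<open>The minimum is attained by a cochain that is not zero, since
        \<open>f\<close> is not a coboundary; so its weight is positive and the quotient can be
        handled by multiplication.\<close>
      have "coset_norm d K ?i f \<in> ?N" unfolding coset_norm_def
          by (rule Min_in[OF fN]) (use b in blast)
      then obtain b' where b': "b' \<in> coboundaries K ?i" "coset_norm d K ?i f =
          cochain_norm d K ?i (\<lambda>\<sigma>. f \<sigma> + b' \<sigma>)" by blast
      let ?g = "\<lambda>\<sigma>. f \<sigma> + b' \<sigma>"
      have gc: "?g \<in> cochains K ?i" by (rule addc[OF fc b'(1)])
      have "csupp ?g \<noteq> {}"
      proof
        assume "csupp ?g = {}"
        then have "csupp f = csupp b'" unfolding csupp_add by blast
        then show False using fnb b'(1) by (simp add: csupp_inject)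
      qed
      moreover have "finite (csupp ?g)" using finite_subset[OF _ ffin] gc unfolding cochains_iff
          by blast
      moreover have "face_weight d K ?i \<sigma> > 0" if "\<sigma> \<in> csupp ?g" for \<sigma>
        using pos[OF q] gc that unfolding cochains_iff fl by blast
      ultimately have "0 < (\<Sum>\<sigma>\<in>csupp ?g. face_weight d K ?i \<sigma>)" by (intro sum_pos) auto
      then have cpos: "coset_norm d K ?i f > 0" using b'(2) cochain_norm_eq[OF gc] by simp
      have "\<beta> * coset_norm d K ?i f \<le> cochain_norm d K (?i + 1) (coboundary K ?i f)"
        using order_trans[OF mult_left_mono[OF up less_imp_le[OF b0]] low] .
      then show ?thesis using cpos by (simp add: pos_le_divide_eq)
    qed
    let ?S = "{cochain_norm d K (?i + 1) (coboundary K ?i f) / coset_norm d K ?i f | f. f \<in> cochains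
        K ?i - coboundaries K ?i}"
    have Sim: "?S = (\<lambda>f. cochain_norm d K (?i +
        1) (coboundary K ?i f) / coset_norm d K ?i f) ` (cochains K ?i - coboundaries K ?i)"
        by blast
    have fS: "finite ?S" unfolding Sim using finite_cochains[OF ffin] by simp
    \<comment> \<open>The minimum of an empty set would be unspecified. The single face {1..q} is
      not a coboundary, as its own coboundary contains {1..q+1}.\<close>
    have "?S \<noteq> {}"
    proof -
      have "{1..q} \<in> ksets V q" using q n by (auto simp: ksets_def)
      moreover define \<sigma> where "\<sigma> = {1..q}"
      ultimately have s: "\<sigma> \<in> ksets V q" by simp
      have c: "cind {\<sigma>} \<in> cochains K ?i" unfolding cochains_iff fl using s by simp
      have "cind {\<sigma>} \<notin> coboundaries K ?i"
      proof
        assume "cind {\<sigma>} \<in> coboundaries K ?i"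
        then obtain B where B: "B \<subseteq> ksets V (q - 1)" "{\<sigma>} = cobd V (q - 1) B"
            unfolding coboundaries_iff[OF q] by auto
        have "cobd V q {\<sigma>} = {}" using cobd_cobd[OF fV B(1)] Sq B(2) by simp
        moreover have "insert (Suc q) \<sigma> \<in> cobd V q {\<sigma>}"
        proof -
          have "{\<kappa>\<in>{\<sigma>}. \<kappa> \<subseteq> insert (Suc q) \<sigma>} = {\<sigma>}" by auto
          then have "odd (card {\<kappa>\<in>{\<sigma>}. \<kappa> \<subseteq> insert (Suc q) \<sigma>})"
              by (metis card_1_singleton_iff One_nat_def odd_one)
          moreover have "insert (Suc q) \<sigma> \<in> ksets V (Suc q)"
            using insert_ksets[OF fV s, of "Suc q"] q n by (auto simp: \<sigma>_def)
          ultimately show ?thesis unfolding cobd_def by blast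
        qed
        ultimately show False by blast
      qed
      then show ?thesis unfolding Sim using c by blast
    qed
    then show ?thesis unfolding coboundary_expansion_at_def using fS main by (subst Min_ge_iff) auto
  qed
  have "\<beta> \<le> coboundary_expansion_at d K i" if i: "i \<in> {0..int d - 1}" for i
  proof -
    define q where "q = nat (i + 1)"
    have "1 \<le> q" "q \<le> d" "i = int q - 1" using i by (auto simp: q_def)
    then show ?thesis using at by simp
  qed
  then show ?thesis unfolding coboundary_expansion_def using d by (subst Min_ge_iff) auto
qed
end


section \<open>Expansion of the random complex\<close>

text \<open>\<open>fat_const d a r\<close> bounds \<open>n ^ r\<close> times the number of fat faces of codimension \<open>r\<close> in terms
  of \<open>card A\<close>; the threshold for the next level is taken so small that bad faces of that level
  cost at most the fraction \<open>a\<close> of \<open>card A\<close>, up to a power of \<open>d\<close>.\<close>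

primrec fat_const :: "nat \<Rightarrow> real \<Rightarrow> nat \<Rightarrow> real" where
  "fat_const d a 0 = 1"
| "fat_const d a (Suc r) = fat_const d a r * real d / (a / fat_const d a r / (exp 1 * (real d +
    1))) ^ 2"

lemma fat_const_ge:
  assumes d: "d \<ge> 1" and a: "0 < a" "a \<le> 1"
  shows "1 \<le> fat_const d a r" "fat_const d a r \<le> fat_const d a (Suc r)"
proof -
  have step: "fat_const d a r \<le> fat_const d a (Suc r)" if M: "1 \<le> fat_const d a r" for r
  proof -
    let ?e = "a / fat_const d a r / (exp 1 * (real d + 1))"
    have "1 * 1 \<le> exp 1 * (real d + 1)" using exp_ge_add_one_self[of "1::real"]
        by (intro mult_mono) auto
    moreover have "a / fat_const d a r \<le> 1" using M a by (simp add: divide_le_eq)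
    ultimately have "?e \<le> 1 / 1" by (intro frac_le) auto
    then have "?e \<le> 1" by simp
    moreover have e0: "0 < ?e" using a M by (auto intro!: divide_pos_pos mult_pos_pos)
    ultimately have "?e ^ 2 \<le> 1" by (simp add: power_le_one)
    also have "1 \<le> real d" using d by simp
    finally have "?e ^ 2 \<le> real d" .
    then have "fat_const d a r * ?e ^ 2 \<le> fat_const d a r * real d" using M
        by (intro mult_left_mono) auto
    then show ?thesis unfolding fat_const.simps pos_le_divide_eq[OF zero_less_power[OF e0]] .
  qed
  show ge: "1 \<le> fat_const d a r"
  proof (induction r)
    case (Suc r) then show ?case using step[OF Suc.IH] by linarith
  qed simp
  show "fat_const d a r \<le> fat_const d a (Suc r)" by (rule step[OF ge])
qed

definition link_const :: "nat \<Rightarrow> real" where "link_const d = 1 / (4 * (real d + 1))"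

definition bad_const :: "nat \<Rightarrow> real" where "bad_const d = link_const d / (2 ^ (d + 2) * real d ^ 2)"

abbreviation "fatM d \<equiv> fat_const d (bad_const d)"

text \<open>The division by \<open>fatM d r\<close> is the one that cancels against the number of
  fat faces in \<open>bad_weight\<close>.\<close>

definition sparse_bound :: "nat \<Rightarrow> nat \<Rightarrow> real" where "sparse_bound d r = bad_const d / fatM d r"

text \<open>The square is the smallness condition of \<open>prob_sparse_single\<close>.\<close>

definition fat_eps :: "nat \<Rightarrow> nat \<Rightarrow> real" where
  "fat_eps d r = (sparse_bound d r / (exp 1 * (real d + 1))) ^ 2"

text \<open>The constant of \<open>fat_expansion\<close> with the degree constant 3d + 4
  inserted.\<close>

definition top_const :: "nat \<Rightarrow> real" where
  "top_const d = (1 + (real d + 1) * (3 * real d + 4) * fatM d d / link_const d) * 2 ^ (d + 2)"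

text \<open>Losses below top dimension: one d + 1 from the complete complex, (d + 1)(d + 2) from
  counting degrees through ridges with multiplicity, 2^(d+1) from the binomial normalisation, (2d)^d
  from n^r against a binomial coefficient, and 3d + 4 from the degree bound.\<close>

definition low_const :: "nat \<Rightarrow> real" where
  "low_const d = (real d + 1) ^ 2 * (real d + 2) * 2 ^ (d + 1) * (2 * real d) ^ d * (3 * real d +
      4)"

text \<open>Independent of \<open>k\<close>, because degrees are bounded above and below by
  multiples of the same \<open>k\<close>. The factor d + 2 removes multiplicities.\<close>

definition expansion_const :: "nat \<Rightarrow> real" where
  "expansion_const d = min (1 / (top_const d * (real d + 2))) (1 / low_const d)"

context
  fixes d :: nat
  assumes d: "d \<ge> 1"
begin

lemma bad_const_bounds: "0 < bad_const d" "bad_const d \<le> 1"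
proof -
  show "0 < bad_const d" using d by (simp add: bad_const_def link_const_def)
  have "1 \<le> (2::real) ^ (d + 2)" by (rule one_le_power) simp
  moreover have "1 \<le> real d ^ 2" by (rule one_le_power) (use d in simp)
  ultimately have "1 * 1 \<le> (2::real) ^ (d + 2) * real d ^ 2" by (rule mult_mono) auto
  moreover have "link_const d \<le> 1" by (simp add: link_const_def divide_le_eq)
  ultimately show "bad_const d \<le> 1" unfolding bad_const_def by (simp add: divide_le_eq)
qed

lemmas fatM_ge = fat_const_ge[OF d bad_const_bounds]

lemma fatM_le: "r \<le> d \<Longrightarrow> fatM d r \<le> fatM d d"
  by (rule lift_Suc_mono_le[of "fatM d"]) (rule fatM_ge(2))

lemma sparse_bound_bounds: "0 < sparse_bound d r \<and> sparse_bound d r \<le> 1"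
  using bad_const_bounds fatM_ge(1)[of r] by (simp add: sparse_bound_def divide_le_eq)

lemma fat_eps_pos: "0 < fat_eps d r"
  using sparse_bound_bounds[of r] unfolding fat_eps_def
  by (intro zero_less_power divide_pos_pos mult_pos_pos) auto

lemma top_const_pos: "0 < top_const d"
  unfolding top_const_def using fatM_ge(1)[of d]
  by (intro mult_pos_pos add_pos_nonneg divide_nonneg_nonneg mult_nonneg_nonneg) (auto simp:
      link_const_def)

lemma low_const_pos: "0 < low_const d"
  unfolding low_const_def using d by simp

lemma expansion_const_pos: "0 < expansion_const d"
  unfolding expansion_const_def using top_const_pos low_const_pos by simp

lemma good_sample_expansion:
  assumes n2: "n \<ge> 2 * d + 2" and k: "k \<ge> 1" and T: "\<And>j. j \<in> {1..k} \<Longrightarrow> hypertree n d (T j)"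
    and good: "good_sample n d k (sparse_bound d) (fat_eps d) (2 * (real d + 1) * fatM d d) T"
  shows "coboundary_expansion d (hypertree_union n d k T) \<ge> expansion_const d"
proof -
  define D where "D = (\<Union>j\<in>{1..k}. faces (T j) (int d))"
  have n': "n \<ge> d + 1" using n2 by simp
  have DK: "D \<subseteq> ksets {1..n} (Suc d)" unfolding D_def using hypertree_decompose(2)[OF T] by blast
  note good1 = good[unfolded good_sample_def, THEN conjunct1, rule_format]
    and good2 = good[unfolded good_sample_def, THEN conjunct2, THEN conjunct1, rule_format]
    and good3 = good[unfolded good_sample_def, THEN conjunct2, THEN conjunct2, THEN conjunct1,
        rule_format]
    and good4 = good[unfolded good_sample_def, THEN conjunct2, THEN conjunct2, THEN conjunct2,
        rule_format]
  interpret skeleton_complex n d D by unfold_locales (use d n' DK in auto)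
  have Keq: "hypertree_union n d k T = K" unfolding hypertree_union_def K_def unfolding D_def ..
  have fV: "finite V" and cV: "card V = n" by auto
  have fK: "finite (ksets V q)" for q by simp
  have fD: "finite D" using finite_subset[OF DK fK] .
  \<comment> \<open>The multiplicity of a face among the trees; it is at least 1 on
    \<open>D\<close>, 0 elsewhere and at most d + 2, so it is comparable with counting faces of the
    union.\<close>
  define m where "m \<tau> = real (face_count d k T {\<tau>})" for \<tau>
  have m0: "m \<tau> \<ge> 0" for \<tau> by (simp add: m_def)
  have N: "sum m S = real (face_count d k T S)" if "S \<subseteq> ksets V (Suc d)" for S
    unfolding m_def using face_count_sum[OF finite_subset[OF that fK], of d k T] by simp
  have mD: "1 \<le> m \<tau>" if t: "\<tau> \<in> D" for \<tau>
  proof -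
    obtain j where j: "j \<in> {1..k}" "\<tau> \<in> faces (T j) (int d)" using t by (auto simp: D_def)
    then have "faces (T j) (int d) \<inter> {\<tau>} = {\<tau>}" by blast
    then have "1 \<le> card (faces (T j) (int d) \<inter> {\<tau>})" by simp
    also have "\<dots> \<le> face_count d k T {\<tau>}" unfolding face_count_def
        by (rule member_le_sum) (use j in auto)
    finally show ?thesis by (simp add: m_def)
  qed
  have mnD: "m \<tau> = 0" if t: "\<tau> \<notin> D" for \<tau>
  proof -
    have "faces (T j) (int d) \<inter> {\<tau>} = {}" if "j \<in> {1..k}" for j using t that by (auto simp: D_def)
    then show ?thesis by (simp add: m_def face_count_def)
  qed
  have mle: "m \<tau> \<le> real d + 2" if "\<tau> \<in> ksets V (Suc d)" for \<tau>
  proof -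
    show ?thesis using good1[OF that] by (simp add: m_def)
  qed
  have card_le_N: "real (card (S \<inter> D)) \<le> sum m S" if S: "S \<subseteq> ksets V (Suc d)" for S
  proof -
    have "real (card (S \<inter> D)) = (\<Sum>\<tau>\<in>S \<inter> D. 1)" by simp
    also have "\<dots> \<le> sum m (S \<inter> D)" using mD by (intro sum_mono) auto
    also have "\<dots> \<le> sum m S" using finite_subset[OF S fK] m0 by (intro sum_mono2) auto
    finally show ?thesis .
  qed
  have N_le_card: "sum m S \<le> (real d + 2) * real (card (S \<inter> D))" if S: "S \<subseteq> ksets V (Suc d)" for S
  proof -
    have "sum m S = sum m (S \<inter> D)" using finite_subset[OF S fK] mnD
        by (intro sum.mono_neutral_right) auto
    also have "\<dots> \<le> (\<Sum>\<tau>\<in>S \<inter> D. real d + 2)" using mle S by (intro sum_mono) auto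
    finally show ?thesis by (simp add: mult.commute)
  qed
  have starK: "star V d \<sigma> \<subseteq> ksets V (Suc d)" for \<sigma> by (auto simp: star_def)
  have degD: "{\<tau> \<in> faces K (int d). \<sigma> \<subseteq> \<tau>} = star V d \<sigma> \<inter> D" for \<sigma>
    unfolding faces_top star_def using DK by blast
  define deg where "deg \<sigma> = real (card (star V d \<sigma> \<inter> D))" for \<sigma>
  have deg_le: "deg \<sigma> \<le> sum m (star V d \<sigma>)" for \<sigma> unfolding deg_def by (rule card_le_N[OF starK])
  have le_deg: "sum m (star V d \<sigma>) \<le> (real d + 2) * deg \<sigma>" for \<sigma> unfolding deg_def
      by (rule N_le_card[OF starK])
  have weight: "face_weight d K (int q - 1) \<sigma> =
      deg \<sigma> / (real ((d + 1) choose q) * real (card D))" for q \<sigma>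
    unfolding face_weight_def degD unfolding deg_def faces_top by simp
  have ridge: "real k \<le> sum m (star V d \<sigma>)" if s: "\<sigma> \<in> ksets V d" for \<sigma>
  proof -
    have "(\<Sum>j\<in>{1..k}. 1) \<le> (\<Sum>j\<in>{1..k}. card (faces (T j) (int d) \<inter> star V d \<sigma>))"
    proof (rule sum_mono)
      fix j assume j: "j \<in> {1..k}"
      obtain \<tau> where t: "\<tau> \<in> faces (T j) (int d)" "\<sigma> \<subseteq> \<tau>"
          using hypertree_covers_ridge[OF d n' T[OF j] s] by blast
      then have "\<tau> \<in> faces (T j) (int d) \<inter> star V d \<sigma>" using hypertree_decompose(2)[OF T[OF j]]
          by (auto simp: star_def)
      moreover have "finite (faces (T j) (int d) \<inter> star V d \<sigma>)" using finite_subset[OF starK fK]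
          by blast
      ultimately show "1 \<le> card (faces (T j) (int d) \<inter> star V d \<sigma>)"
          by (metis One_nat_def Suc_leI card_gt_0_iff empty_iff)
    qed
    then have "k \<le> face_count d k T (star V d \<sigma>)" by (simp add: face_count_def)
    then show ?thesis unfolding N[OF starK] by simp
  qed
  \<comment> \<open>Lower degree bound for every face: each ridge above it carries \<open>k\<close>
    faces with multiplicity, a face is counted by at most d + 1 ridges, and multiplicities are at
    most d + 2.\<close>
  have star_lower: "real ((n - p) choose (d - p)) * real k \<le> (real d + 1) * (real d + 2) * deg \<sigma>"
    if s: "\<sigma> \<in> ksets V p" and p: "p \<le> d" for p \<sigma>
  proof -
    let ?G = "{\<omega>\<in>ksets V d. \<sigma> \<subseteq> \<omega>}"
    have sV: "\<sigma> \<subseteq> V" "card \<sigma> = p" using s by (auto simp: ksets_def)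
    have "real ((n - p) choose (d - p)) * real k \<le> real (card ?G) * real k"
      using card_supersets_ge[OF fV sV(1), of d] p unfolding sV(2) cV
          by (intro mult_right_mono) auto
    also have "\<dots> = (\<Sum>\<omega>\<in>?G. real k)" by simp
    also have "\<dots> \<le> (\<Sum>\<omega>\<in>?G. sum m (star V d \<omega>))" by (rule sum_mono) (use ridge in blast)
    also have "\<dots> \<le> (real d + 1) * sum m (star V d \<sigma>)" by (rule sum_star_le[OF fV m0]) auto
    also have "\<dots> \<le> (real d + 1) * ((real d + 2) * deg \<sigma>)" using le_deg
        by (intro mult_left_mono) auto
    finally show ?thesis by (simp add: mult.assoc)
  qed
  have deg_pos: "0 < deg \<sigma>" if s: "\<sigma> \<in> ksets V p" and p: "p \<le> d" for p \<sigma>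
  proof -
    have "0 < (n - p) choose (d - p)" using n2 p by simp
    then have "0 < real ((n - p) choose (d - p)) * real k" using k by simp
    then have "0 < (real d + 1) * (real d + 2) * deg \<sigma>" using star_lower[OF s p] by linarith
    then have "deg \<sigma> \<noteq> 0" by auto
    moreover have "0 \<le> deg \<sigma>" by (simp add: deg_def)
    ultimately show ?thesis by linarith
  qed
  have Dpos: "0 < real (card D)"
  proof -
    have "{1..d} \<in> ksets V d" using n2 by (auto simp: ksets_def)
    then have "0 < deg {1..d}" by (rule deg_pos) simp
    then have "star V d {1..d} \<inter> D \<noteq> {}" by (auto simp: deg_def)
    then show ?thesis using fD by (auto simp: card_gt_0_iff)
  qed
  have pos: "face_weight d K (int q - 1) \<sigma> > 0" if "1 \<le> q" "q \<le> d" "\<sigma> \<in> ksets V q" for q \<sigma>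
    unfolding weight using deg_pos[OF that(3,2)] Dpos that by simp
  have ineq: "expansion_const d * (\<Sum>\<sigma>\<in>A. face_weight d K (int q - 1) \<sigma>) \<le>
      (\<Sum>\<tau>\<in>cobd V q A \<inter> faces K (int q). face_weight d K (int q) \<tau>)"
    if q: "1 \<le> q" "q \<le> d" and min: "cobd_minimal V (q - 1) A" for q A
  proof -
    have Sq: "Suc (q - 1) = q" using q by simp
    have AK: "A \<subseteq> ksets V q" using min unfolding cobd_minimal_def Sq by simp
    have b0: "0 \<le> expansion_const d" using expansion_const_pos by simp
    have weight': "face_weight d K (int q) \<tau> = deg \<tau> / (real ((d +
        1) choose Suc q) * real (card D))" for \<tau>
      using weight[of "Suc q" \<tau>] by simp
    show ?thesis
    proof (cases "q = d")
      case True
      interpret fat_faces_const V d A "fat_eps d" "fatM d"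
      proof unfold_locales
        show "A \<subseteq> ksets V d" using AK True by simp
        show "fatM d (Suc r) * fat_eps d r = fatM d r * real d" for r
          using fat_eps_pos[of r] unfolding fat_eps_def sparse_bound_def by simp
        show "fatM d r > 0" for r using fatM_ge(1)[of r] by simp
      qed (use fat_eps_pos in auto)
      have main: "(\<Sum>\<sigma>\<in>A. sum m (star V d \<sigma>)) \<le> (1 + (real d + 1) * (3 * real d +
          4) * fatM d d / link_const d) * 2 ^ (d + 2) * sum m (cobd V d A)"
      proof (rule fat_expansion[where k="real k" and a="bad_const d" and d'="d - 1"])
        show "d = Suc (d - 1)" using d by simp
        show "cobd_minimal V (d - 1) A" using min True by simp
        show "2 * d \<le> card V" "card V > 0" using n2 by auto
        show "real k > 0" using k by simp
        show "link_const d = 1 / (4 * (real d + 1))" by (rule link_const_def)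
        show "bad_const d = link_const d / (2 ^ (d + 2) * (real d)\<^sup>2)" by (rule bad_const_def)
        show "real k \<le> sum m (star V d \<sigma>)" if "\<sigma> \<in> ksets V d" for \<sigma> by (rule ridge[OF that])
      next
        fix \<psi> r X assume a: "\<psi> \<subseteq> V" "card \<psi> + Suc r =
            d" "X \<subseteq> V - \<psi>" "X \<noteq> {}" "real (card X) < fat_eps d r * real (card V)"
        have "r < d" "\<psi> \<in> ksets V (d - Suc r)" using a by (auto simp: ksets_def)
        then have "real (face_count d k T {\<tau>\<in>ksets V (Suc d). \<exists>x\<in>X. \<exists>y\<in>X. x \<noteq> y \<and>
            insert x (insert y \<psi>) \<subseteq> \<tau>}) \<le> sparse_bound d r * real k * real n ^ r * real (card X)"
          by (rule good2[OF _ _ a(3,4) a(5)[unfolded cV]])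
        then show "sum m {\<tau>\<in>ksets V (Suc d). \<exists>x\<in>X. \<exists>y\<in>X. x \<noteq> y \<and> insert x (insert y \<psi>) \<subseteq> \<tau>} \<le>
            bad_const d / fatM d r * real k * real (card V) ^ r * real (card X)"
          unfolding cV sparse_bound_def by (subst N) auto
      next
        fix \<rho> r G assume a: "\<rho> \<subseteq> V" "card \<rho> + r = d" "r > 0" "G \<subseteq> {\<sigma>\<in>ksets V d. \<rho> \<subseteq> \<sigma>}"
          "real (card V) ^ Suc r \<le> 2 * (real d + 1) * fatM d d * real (card (cobd V d G))"
        have "r \<in> {1..d}" "\<rho> \<in> ksets V (d - r)" using a by (auto simp: ksets_def)
        then have "real k * real (card (cobd V d G)) \<le>
            2 * real n * real (face_count d k T (cobd V d G))"
          by (rule good3[OF _ _ a(4) a(5)[unfolded cV]])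
        then show "real k * real (card (cobd V d G)) \<le> 2 * real (card V) * sum m (cobd V d G)"
          unfolding cV N[OF cobd_subset_ksets] .
      next
        fix \<rho> r assume a: "\<rho> \<subseteq> V" "card \<rho> + r = d" "r > 0"
        have "r \<in> {1..d}" "\<rho> \<in> ksets V (d - r)" using a by (auto simp: ksets_def)
        then have "real (face_count d k T (star V d \<rho>)) \<le> (3 * real d + 4) * real k * real n ^ r"
          by (rule good4)
        then show "sum m (star V d \<rho>) \<le> (3 * real d + 4) * real k * real (card V) ^ r"
          unfolding cV N[OF starK] .
      qed (use m0 fatM_le in auto)
      let ?C = "cobd V d A \<inter> D"
      have "(\<Sum>\<sigma>\<in>A. deg \<sigma>) \<le> (\<Sum>\<sigma>\<in>A. sum m (star V d \<sigma>))" by (rule sum_mono) (rule deg_le)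
      also have "\<dots> \<le> top_const d * sum m (cobd V d A)" using main unfolding top_const_def .
      also have "\<dots> \<le> top_const d * ((real d + 2) * real (card ?C))"
        using N_le_card[OF cobd_subset_ksets] top_const_pos by (intro mult_left_mono) auto
      finally have sum_deg: "(\<Sum>\<sigma>\<in>A. deg \<sigma>) \<le> top_const d * (real d + 2) * real (card ?C)"
          by (simp only: mult.assoc)
      have "expansion_const d * (\<Sum>\<sigma>\<in>A. deg \<sigma>) \<le> real (card ?C)"
      proof -
        have "expansion_const d * (\<Sum>\<sigma>\<in>A. deg \<sigma>) \<le>
            1 / (top_const d * (real d + 2)) * (top_const d * (real d + 2) * real (card ?C))"
          using sum_deg b0 top_const_pos by (intro mult_mono) (auto simp: expansion_const_def
              deg_def intro!: sum_nonneg)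
        then show ?thesis using top_const_pos by simp
      qed
      then have "expansion_const d * (\<Sum>\<sigma>\<in>A. deg \<sigma>) / real (card D) \<le> real (card ?C) / real (card D)"
        by (rule divide_right_mono) simp
      moreover have "expansion_const d * (\<Sum>\<sigma>\<in>A. face_weight d K (int q - 1) \<sigma>) \<le>
          expansion_const d * (\<Sum>\<sigma>\<in>A. deg \<sigma>) / real (card D)"
      proof -
        have "face_weight d K (int q - 1) \<sigma> \<le> deg \<sigma> / real (card D)" for \<sigma>
          unfolding weight True using Dpos by (intro divide_left_mono) (auto simp: deg_def)
        then have "(\<Sum>\<sigma>\<in>A. face_weight d K (int q - 1) \<sigma>) \<le> (\<Sum>\<sigma>\<in>A. deg \<sigma> / real (card D))"
            by (intro sum_mono)
        then show ?thesis using b0 by (simp add: sum_divide_distrib[symmetric] mult_left_mono flip: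
            times_divide_eq_right)
      qed
      moreover have "(\<Sum>\<tau>\<in>cobd V q A \<inter> faces K (int q). face_weight d K (int q) \<tau>) =
          real (card ?C) / real (card D)"
      proof -
        \<comment> \<open>A top face lies in no top face but itself, and its binomial normalisation
          is 1.\<close>
        have "face_weight d K (int q) \<tau> = 1 / real (card D)" if t: "\<tau> \<in> ?C" for \<tau>
        proof -
          have tc: "\<tau> \<in> ksets V (Suc d)" "\<tau> \<in> D" using t DK by auto
          have "star V d \<tau> \<inter> D = {\<tau>}"
          proof -
            have "\<tau>' = \<tau>" if "\<tau>' \<in> ksets V (Suc d)" "\<tau> \<subseteq> \<tau>'" for \<tau>'
              using card_subset_eq[OF ksets_finite[OF fV that(1)] that(2)] that tc
                  by (simp add: ksets_def)
            then show ?thesis unfolding star_def using tc by blast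
          qed
          then show ?thesis unfolding weight' unfolding True deg_def by simp
        qed
        then show ?thesis unfolding True faces_top by simp
      qed
      ultimately show ?thesis by linarith
    next
      \<comment> \<open>Below top dimension the coboundary takes place in the complete skeleton, so
        the expansion of the full simplex applies directly. It remains to compare weights: a face
        with q vertices weighs at most a constant times k n^(r+1) / |D|, one with q + 1 vertices at
        least a constant times k n^r / |D|.\<close>
      case False
      then have qd: "q < d" using q by simp
      define r where "r = d - q - 1"
      have r: "d - q = Suc r" using qd by (simp add: r_def)
      have fq: "faces K (int q) = ksets V (Suc q)" using faces_low[of "Suc q"] qd by simp
      have Cint: "cobd V q A \<inter> faces K (int q) = cobd V q A" unfolding fq
          using cobd_subset_ksets[of V q A] by blast
      let ?c = "real (card (cobd V q A))" and ?a = "real (card A)" and ?D = "real (card D)"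
      have n0: "real n > 0" using n2 by simp
      have "n * card A \<le> Suc q * card (cobd V q A)"
        using minimal_cobd_expansion[OF fV min, of "{}"] unfolding Sq by simp
      also have "\<dots> \<le> (d + 1) * card (cobd V q A)" using qd by (intro mult_right_mono) auto
      finally have "real (n * card A) \<le> real ((d + 1) * card (cobd V q A))" by (rule of_nat_mono)
      then have e1: "real n * ?a \<le> (real d + 1) * ?c" by (simp add: algebra_simps)
      have up: "face_weight d K (int q - 1) \<sigma> \<le> (3 * real d + 4) * real k * real n ^ Suc r / ?D"
          if s: "\<sigma> \<in> A" for \<sigma>
      proof -
        have "d - Suc r = q" "Suc r \<in> {1..d}" using r qd by auto
        then have "Suc r \<in> {1..d}" "\<sigma> \<in> ksets V (d - Suc r)" using s AK by auto
        then have "real (face_count d k T (star V d \<sigma>)) \<le>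
            (3 * real d + 4) * real k * real n ^ Suc r"
          by (rule good4)
        then have "deg \<sigma> \<le> (3 * real d + 4) * real k * real n ^ Suc r"
            using deg_le[of \<sigma>] unfolding N[OF starK] by linarith
        moreover have "1 * ?D \<le> real ((d + 1) choose q) * ?D" using q
            by (intro mult_right_mono) (auto simp: Suc_le_eq)
        ultimately show ?thesis unfolding weight using Dpos by (intro frac_le) auto
      qed
      \<comment> \<open>For r > 0 the binomial coefficient in \<open>star_lower\<close> is at least
        ((n - q - 1) / r)^r, and n - q - 1 is at least n/2 by the size of n; the case r = 0 is
        separate because of the division by r.\<close>
      have low: "real k * real n ^ r / ((2 * real d) ^ d * ((real d + 1) * (real d + 2)) * (2 ^ (d +
          1) * ?D)) \<le> face_weight d K (int q) \<tau>"
        if t: "\<tau> \<in> cobd V q A" for \<tau>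
      proof -
        have tK: "\<tau> \<in> ksets V (Suc q)" using t cobd_subset_ksets[of V q A] by blast
        have "(real n / (2 * real d)) ^ r \<le> (real (n - Suc q) / real r) ^ r"
        proof (cases "r = 0")
          case False
          have "real n / (2 * real d) = (real n / 2) / real d" by simp
          also have "\<dots> \<le> real (n - Suc q) / real r"
          proof (rule frac_le)
            show "real n / 2 \<le> real (n - Suc q)" using n2 qd by (simp add: of_nat_diff)
            show "real r \<le> real d" by (simp add: r_def)
          qed (use False in auto)
          finally show ?thesis by (intro power_mono) auto
        qed simp
        also have "\<dots> \<le> real ((n - Suc q) choose r)"
        proof -
          have "r \<le> n - Suc q" using n2 qd by (simp add: r_def)
          then show ?thesis using binomial_ge_n_over_k_pow_k[of r "n - Suc q", where 'a=real]
              by simp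
        qed
        finally have "(real n / (2 * real d)) ^ r \<le> real ((n - Suc q) choose r)" .
        moreover have "real n ^ r / (2 * real d) ^ d \<le> (real n / (2 * real d)) ^ r"
        proof -
          have "(2 * real d) ^ r \<le> (2 * real d) ^ d" using d
              by (intro power_increasing) (auto simp: r_def)
          moreover have "0 < (2 * real d) ^ r" using d by simp
          ultimately have "real n ^ r / (2 * real d) ^ d \<le> real n ^ r / (2 * real d) ^ r" using d
              by (intro divide_left_mono) auto
          then show ?thesis by (simp add: power_divide)
        qed
        ultimately have "real n ^ r / (2 * real d) ^ d * real k \<le>
            real ((n - Suc q) choose r) * real k"
          by (intro mult_right_mono) auto
        also have "\<dots> \<le> (real d + 1) * (real d + 2) * deg \<tau>"
        proof -
          have "d - Suc q = r" by (simp add: r_def)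
          then show ?thesis using star_lower[OF tK] qd by simp
        qed
        finally have X: "real n ^ r / (2 * real d) ^ d * real k \<le>
            (real d + 1) * (real d + 2) * deg \<tau>" .
        have p: "0 < (real d + 1) * (real d + 2)" by simp
        have Y: "real n ^ r / (2 * real d) ^ d * real k / ((real d + 1) * (real d + 2)) \<le> deg \<tau>"
          unfolding pos_divide_le_eq[OF p] mult.commute[of "deg \<tau>"] by (rule X)
        have "real n ^ r / (2 * real d) ^ d * real k / ((real d + 1) * (real d + 2)) / (2 ^ (d +
            1) * ?D) \<le> deg \<tau> / (real ((d + 1) choose Suc q) * ?D)"
        proof (rule frac_le[OF _ Y])
          have "(d + 1) choose Suc q \<le> 2 ^ (d + 1)" by (rule binomial_le_pow2)
          then have "real ((d + 1) choose Suc q) \<le> 2 ^ (d + 1)"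
              by (metis of_nat_le_iff of_nat_numeral of_nat_power)
          then show "real ((d + 1) choose Suc q) * ?D \<le> 2 ^ (d + 1) * ?D"
              by (intro mult_right_mono) auto
          have "0 < (d + 1) choose Suc q" using qd by simp
          then have "0 < real ((d + 1) choose Suc q)" by (simp only: of_nat_0_less_iff)
          then show "0 < real ((d + 1) choose Suc q) * ?D" using Dpos by (rule mult_pos_pos)
        qed (simp add: deg_def)
        then show ?thesis unfolding weight' by (simp add: mult.assoc mult.commute[of "real k"])
      qed
      let ?B = "(2 * real d) ^ d * ((real d + 1) * (real d + 2)) * (2 ^ (d + 1) * ?D)"
      have B0: "0 < ?B" using d Dpos by simp
      have "expansion_const d * (\<Sum>\<sigma>\<in>A. face_weight d K (int q - 1) \<sigma>) \<le>
          1 / low_const d * (?a * ((3 * real d + 4) * real k * real n ^ Suc r / ?D))"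
      proof (rule mult_mono)
        show "expansion_const d \<le> 1 / low_const d" by (simp add: expansion_const_def)
        show "(\<Sum>\<sigma>\<in>A. face_weight d K (int q - 1) \<sigma>) \<le>
            ?a * ((3 * real d + 4) * real k * real n ^ Suc r / ?D)"
          using sum_mono[of A "face_weight d K (int q - 1)" "\<lambda>_. (3 * real d +
              4) * real k * real n ^ Suc r / ?D", OF up] by simp
        show "0 \<le> (\<Sum>\<sigma>\<in>A. face_weight d K (int q - 1) \<sigma>)"
            by (rule sum_nonneg) (simp add: face_weight_def)
        show "0 \<le> 1 / low_const d" using low_const_pos by simp
      qed
      also have "\<dots> = (real n * ?a) / (real d + 1) * (real k * real n ^ r / ?B)"
      proof -
        have aux: "1 / (p ^ 2 * s * t * u * c) * (a * (c * k * (n * nr) / D)) =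
            (n * a) / p * (k * nr / (u * (p * s) * (t * D)))"
          if "p \<noteq> 0" "s \<noteq> 0" "t \<noteq> 0" "u \<noteq> 0" "c \<noteq> 0" "D \<noteq> 0" for p s t u c a k n nr D :: real
          using that by (simp add: field_simps power2_eq_square)
        show ?thesis unfolding low_const_def power_Suc[of "real n" r]
            by (rule aux) (use d Dpos in auto)
      qed
      also have "\<dots> \<le> ?c * (real k * real n ^ r / ?B)"
        using e1 B0 n0 by (intro mult_right_mono) (auto simp: pos_divide_le_eq mult.commute)
      also have "\<dots> = (\<Sum>\<tau>\<in>cobd V q A. real k * real n ^ r / ?B)" by simp
      also have "\<dots> \<le> (\<Sum>\<tau>\<in>cobd V q A. face_weight d K (int q) \<tau>)" by (rule sum_mono) (rule low)
      finally show ?thesis unfolding Cint .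
    qed
  qed
  show ?thesis unfolding Keq by (rule expansion_from_minimal[OF expansion_const_pos pos ineq])
qed

end

theorem theorem1:
  fixes d :: nat
  assumes "d \<ge> 1"
  shows "\<exists>(k\<^sub>d :: nat) (\<beta> :: real). \<beta> > 0 \<and>
    (\<forall>k \<ge> k\<^sub>d.
       (\<lambda>n. measure (iid_determinantal_hypertrees n d k)
              {T \<in> space (iid_determinantal_hypertrees n d k).
                 coboundary_expansion d (hypertree_union n d k T) \<ge> \<beta>})
         \<longlonglongrightarrow> 1)"
proof -
  let ?L = "2 * (real d + 1) * fatM d d"
  \<comment> \<open>The first summand secures 4L at most k for the link bound, the second makes
    \<open>sparse_bound d r * k\<close> large enough at every level r < d; adding them gives both at
    once.\<close>
  define k0 where "k0 = nat \<lceil>4 * ?L + 2 * (real d + 4) * fatM d d / bad_const d\<rceil> + 1"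
  note d = assms
  have M1: "fatM d d \<ge> 1" by (rule fatM_ge(1)[OF d])
  have a0: "bad_const d > 0" by (rule bad_const_bounds(1)[OF d])
  have L0: "?L > 0" using M1 by simp
  show ?thesis
  proof (intro exI[of _ k0] exI[of _ "expansion_const d"] conjI allI impI)
    show "expansion_const d > 0" by (rule expansion_const_pos[OF d])
    fix k assume kk: "k \<ge> k0"
    have kr: "4 * ?L + 2 * (real d + 4) * fatM d d / bad_const d \<le> real k"
    proof -
      have "4 * ?L + 2 * (real d + 4) * fatM d d / bad_const d \<le> real k0" unfolding k0_def
          by linarith
      then show ?thesis using kk by linarith
    qed
    have k1: "k \<ge> 1" using kk by (simp add: k0_def)
    have x0: "0 \<le> 2 * (real d + 4) * fatM d d / bad_const d" using M1 a0 by simp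
    have kL: "4 * ?L \<le> real k" using kr x0 by linarith
    have ek: "2 * (real d + 4) \<le> sparse_bound d r * real k" if "r < d" for r
    proof -
      have Mr: "fatM d r \<ge> 1" "fatM d r \<le> fatM d d"
          using fatM_ge(1)[OF d, of r] fatM_le[OF d, of r] that by auto
      have "2 * (real d + 4) * fatM d r \<le> 2 * (real d + 4) * fatM d d" using Mr
          by (intro mult_left_mono) auto
      also have "\<dots> \<le> bad_const d * real k"
      proof -
        have "2 * (real d + 4) * fatM d d / bad_const d \<le> real k" using kr L0 by linarith
        then show ?thesis using a0 by (simp add: pos_divide_le_eq mult.commute)
      qed
      finally show ?thesis unfolding sparse_bound_def using Mr by (simp add: pos_le_divide_eq)
    qed
    let ?P = "\<lambda>n. iid_determinantal_hypertrees n d k"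
    let ?g = "\<lambda>n. measure (?P n) {T\<in>space (?P n). good_sample n d k (sparse_bound d) (fat_eps d) ?L
        T}"
    have lim: "?g \<longlonglongrightarrow> 1"
      by (rule good_sample_whp[OF d k1 sparse_bound_bounds[OF d] ek fat_eps_def L0 kL])
    show "(\<lambda>n. measure (?P n) {T \<in> space (?P n). coboundary_expansion d (hypertree_union n d k T) \<ge>
        expansion_const d}) \<longlonglongrightarrow> 1"
    proof (rule tendsto_sandwich[OF _ _ lim tendsto_const])
      show "\<forall>\<^sub>F n in sequentially. ?g n \<le> measure (?P n) {T \<in> space (?P n). coboundary_expansion d
          (hypertree_union n d k T) \<ge> expansion_const d}"
      proof (rule eventually_sequentiallyI[of "2 * d + 2"])
        fix n assume n: "2 * d + 2 \<le> n"
        then interpret prob_space "?P n" by (intro prob_space_iid) (use d in auto)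
        show "?g n \<le> measure (?P n) {T \<in> space (?P n). coboundary_expansion d (hypertree_union n d k
            T) \<ge> expansion_const d}"
        proof (rule finite_measure_mono)
          show "{T\<in>space (?P n). good_sample n d k (sparse_bound d) (fat_eps d) ?L T} \<subseteq>
            {T \<in> space (?P n). coboundary_expansion d (hypertree_union n d k T) \<ge> expansion_const
                d}"
          proof safe
            fix T assume T: "T \<in> space (?P n)" and g: "good_sample n d k (sparse_bound d) (fat_eps
                d) ?L T"
            have "hypertree n d (T j)" if "j \<in> {1..k}" for j using T that unfolding space_iid
                by (auto simp: PiE_def Pi_def)
            then show "coboundary_expansion d (hypertree_union n d k T) \<ge> expansion_const d"
              by (rule good_sample_expansion[OF d n k1 _ g])
          qed
        qed (rule sets_iid, blast)
      qed
      show "\<forall>\<^sub>F n in sequentially. measure (?P n) {T \<in> space (?P n). coboundary_expansion d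
          (hypertree_union n d k T) \<ge> expansion_const d} \<le> 1"
      proof (rule eventually_sequentiallyI[of "2 * d + 2"])
        fix n assume n: "2 * d + 2 \<le> n"
        then interpret prob_space "?P n" by (intro prob_space_iid) (use d in auto)
        show "measure (?P n) {T \<in> space (?P n). coboundary_expansion d (hypertree_union n d k T) \<ge>
            expansion_const d} \<le> 1"
          by (rule prob_le_1)
      qed
    qed
  qed
qed

end
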